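(* Let $p$ be a prime number, let $X$ be a locally Noetherian $\mathbb{F}_p$-scheme, and let $\mathcal{b}_\bullet=\{\mathcal{b}_{p^e}\}_{e=1}^\infty$ be a $p$-system of ideal sheaves over $X$. Then $*\mathcal{b}_\bullet$ (that is, $\mathcal{b}_\bullet$-tight closure) is a glueable preclosure operation on submodules over $X$.
   Context: Rings are commutative with $1$; $q,q'$ denote powers of $p$. For a ring $R$, $R^\circ$ is the complement of the union of the minimal primes of $R$. For an ideal $I$ of an $\mathbb{F}_p$-algebra, $I^{[q]}$ is the ideal generated by the $q$-th powers of elements of $I$. For $R$-modules $L\subseteq M$ over an $\mathbb{F}_p$-algebra $R$, $z\in M$, $q=p^e$: $F^e(M)$ is the base change of $M$ along the $e$-th iterated Frobenius $R\to R$, $z^q_M=1\otimes z\in F^e(M)$, and $L^{[q]}_M$ is the image of $F^e(L)\to F^e(M)$. A $p$-system of ideals of $R$ is a sequence of ideals $\mathfrak{b}_\bullet=\{\mathfrak{b}_{p^e}\}_{e=1}^\infty$ with $\mathfrak{b}_q\mathfrak{b}_{q'}^{[q]}\subseteq\mathfrak{b}_{qq'}$ for all $q,q'$. For $R$ Noetherian and $R$-modules $L\subseteq M$, $L^{*\mathfrak{b}_\bullet}_M$ is the set of $z\in M$ for which there are $c\in R^\circ$ and a power $q_0$ of $p$ with $c\,\mathfrak{b}_q z^q_M\subseteq L^{[q]}_M$ for all $q\ge q_0$. A $p$-system of ideal sheaves over $X$ is a sequence $\mathcal{b}_\bullet$ of quasi-coherent ideal sheaves such that for every affine open $U\subseteq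 X$ (equivalently, for all members of some affine open cover), $\mathcal{b}(U)_\bullet:=\{\mathcal{b}_{p^e}(U)\}_{e=1}^\infty$ is a $p$-system of ideals of $\mathcal{O}_X(U)$. For $U$ affine open and $\mathcal{O}_X(U)$-modules $L\subseteq M$, set $L^{*\mathcal{b}_\bullet}_M:=L^{*\mathcal{b}(U)_\bullet}_M$. A preclosure operation $\mathrm{cl}$ on submodules over $X$ gives, for every affine open $U\subseteq X$ and every $\mathcal{O}_X(U)$-module $M$, an extensive ($L\subseteq L^{\mathrm{cl}}_M$) and order-preserving map $L\mapsto L^{\mathrm{cl}}_M$ from the $\mathcal{O}_X(U)$-submodules of $M$ to themselves. It is openly persistent if for all affine opens $V\subseteq U\subseteq X$, $R=\mathcal{O}_X(U)$, $S=\mathcal{O}_X(V)$, all $R$-modules $L\subseteq M$ and $x\in L^{\mathrm{cl}}_M$, we have $x\otimes1\in(LS)^{\mathrm{cl}}_{M\otimes_RS}$, with $LS$ the image of $L\otimes_RS\to M\otimes_RS$. It is glueable over $X$ if it is openly persistent and for every affine open $\operatorname{Spec}R\subseteq X$: whenever $I$ is an ideal of $R$ generated by $(f_\alpha)_{\alpha\in A}$, $g\in\sqrt I$, $L\subseteq M$ are $R$-modules, and $z\in M$ satisfies $z/1\in(L_{f_\alpha})^{\mathrm{cl}}_{M_{f_\alpha}}$ for all $\alpha\in A$, it follows that $z/1\in(L_g)^{\mathrm{cl}}_{M_g}$. *)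

theory Defs
  imports
    "HOL-Computational_Algebra.Primes"
    "HOL-Analysis.Abstract_Topology"
    "HOL-Algebra.Ring_Divisibility"
    "HOL-Algebra.Ideal_Product"
    "HOL-Algebra.Module"
begin

section \<open>Modules: linear isomorphisms, quotients, localization, base change\<close>

text \<open>The type of modules is an extension of the type of rings. The fields \<open>mult\<close> and \<open>one\<close>
  of a module play no role and are left \<^const>\<open>undefined\<close> in the constructions below.\<close>

definition mod_iso ::
  "('r, 'x) ring_scheme \<Rightarrow> ('r, 'm, 'y) module_scheme \<Rightarrow> ('r, 'n, 'z) module_scheme \<Rightarrow> ('m \<Rightarrow> 'n) set"
  where "mod_iso R M N = {h. bij_betw h (carrier M) (carrier N)
      \<and> (\<forall>x \<in> carrier M. \<forall>y \<in> carrier M. h (x \<oplus>\<^bsub>M\<^esub> y) = h x \<oplus>\<^bsub>N\<^esub> h y)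
      \<and> (\<forall>r \<in> carrier R. \<forall>x \<in> carrier M. h (r \<odot>\<^bsub>M\<^esub> x) = r \<odot>\<^bsub>N\<^esub> h x)}"

definition restrict_scalars :: "('r \<Rightarrow> 's) \<Rightarrow> ('s, 'm) module \<Rightarrow> ('r, 'm) module"
  where "restrict_scalars h N = \<lparr>carrier = carrier N, monoid.mult = undefined, one = undefined,
      zero = \<zero>\<^bsub>N\<^esub>, add = add N, smult = (\<lambda>r n. h r \<odot>\<^bsub>N\<^esub> n)\<rparr>"

definition regular_module :: "'r ring \<Rightarrow> ('r, 'r) module"
  where "regular_module R = \<lparr>carrier = carrier R, monoid.mult = undefined, one = undefined,
      zero = \<zero>\<^bsub>R\<^esub>, add = add R, smult = monoid.mult R\<rparr>"

definition gen_submodule ::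
  "('r, 'x) ring_scheme \<Rightarrow> ('r, 'm, 'y) module_scheme \<Rightarrow> 'm set \<Rightarrow> 'm set"
  where "gen_submodule R M A = \<Inter>{H. submodule H R M \<and> A \<subseteq> H}"

definition quot_module :: "('r, 'm) module \<Rightarrow> 'm set \<Rightarrow> ('r, 'm set) module"
  where "quot_module M H = \<lparr>carrier = a_rcosets\<^bsub>M\<^esub> H, monoid.mult = undefined, one = undefined,
      zero = H, add = set_add M, smult = (\<lambda>r X. \<Union>x\<in>X. H +>\<^bsub>M\<^esub> (r \<odot>\<^bsub>M\<^esub> x))\<rparr>"

text \<open>The fraction \<open>m/s\<close> with \<open>s\<close> in a multiplicative subset \<open>T\<close> of \<open>R\<close>, as the class of all
  \<open>(n, t)\<close> with \<open>m/s = n/t\<close>.\<close>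

definition fraction ::
  "'r ring \<Rightarrow> 'r set \<Rightarrow> ('r, 'm) module \<Rightarrow> 'm \<Rightarrow> 'r \<Rightarrow> ('m \<times> 'r) set"
  where "fraction R T M m s = {(n, t). n \<in> carrier M \<and> t \<in> T
      \<and> (\<exists>u \<in> T. u \<odot>\<^bsub>M\<^esub> (t \<odot>\<^bsub>M\<^esub> m) = u \<odot>\<^bsub>M\<^esub> (s \<odot>\<^bsub>M\<^esub> n))}"

definition loc_module :: "'r ring \<Rightarrow> 'r set \<Rightarrow> ('r, 'm) module \<Rightarrow> ('r, ('m \<times> 'r) set) module"
  where "loc_module R T M = \<lparr>
      carrier = {fraction R T M m s | m s. m \<in> carrier M \<and> s \<in> T},
      monoid.mult = undefined, one = undefined,
      zero = fraction R T M \<zero>\<^bsub>M\<^esub> \<one>\<^bsub>R\<^esub>,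
      add = (\<lambda>x y. \<Union>(m, s)\<in>x. \<Union>(n, t)\<in>y.
               fraction R T M (t \<odot>\<^bsub>M\<^esub> m \<oplus>\<^bsub>M\<^esub> s \<odot>\<^bsub>M\<^esub> n) (s \<otimes>\<^bsub>R\<^esub> t)),
      smult = (\<lambda>r x. \<Union>(m, s)\<in>x. fraction R T M (r \<odot>\<^bsub>M\<^esub> m) s)\<rparr>"

definition loc_submodule :: "'r ring \<Rightarrow> 'r set \<Rightarrow> ('r, 'm) module \<Rightarrow> 'm set \<Rightarrow> ('m \<times> 'r) set set"
  where "loc_submodule R T M L = {fraction R T M m s | m s. m \<in> L \<and> s \<in> T}"

definition powers :: "'r ring \<Rightarrow> 'r \<Rightarrow> 'r set"
  where "powers R f = {f [^]\<^bsub>R\<^esub> n | n :: nat. True}"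

definition loc_ring :: "'r ring \<Rightarrow> 'r set \<Rightarrow> ('r \<times> 'r) set ring"
  where "loc_ring R T = (let M = regular_module R in \<lparr>
      carrier = carrier (loc_module R T M),
      monoid.mult = (\<lambda>x y. \<Union>(a, s)\<in>x. \<Union>(b, t)\<in>y. fraction R T M (a \<otimes>\<^bsub>R\<^esub> b) (s \<otimes>\<^bsub>R\<^esub> t)),
      one = fraction R T M \<one>\<^bsub>R\<^esub> \<one>\<^bsub>R\<^esub>,
      zero = zero (loc_module R T M),
      add = add (loc_module R T M)\<rparr>)"

text \<open>For a ring homomorphism \<open>h : R \<rightarrow> S\<close> and an \<open>R\<close>-module \<open>M\<close>, the base change \<open>S \<otimes>\<^sub>R M\<close>
  is built as the free \<open>S\<close>-module on the elements of \<open>M\<close> (the basis element \<open>[m]\<close> standing for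
  \<open>1 \<otimes> m\<close>) modulo the submodule generated by all \<open>[m + n] - [m] - [n]\<close> and
  \<open>[r m] - h r [m]\<close>. Elements of the free module are finitely supported functions that vanish
  outside \<open>carrier M\<close>.\<close>

definition free_module :: "'s ring \<Rightarrow> 'm set \<Rightarrow> ('s, 'm \<Rightarrow> 's) module"
  where "free_module S B = \<lparr>
      carrier = {f. (\<forall>m. f m \<in> carrier S) \<and> (\<forall>m. m \<notin> B \<longrightarrow> f m = \<zero>\<^bsub>S\<^esub>)
                    \<and> finite {m. f m \<noteq> \<zero>\<^bsub>S\<^esub>}},
      monoid.mult = undefined, one = undefined,
      zero = (\<lambda>m. \<zero>\<^bsub>S\<^esub>),
      add = (\<lambda>f g m. f m \<oplus>\<^bsub>S\<^esub> g m),
      smult = (\<lambda>s f m. s \<otimes>\<^bsub>S\<^esub> f m)\<rparr>"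

definition basis_elt :: "'s ring \<Rightarrow> 'm \<Rightarrow> 'm \<Rightarrow> 's"
  where "basis_elt S m = (\<lambda>n. if n = m then \<one>\<^bsub>S\<^esub> else \<zero>\<^bsub>S\<^esub>)"

definition base_change_rel ::
  "'r ring \<Rightarrow> 's ring \<Rightarrow> ('r \<Rightarrow> 's) \<Rightarrow> ('r, 'm) module \<Rightarrow> ('m \<Rightarrow> 's) set"
  where "base_change_rel R S h M = (let F = free_module S (carrier M) in gen_submodule S F
      ({basis_elt S (m \<oplus>\<^bsub>M\<^esub> n) \<ominus>\<^bsub>F\<^esub> (basis_elt S m \<oplus>\<^bsub>F\<^esub> basis_elt S n)
          | m n. m \<in> carrier M \<and> n \<in> carrier M}
       \<union> {basis_elt S (r \<odot>\<^bsub>M\<^esub> m) \<ominus>\<^bsub>F\<^esub> (h r \<odot>\<^bsub>F\<^esub> basis_elt S m)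
          | r m. r \<in> carrier R \<and> m \<in> carrier M}))"

definition base_change ::
  "'r ring \<Rightarrow> 's ring \<Rightarrow> ('r \<Rightarrow> 's) \<Rightarrow> ('r, 'm) module \<Rightarrow> ('s, ('m \<Rightarrow> 's) set) module"
  where "base_change R S h M =
    quot_module (free_module S (carrier M)) (base_change_rel R S h M)"

text \<open>The element \<open>1 \<otimes> m\<close>.\<close>

definition base_change_elt ::
  "'r ring \<Rightarrow> 's ring \<Rightarrow> ('r \<Rightarrow> 's) \<Rightarrow> ('r, 'm) module \<Rightarrow> 'm \<Rightarrow> ('m \<Rightarrow> 's) set"
  where "base_change_elt R S h M m =
    base_change_rel R S h M +>\<^bsub>free_module S (carrier M)\<^esub> basis_elt S m"

text \<open>For a submodule \<open>L\<close> of \<open>M\<close>, the map \<open>S \<otimes>\<^sub>R L \<rightarrow> S \<otimes>\<^sub>R M\<close> induced by the inclusion, and its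
  image. The free module on \<open>L\<close> is literally contained in the free module on \<open>M\<close>.\<close>

definition base_change_incl ::
  "'r ring \<Rightarrow> 's ring \<Rightarrow> ('r \<Rightarrow> 's) \<Rightarrow> ('r, 'm) module \<Rightarrow> ('m \<Rightarrow> 's) set \<Rightarrow> ('m \<Rightarrow> 's) set"
  where "base_change_incl R S h M x =
    (\<Union>f\<in>x. base_change_rel R S h M +>\<^bsub>free_module S (carrier M)\<^esub> f)"

definition base_change_image ::
  "'r ring \<Rightarrow> 's ring \<Rightarrow> ('r \<Rightarrow> 's) \<Rightarrow> ('r, 'm) module \<Rightarrow> 'm set \<Rightarrow> ('m \<Rightarrow> 's) set set"
  where "base_change_image R S h M L =
    base_change_incl R S h M ` carrier (base_change R S h (M\<lparr>carrier := L\<rparr>))"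


section \<open>Ideals and tight closure over a ring\<close>

definition minimal_primes :: "'r ring \<Rightarrow> 'r set set"
  where "minimal_primes R =
    {P. primeideal P R \<and> (\<forall>Q. primeideal Q R \<and> Q \<subseteq> P \<longrightarrow> Q = P)}"

definition off_minimal_primes :: "'r ring \<Rightarrow> 'r set"
  where "off_minimal_primes R = carrier R - \<Union>(minimal_primes R)"

definition radical :: "'r ring \<Rightarrow> 'r set \<Rightarrow> 'r set"
  where "radical R I = {g \<in> carrier R. \<exists>n :: nat. g [^]\<^bsub>R\<^esub> n \<in> I}"

definition frobenius_power :: "'r ring \<Rightarrow> nat \<Rightarrow> 'r set \<Rightarrow> 'r set"
  where "frobenius_power R q I = Idl\<^bsub>R\<^esub> ((\<lambda>x. x [^]\<^bsub>R\<^esub> q) ` I)"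

text \<open>Sequences indexed by the powers \<open>p\<^sup>e\<close> with \<open>e \<ge> 1\<close> are indexed by the exponent \<open>e\<close>;
  the value at \<open>e = 0\<close> is ignored.\<close>

definition p_system :: "nat \<Rightarrow> 'r ring \<Rightarrow> (nat \<Rightarrow> 'r set) \<Rightarrow> bool"
  where "p_system p R b \<longleftrightarrow> (\<forall>e\<ge>1. ideal (b e) R)
    \<and> (\<forall>e\<ge>1. \<forall>e'\<ge>1. ideal_prod R (b e) (frobenius_power R (p ^ e) (b e')) \<subseteq> b (e + e'))"

definition frob_iter :: "nat \<Rightarrow> nat \<Rightarrow> 'r ring \<Rightarrow> 'r \<Rightarrow> 'r"
  where "frob_iter p e R x = x [^]\<^bsub>R\<^esub> (p ^ e)"

definition tight_closure ::
  "nat \<Rightarrow> 'r ring \<Rightarrow> (nat \<Rightarrow> 'r set) \<Rightarrow> ('r, 'm) module \<Rightarrow> 'm set \<Rightarrow> 'm set"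
  where "tight_closure p R b M L = {z \<in> carrier M.
    \<exists>c \<in> off_minimal_primes R. \<exists>e0. \<forall>e\<ge>1. e0 \<le> e \<longrightarrow>
      (\<forall>a \<in> b e. (c \<otimes>\<^bsub>R\<^esub> a) \<odot>\<^bsub>base_change R R (frob_iter p e R) M\<^esub>
                    base_change_elt R R (frob_iter p e R) M z
                  \<in> base_change_image R R (frob_iter p e R) M L)}"


section \<open>Schemes\<close>

record ('a, 'r) ringed_space =
  space_of :: "'a topology"
  sections :: "'a set \<Rightarrow> 'r ring"
  res :: "'a set \<Rightarrow> 'a set \<Rightarrow> 'r \<Rightarrow> 'r"
    \<comment> \<open>\<open>res X U V\<close> is the restriction of sections from \<open>U\<close> to \<open>V \<subseteq> U\<close>\<close>

definition ringed_space :: "('a, 'r) ringed_space \<Rightarrow> bool"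
  where "ringed_space X \<longleftrightarrow>
    (\<forall>U. openin (space_of X) U \<longrightarrow> cring (sections X U))
  \<and> (\<forall>U V. openin (space_of X) U \<and> openin (space_of X) V \<and> V \<subseteq> U \<longrightarrow>
        res X U V \<in> ring_hom (sections X U) (sections X V))
  \<and> (\<forall>U. openin (space_of X) U \<longrightarrow> (\<forall>s \<in> carrier (sections X U). res X U U s = s))
  \<and> (\<forall>U V W. openin (space_of X) U \<and> openin (space_of X) V \<and> openin (space_of X) W
        \<and> W \<subseteq> V \<and> V \<subseteq> U \<longrightarrow>
        (\<forall>s \<in> carrier (sections X U). res X V W (res X U V s) = res X U W s))
  \<and> (\<forall>C. (\<forall>V \<in> C. openin (space_of X) V) \<longrightarrow>
        (\<forall>s \<in> carrier (sections X (\<Union>C)). \<forall>t \<in> carrier (sections X (\<Union>C)).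
          (\<forall>V \<in> C. res X (\<Union>C) V s = res X (\<Union>C) V t) \<longrightarrow> s = t))
  \<and> (\<forall>C s. (\<forall>V \<in> C. openin (space_of X) V \<and> s V \<in> carrier (sections X V))
        \<and> (\<forall>V \<in> C. \<forall>W \<in> C. res X V (V \<inter> W) (s V) = res X W (V \<inter> W) (s W)) \<longrightarrow>
        (\<exists>t \<in> carrier (sections X (\<Union>C)). \<forall>V \<in> C. res X (\<Union>C) V t = s V))"

definition restrict_space :: "('a, 'r) ringed_space \<Rightarrow> 'a set \<Rightarrow> ('a, 'r) ringed_space"
  where "restrict_space X U = X\<lparr>space_of := subtopology (space_of X) U\<rparr>"

definition ringed_iso :: "('a, 'r) ringed_space \<Rightarrow> ('b, 's) ringed_space \<Rightarrow> bool"
  where "ringed_iso X Y \<longleftrightarrow> (\<exists>\<phi> \<theta>.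
     homeomorphic_map (space_of X) (space_of Y) \<phi>
   \<and> (let pre = (\<lambda>V. {x \<in> topspace (space_of X). \<phi> x \<in> V}) in
       (\<forall>V. openin (space_of Y) V \<longrightarrow> \<theta> V \<in> ring_iso (sections Y V) (sections X (pre V)))
     \<and> (\<forall>V W. openin (space_of Y) V \<and> openin (space_of Y) W \<and> W \<subseteq> V \<longrightarrow>
          (\<forall>s \<in> carrier (sections Y V). res X (pre V) (pre W) (\<theta> V s) = \<theta> W (res Y V W s)))))"

definition Spec_topology :: "'r ring \<Rightarrow> 'r set topology"
  where "Spec_topology A =
    topology (\<lambda>U. \<exists>S \<subseteq> carrier A. U = {P. primeideal P A \<and> \<not> S \<subseteq> P})"

lemma istopology_Spec:
  "istopology (\<lambda>U. \<exists>S \<subseteq> carrier A. U = {P. primeideal P A \<and> \<not> S \<subseteq> P})"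
  unfolding istopology_def
proof (intro conjI allI impI)
  fix U V
  assume "\<exists>S \<subseteq> carrier A. U = {P. primeideal P A \<and> \<not> S \<subseteq> P}"
    and "\<exists>S \<subseteq> carrier A. V = {P. primeideal P A \<and> \<not> S \<subseteq> P}"
  then obtain S T where S: "S \<subseteq> carrier A" "U = {P. primeideal P A \<and> \<not> S \<subseteq> P}"
    and T: "T \<subseteq> carrier A" "V = {P. primeideal P A \<and> \<not> T \<subseteq> P}"
    by blast
  let ?ST = "{s \<otimes>\<^bsub>A\<^esub> t | s t. s \<in> S \<and> t \<in> T}"
  have mem: "s \<otimes>\<^bsub>A\<^esub> t \<in> P \<longleftrightarrow> s \<in> P \<or> t \<in> P"
    if "primeideal P A" "s \<in> carrier A" "t \<in> carrier A" for P s t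
  proof -
    interpret primeideal P A by fact
    show ?thesis using that I_prime I_l_closed I_r_closed by blast
  qed
  show "\<exists>S \<subseteq> carrier A. U \<inter> V = {P. primeideal P A \<and> \<not> S \<subseteq> P}"
  proof (cases "U \<inter> V = {}")
    case True
    then show ?thesis by (intro exI[of _ "{}"]) auto
  next
    case False
    then obtain Q where "primeideal Q A" using S by auto
    then interpret primeideal Q A .
    have "?ST \<subseteq> carrier A" using S T by auto
    moreover have "U \<inter> V = {P. primeideal P A \<and> \<not> ?ST \<subseteq> P}"
    proof (rule Set.set_eqI)
      fix P
      show "P \<in> U \<inter> V \<longleftrightarrow> P \<in> {P. primeideal P A \<and> \<not> ?ST \<subseteq> P}"
      proof (cases "primeideal P A")
        case prime: True
        have "\<not> ?ST \<subseteq> P \<longleftrightarrow> (\<exists>s\<in>S. \<exists>t\<in>T. s \<otimes>\<^bsub>A\<^esub> t \<notin> P)" by blast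
        also have "\<dots> \<longleftrightarrow> (\<exists>s\<in>S. \<exists>t\<in>T. s \<notin> P \<and> t \<notin> P)"
          using mem[OF prime] S(1) T(1) by (meson subsetD)
        finally show ?thesis using S(2) T(2) prime by blast
      qed (use S(2) in blast)
    qed
    ultimately show ?thesis by blast
  qed
next
  fix K
  assume K: "\<forall>U\<in>K. \<exists>S \<subseteq> carrier A. U = {P. primeideal P A \<and> \<not> S \<subseteq> P}"
  let ?S = "\<Union>{S. S \<subseteq> carrier A \<and> {P. primeideal P A \<and> \<not> S \<subseteq> P} \<in> K}"
  have "?S \<subseteq> carrier A" by blast
  moreover have "\<Union>K = {P. primeideal P A \<and> \<not> ?S \<subseteq> P}"
  proof (rule Set.set_eqI)
    fix P
    show "P \<in> \<Union>K \<longleftrightarrow> P \<in> {P. primeideal P A \<and> \<not> ?S \<subseteq> P}"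
    proof
      assume "P \<in> \<Union>K"
      then obtain U where U: "U \<in> K" "P \<in> U" by blast
      with K obtain S where S: "S \<subseteq> carrier A" "U = {P. primeideal P A \<and> \<not> S \<subseteq> P}" by blast
      with U show "P \<in> {P. primeideal P A \<and> \<not> ?S \<subseteq> P}" by blast
    qed blast
  qed
  ultimately show "\<exists>S \<subseteq> carrier A. \<Union>K = {P. primeideal P A \<and> \<not> S \<subseteq> P}" by blast
qed

text \<open>The localization \<open>A\<^sub>P\<close> and the structure sheaf of \<open>Spec A\<close>: sections are the functions into
  the localizations that are locally given by fractions of elements of \<open>A\<close>.\<close>

definition loc_at :: "'r ring \<Rightarrow> 'r set \<Rightarrow> ('r \<times> 'r) set ring"
  where "loc_at A P = loc_ring A (carrier A - P)"

definition Spec_sections :: "'r ring \<Rightarrow> 'r set set \<Rightarrow> ('r set \<Rightarrow> ('r \<times> 'r) set) ring"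
  where "Spec_sections A U = \<lparr>
      carrier = {s \<in> (\<Pi>\<^sub>E P\<in>U. carrier (loc_at A P)).
        \<forall>P \<in> U. \<exists>V. openin (Spec_topology A) V \<and> P \<in> V \<and> V \<subseteq> U
          \<and> (\<exists>a \<in> carrier A. \<exists>f \<in> carrier A. \<forall>Q \<in> V. f \<notin> Q
              \<and> s Q = fraction A (carrier A - Q) (regular_module A) a f)},
      monoid.mult = (\<lambda>s t. \<lambda>P\<in>U. s P \<otimes>\<^bsub>loc_at A P\<^esub> t P),
      one = (\<lambda>P\<in>U. \<one>\<^bsub>loc_at A P\<^esub>),
      zero = (\<lambda>P\<in>U. \<zero>\<^bsub>loc_at A P\<^esub>),
      add = (\<lambda>s t. \<lambda>P\<in>U. s P \<oplus>\<^bsub>loc_at A P\<^esub> t P)\<rparr>"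

definition Spec :: "'r ring \<Rightarrow> ('r set, 'r set \<Rightarrow> ('r \<times> 'r) set) ringed_space"
  where "Spec A = \<lparr>space_of = Spec_topology A, sections = Spec_sections A,
      res = (\<lambda>U V s. restrict s V)\<rparr>"

text \<open>Schemes are defined as in the first edition of EGA I: a ringed space that is locally
  isomorphic, as a ringed space, to spectra. The stalks are then automatically local, and an
  isomorphism of ringed spaces between locally ringed spaces is automatically local.

  In \<open>affine_open\<close>, \<open>A\<close> may be taken over the type of sections since \<open>A\<close> is isomorphic to
  the ring of sections over \<open>U\<close>.\<close>

definition affine_open :: "('a, 'r) ringed_space \<Rightarrow> 'a set \<Rightarrow> bool"
  where "affine_open X U \<longleftrightarrow> openin (space_of X) U
    \<and> (\<exists>A :: 'r ring. cring A \<and> ringed_iso (restrict_space X U) (Spec A))"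

definition scheme :: "('a, 'r) ringed_space \<Rightarrow> bool"
  where "scheme X \<longleftrightarrow> ringed_space X
    \<and> (\<forall>x \<in> topspace (space_of X). \<exists>U. x \<in> U \<and> affine_open X U)"

definition locally_noetherian :: "('a, 'r) ringed_space \<Rightarrow> bool"
  where "locally_noetherian X \<longleftrightarrow> (\<forall>x \<in> topspace (space_of X).
    \<exists>U. x \<in> U \<and> affine_open X U \<and> noetherian_ring (sections X U))"

text \<open>A scheme has at most one morphism to the spectrum of the field with \<open>p\<close> elements, and it
  has one iff \<open>p = 0\<close> in its ring of global sections.\<close>

definition Fp_scheme :: "nat \<Rightarrow> ('a, 'r) ringed_space \<Rightarrow> bool"
  where "Fp_scheme p X \<longleftrightarrow> scheme X
    \<and> (let R = sections X (topspace (space_of X)) in add_pow R p \<one>\<^bsub>R\<^esub> = \<zero>\<^bsub>R\<^esub>)"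

text \<open>For \<open>f\<close> in \<open>O\<^sub>X(U)\<close>, the open set of points of \<open>U\<close> near which \<open>f\<close> is invertible; this is the
  distinguished open set \<open>Spec R\<^sub>f\<close> if \<open>U = Spec R\<close>.\<close>

definition basic_open :: "('a, 'r) ringed_space \<Rightarrow> 'a set \<Rightarrow> 'r \<Rightarrow> 'a set"
  where "basic_open X U f = {x \<in> U. \<exists>W. openin (space_of X) W \<and> x \<in> W \<and> W \<subseteq> U
    \<and> res X U W f \<in> Units (sections X W)}"

definition ideal_sheaf :: "('a, 'r) ringed_space \<Rightarrow> ('a set \<Rightarrow> 'r set) \<Rightarrow> bool"
  where "ideal_sheaf X J \<longleftrightarrow>
    (\<forall>U. openin (space_of X) U \<longrightarrow> ideal (J U) (sections X U))
  \<and> (\<forall>U V. openin (space_of X) U \<and> openin (space_of X) V \<and> V \<subseteq> U \<longrightarrow> res X U V ` J U \<subseteq> J V)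
  \<and> (\<forall>C. (\<forall>V \<in> C. openin (space_of X) V) \<longrightarrow>
        (\<forall>s \<in> carrier (sections X (\<Union>C)). (\<forall>V \<in> C. res X (\<Union>C) V s \<in> J V) \<longrightarrow> s \<in> J (\<Union>C)))"

text \<open>\<open>J\<close> is quasi-coherent if for every affine open \<open>U\<close> and every \<open>f\<close> in \<open>R = O\<^sub>X(U)\<close> the
  restriction map from \<open>J(U)\<close> to \<open>J(U\<^sub>f)\<close> induces an isomorphism \<open>J(U)\<^sub>f \<rightarrow> J(U\<^sub>f)\<close>.\<close>

definition quasi_coherent_ideal_sheaf :: "('a, 'r) ringed_space \<Rightarrow> ('a set \<Rightarrow> 'r set) \<Rightarrow> bool"
  where "quasi_coherent_ideal_sheaf X J \<longleftrightarrow> ideal_sheaf X J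
  \<and> (\<forall>U. affine_open X U \<longrightarrow> (\<forall>f \<in> carrier (sections X U).
      let R = sections X U; V = basic_open X U f; T = powers R f;
          M = (regular_module R)\<lparr>carrier := J U\<rparr>;
          N = (regular_module (sections X V))\<lparr>carrier := J V\<rparr>
      in \<exists>\<theta> \<in> mod_iso R (loc_module R T M) (restrict_scalars (res X U V) N).
           \<forall>m \<in> J U. \<theta> (fraction R T M m \<one>\<^bsub>R\<^esub>) = res X U V m))"

text \<open>The sheaf with index \<open>e\<close> is the one belonging to \<open>p\<^sup>e\<close>.\<close>

definition p_system_of_ideal_sheaves ::
  "nat \<Rightarrow> ('a, 'r) ringed_space \<Rightarrow> (nat \<Rightarrow> 'a set \<Rightarrow> 'r set) \<Rightarrow> bool"
  where "p_system_of_ideal_sheaves p X b \<longleftrightarrow>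
    (\<forall>e\<ge>1. quasi_coherent_ideal_sheaf X (b e))
  \<and> (\<forall>U. affine_open X U \<longrightarrow> p_system p (sections X U) (\<lambda>e. b e U))"

definition sheaf_tight_closure ::
  "nat \<Rightarrow> ('a, 'r) ringed_space \<Rightarrow> (nat \<Rightarrow> 'a set \<Rightarrow> 'r set) \<Rightarrow>
    'a set \<Rightarrow> ('r, 'm) module \<Rightarrow> 'm set \<Rightarrow> 'm set"
  where "sheaf_tight_closure p X b U = tight_closure p (sections X U) (\<lambda>e. b e U)"


section \<open>Preclosure operations on submodules over a scheme\<close>

text \<open>The type \<open>'m\<close> of module elements plays the role of a universe: \<open>cl U M L\<close> is the closure of
  \<open>L\<close> in the \<open>O\<^sub>X(U)\<close>-module \<open>M\<close>, for all \<open>M\<close> with elements in \<open>'m\<close>.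
  Tensor products and localizations of \<open>M\<close> enter through arbitrary isomorphic copies \<open>N\<close>
  with elements in \<open>'m\<close>. Instantiating \<open>'m\<close> to a sum type covers modules \<open>M\<close> and \<open>N\<close>
  whose elements have different types.\<close>

definition preclosure_operation ::
  "('a, 'r) ringed_space \<Rightarrow> ('a set \<Rightarrow> ('r, 'm) module \<Rightarrow> 'm set \<Rightarrow> 'm set) \<Rightarrow> bool"
  where "preclosure_operation X cl \<longleftrightarrow>
    (\<forall>U M. affine_open X U \<and> module (sections X U) M \<longrightarrow>
      (\<forall>L. submodule L (sections X U) M \<longrightarrow>
          submodule (cl U M L) (sections X U) M \<and> L \<subseteq> cl U M L)
    \<and> (\<forall>L L'. submodule L (sections X U) M \<and> submodule L' (sections X U) M \<and> L \<subseteq> L' \<longrightarrow>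
          cl U M L \<subseteq> cl U M L'))"

definition openly_persistent ::
  "('a, 'r) ringed_space \<Rightarrow> ('a set \<Rightarrow> ('r, 'm) module \<Rightarrow> 'm set \<Rightarrow> 'm set) \<Rightarrow> bool"
  where "openly_persistent X cl \<longleftrightarrow>
    (\<forall>U V M L x N \<theta>.
      let R = sections X U; S = sections X V; h = res X U V in
      affine_open X U \<and> affine_open X V \<and> V \<subseteq> U
      \<and> module R M \<and> submodule L R M \<and> x \<in> cl U M L
      \<and> module S N \<and> \<theta> \<in> mod_iso S (base_change R S h M) N
      \<longrightarrow> \<theta> (base_change_elt R S h M x) \<in> cl V N (\<theta> ` base_change_image R S h M L))"

text \<open>\<open>\<theta>\<close> identifies the localization \<open>M\<^sub>f\<close> with the module \<open>N\<close> over \<open>O\<^sub>X(U\<^sub>f) = R\<^sub>f\<close>, where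
  \<open>U = Spec R\<close>. An \<open>R\<close>-linear map between \<open>R\<^sub>f\<close>-modules is \<open>R\<^sub>f\<close>-linear.\<close>

definition is_localization_at ::
  "('a, 'r) ringed_space \<Rightarrow> 'a set \<Rightarrow> 'r \<Rightarrow> ('r, 'm) module \<Rightarrow> ('r, 'n) module \<Rightarrow>
    (('m \<times> 'r) set \<Rightarrow> 'n) \<Rightarrow> bool"
  where "is_localization_at X U f M N \<theta> \<longleftrightarrow>
    (let R = sections X U; V = basic_open X U f in
      module (sections X V) N
    \<and> \<theta> \<in> mod_iso R (loc_module R (powers R f) M) (restrict_scalars (res X U V) N))"

text \<open>The condition \<open>z/1 \<in> (L\<^sub>f)\<^sup>c\<^sup>l\<close> in \<open>M\<^sub>f\<close>, expressed in the copy \<open>N\<close> of \<open>M\<^sub>f\<close>.\<close>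

definition in_closure_at ::
  "('a, 'r) ringed_space \<Rightarrow> ('a set \<Rightarrow> ('r, 'm) module \<Rightarrow> 'm set \<Rightarrow> 'm set) \<Rightarrow>
    'a set \<Rightarrow> 'r \<Rightarrow> ('r, 'm) module \<Rightarrow> 'm set \<Rightarrow> 'm \<Rightarrow> ('r, 'm) module \<Rightarrow>
    (('m \<times> 'r) set \<Rightarrow> 'm) \<Rightarrow> bool"
  where "in_closure_at X cl U f M L z N \<theta> \<longleftrightarrow>
    (let R = sections X U; T = powers R f in
      \<theta> (fraction R T M z \<one>\<^bsub>R\<^esub>) \<in> cl (basic_open X U f) N (\<theta> ` loc_submodule R T M L))"

text \<open>A family of generators \<open>(f\<^sub>\<alpha>)\<close> enters only through the set \<open>A\<close> of its members.\<close>

definition glueable ::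
  "('a, 'r) ringed_space \<Rightarrow> ('a set \<Rightarrow> ('r, 'm) module \<Rightarrow> 'm set \<Rightarrow> 'm set) \<Rightarrow> bool"
  where "glueable X cl \<longleftrightarrow> openly_persistent X cl
  \<and> (\<forall>U. affine_open X U \<longrightarrow> (let R = sections X U in
      \<forall>A I g M L z.
        A \<subseteq> carrier R \<and> I = Idl\<^bsub>R\<^esub> A \<and> g \<in> radical R I
        \<and> module R M \<and> submodule L R M \<and> z \<in> carrier M
        \<and> (\<forall>f \<in> A. \<exists>N \<theta>. is_localization_at X U f M N \<theta> \<and> in_closure_at X cl U f M L z N \<theta>)
        \<longrightarrow> (\<forall>N \<theta>. is_localization_at X U g M N \<theta> \<longrightarrow> in_closure_at X cl U g M L z N \<theta>)))"

end

(* Everything rests on comparing F^e(M)/L^[q] over R with its analogue over S. A map M -> N that is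
   semilinear over R -> S pushes relations s z^q in L^[q] forward; if N is the localization of M at T,
   then conversely a relation over S = T^-1 R pulls back to R after multiplication by an element of T.

   An inclusion V <= U of affine open sets is an isomorphism over every U_f <= V. Since these U_f
   cover V, ideal membership over O(V) can be tested after multiplication by powers of such f; this
   gives open persistence. It also sends O(U) off its minimal primes to O(V) off its minimal primes.

   For gluing, let a power of g lie in (f_1, ..., f_n). A multiplier c_i over R_{f_i} can be replaced
   by one that comes from an element of R outside all minimal primes of R; this is where the
   Noetherian hypothesis enters, via the finiteness of the set of minimal primes. With c the product
   of these elements, c a z^q is annihilated modulo L^[q] by powers of all the f_i, where the
   exponents depend on q and a, hence by a power of g. *)

theory Submission
  imports Defs
begin


subsection \<open>Submodules and quotients\<close>

text \<open>One asymmetry in the definition shapes the proof: the multiplier c must serve for all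
  large q at once, whereas clearing denominators costs a power of f that depends on q and on a in
  b_q. Such powers cannot be absorbed into c. They are removed by fixing q and a and looking at the
  ideal of all s with s c a z^q in L^[q]: membership of powers of generators passes to the radical
  of the ideal they generate, and to 1 if they generate 1.

  For c itself the difficulty is that the minimal primes of R containing f_i are invisible over
  R_{f_i}, so a multiplier that is good there may lie in some of them. It is corrected by a summand
  that vanishes in R_{f_i}.

  No isomorphism between T^-1 F^e(M) and F^e(T^-1 M) is constructed. Each direction of the
  comparison uses a single map given by the universal property of base change: into F^e(N) for
  pushing forward, and into T^-1 (F^e(M)/L^[q]) for pulling back.\<close>

lemma submodule_intro:
  assumes "module R M" "H \<subseteq> carrier M" "\<zero>\<^bsub>M\<^esub> \<in> H"
    and "\<And>a b. \<lbrakk>a \<in> H; b \<in> H\<rbrakk> \<Longrightarrow> a \<oplus>\<^bsub>M\<^esub> b \<in> H"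
    and smult: "\<And>a x. \<lbrakk>a \<in> carrier R; x \<in> H\<rbrakk> \<Longrightarrow> a \<odot>\<^bsub>M\<^esub> x \<in> H"
  shows "submodule H R M"
proof -
  interpret M: module R M by fact
  show ?thesis
  proof (rule M.submoduleI)
    fix a assume a: "a \<in> H"
    \<comment> \<open>Negatives come from the scalar -1.\<close>
    have "(\<ominus>\<^bsub>R\<^esub> \<one>\<^bsub>R\<^esub>) \<odot>\<^bsub>M\<^esub> a \<in> H" using a by (intro smult) auto
    moreover have "(\<ominus>\<^bsub>R\<^esub> \<one>\<^bsub>R\<^esub>) \<odot>\<^bsub>M\<^esub> a = \<ominus>\<^bsub>M\<^esub> a"
      using a assms(2) by (subst M.smult_l_minus) auto
    ultimately show "\<ominus>\<^bsub>M\<^esub> a \<in> H" by simp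
  qed (use assms in auto)
qed

lemma submodule_closed:
  assumes "module R M" "submodule H R M"
  shows "H \<subseteq> carrier M" "\<zero>\<^bsub>M\<^esub> \<in> H"
    and "\<And>a b. \<lbrakk>a \<in> H; b \<in> H\<rbrakk> \<Longrightarrow> a \<oplus>\<^bsub>M\<^esub> b \<in> H"
    and "\<And>a. a \<in> H \<Longrightarrow> \<ominus>\<^bsub>M\<^esub> a \<in> H"
    and "\<And>a x. \<lbrakk>a \<in> carrier R; x \<in> H\<rbrakk> \<Longrightarrow> a \<odot>\<^bsub>M\<^esub> x \<in> H"
proof -
  interpret M: module R M by fact
  interpret H: submodule H R M by fact
  show "H \<subseteq> carrier M" "\<And>a b. \<lbrakk>a \<in> H; b \<in> H\<rbrakk> \<Longrightarrow> a \<oplus>\<^bsub>M\<^esub> b \<in> H" "\<And>a. a \<in> H \<Longrightarrow> \<ominus>\<^bsub>M\<^esub> a \<in> H"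
    "\<And>a x. \<lbrakk>a \<in> carrier R; x \<in> H\<rbrakk> \<Longrightarrow> a \<odot>\<^bsub>M\<^esub> x \<in> H"
    using M.submoduleE[OF assms(2)] by auto
  show "\<zero>\<^bsub>M\<^esub> \<in> H" using H.one_closed by simp
qed

lemma gen_submodule_submodule:
  assumes "module R M" "A \<subseteq> carrier M"
  shows "submodule (gen_submodule R M A) R M"
proof (rule submodule_intro[OF assms(1)])
  interpret M: module R M by fact
  show "gen_submodule R M A \<subseteq> carrier M"
    unfolding gen_submodule_def using M.carrier_is_submodule assms(2) by blast
qed (auto simp: gen_submodule_def dest: submodule_closed[OF assms(1)])

lemma gen_submodule_superset: "A \<subseteq> gen_submodule R M A"
  unfolding gen_submodule_def by blast

lemma gen_submodule_least: "\<lbrakk>submodule H R M; A \<subseteq> H\<rbrakk> \<Longrightarrow> gen_submodule R M A \<subseteq> H"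
  unfolding gen_submodule_def by blast

lemma submodule_abelian_subgroup:
  assumes "module R M" "submodule H R M"
  shows "abelian_subgroup H M"
proof -
  interpret M: module R M by fact
  interpret H: submodule H R M by fact
  show ?thesis
    by (rule abelian_subgroupI3)
      (auto intro: additive_subgroup.intro H.subgroup_axioms M.abelian_group_axioms)
qed

lemma coset_eq_iff:
  assumes "module R M" "submodule H R M" "x \<in> carrier M" "y \<in> carrier M"
  shows "H +>\<^bsub>M\<^esub> x = H +>\<^bsub>M\<^esub> y \<longleftrightarrow> x \<oplus>\<^bsub>M\<^esub> \<ominus>\<^bsub>M\<^esub> y \<in> H"
proof -
  interpret abelian_subgroup H M by (rule submodule_abelian_subgroup[OF assms(1,2)])
  have "H +>\<^bsub>M\<^esub> x = H +>\<^bsub>M\<^esub> y \<longleftrightarrow> x \<in> H +>\<^bsub>M\<^esub> y"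
  proof
    assume "H +>\<^bsub>M\<^esub> x = H +>\<^bsub>M\<^esub> y"
    then have "H +>\<^bsub>M\<^esub> y = H +>\<^bsub>M\<^esub> x" ..
    then show "x \<in> H +>\<^bsub>M\<^esub> y" by (rule a_repr_independenceD[OF assms(3)])
  next
    assume "x \<in> H +>\<^bsub>M\<^esub> y"
    then have "H +>\<^bsub>M\<^esub> y = H +>\<^bsub>M\<^esub> x" using a_repr_independence' assms(4) by blast
    then show "H +>\<^bsub>M\<^esub> x = H +>\<^bsub>M\<^esub> y" ..
  qed
  then show ?thesis using a_rcos_module[OF assms(4,3)] by simp
qed

lemma coset_elem:
  assumes "module R M" "submodule H R M" "x \<in> carrier M" "y \<in> H +>\<^bsub>M\<^esub> x"
  shows "y \<in> carrier M" "H +>\<^bsub>M\<^esub> y = H +>\<^bsub>M\<^esub> x"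
proof -
  interpret abelian_subgroup H M by (rule submodule_abelian_subgroup[OF assms(1,2)])
  show "y \<in> carrier M" using assms(3,4) a_elemrcos_carrier by blast
  show "H +>\<^bsub>M\<^esub> y = H +>\<^bsub>M\<^esub> x" using a_repr_independence'[OF assms(4,3)] by simp
qed

lemma coset_self:
  assumes "module R M" "submodule H R M" "x \<in> carrier M"
  shows "x \<in> H +>\<^bsub>M\<^esub> x"
  using abelian_subgroup.a_rcos_self[OF submodule_abelian_subgroup[OF assms(1,2)]] assms(3) .

text \<open>Operations on classes in \<open>quot_module\<close>, \<open>loc_module\<close> and
  \<open>base_change_incl\<close> are unions over all representatives. Once the value is seen not to
  depend on the representative, the union collapses to it.\<close>

lemma UN_const_on: "\<lbrakk>X \<noteq> {}; \<And>x. x \<in> X \<Longrightarrow> f x = c\<rbrakk> \<Longrightarrow> (\<Union>x\<in>X. f x) = c"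
  by auto

section \<open>Quotient modules\<close>

lemma quot_module_carrier:
  "carrier (quot_module M H) = {H +>\<^bsub>M\<^esub> x | x. x \<in> carrier M}"
  by (auto simp: quot_module_def A_RCOSETS_def')

lemma quot_module_zero: "\<zero>\<^bsub>quot_module M H\<^esub> = H"
  by (simp add: quot_module_def)

lemma quot_module_add:
  assumes "module R M" "submodule H R M" "x \<in> carrier M" "y \<in> carrier M"
  shows "(H +>\<^bsub>M\<^esub> x) \<oplus>\<^bsub>quot_module M H\<^esub> (H +>\<^bsub>M\<^esub> y) = H +>\<^bsub>M\<^esub> (x \<oplus>\<^bsub>M\<^esub> y)"
  using abelian_subgroup.a_rcos_sum[OF submodule_abelian_subgroup[OF assms(1,2)] assms(3,4)]
  by (simp add: quot_module_def)

lemma quot_module_smult: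
  assumes "module R M" "submodule H R M" "r \<in> carrier R" "x \<in> carrier M"
  shows "r \<odot>\<^bsub>quot_module M H\<^esub> (H +>\<^bsub>M\<^esub> x) = H +>\<^bsub>M\<^esub> (r \<odot>\<^bsub>M\<^esub> x)"
proof -
  interpret M: module R M by fact
  have "(\<Union>y\<in>H +>\<^bsub>M\<^esub> x. H +>\<^bsub>M\<^esub> (r \<odot>\<^bsub>M\<^esub> y)) = H +>\<^bsub>M\<^esub> (r \<odot>\<^bsub>M\<^esub> x)"
  proof (rule UN_const_on)
    show "H +>\<^bsub>M\<^esub> x \<noteq> {}" using coset_self[OF assms(1,2,4)] by blast
    fix y assume "y \<in> H +>\<^bsub>M\<^esub> x"
    note y = coset_elem[OF assms(1,2,4) this]
    then have "y \<oplus>\<^bsub>M\<^esub> \<ominus>\<^bsub>M\<^esub> x \<in> H" using coset_eq_iff[OF assms(1,2) _ assms(4)] by simp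
    then have "r \<odot>\<^bsub>M\<^esub> (y \<oplus>\<^bsub>M\<^esub> \<ominus>\<^bsub>M\<^esub> x) \<in> H" using submodule_closed(5)[OF assms(1,2)] assms(3) by simp
    then have "r \<odot>\<^bsub>M\<^esub> y \<oplus>\<^bsub>M\<^esub> \<ominus>\<^bsub>M\<^esub> (r \<odot>\<^bsub>M\<^esub> x) \<in> H"
      using y assms by (simp add: M.smult_r_distr M.smult_r_minus)
    then show "H +>\<^bsub>M\<^esub> (r \<odot>\<^bsub>M\<^esub> y) = H +>\<^bsub>M\<^esub> (r \<odot>\<^bsub>M\<^esub> x)"
      using y assms by (subst coset_eq_iff[OF assms(1,2)]) auto
  qed
  then show ?thesis by (simp add: quot_module_def)
qed

lemma quot_module_module:
  assumes "module R M" "submodule H R M"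
  shows "module R (quot_module M H)"
proof -
  interpret M: module R M by fact
  note simps = quot_module_add[OF assms] quot_module_smult[OF assms] quot_module_zero
  \<comment> \<open>Written as the coset of 0, the zero element becomes accessible to the rules for
    cosets.\<close>
  have zero: "H = H +>\<^bsub>M\<^esub> \<zero>\<^bsub>M\<^esub>"
    using M.a_coset_add_zero submodule_closed(1)[OF assms] by simp
  show ?thesis
  proof (rule moduleI)
    show "cring R" by (rule M.R.is_cring)
    show "abelian_group (quot_module M H)"
    proof (rule abelian_groupI)
      show "\<zero>\<^bsub>quot_module M H\<^esub> \<in> carrier (quot_module M H)"
        using zero by (auto simp: quot_module_carrier quot_module_zero)
      fix X assume "X \<in> carrier (quot_module M H)"
      then obtain x where x: "x \<in> carrier M" "X = H +>\<^bsub>M\<^esub> x" by (auto simp: quot_module_carrier)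
      show "\<zero>\<^bsub>quot_module M H\<^esub> \<oplus>\<^bsub>quot_module M H\<^esub> X = X"
        unfolding quot_module_zero x
        by (subst zero, subst simps) (use x in auto)
      have "(H +>\<^bsub>M\<^esub> (\<ominus>\<^bsub>M\<^esub> x)) \<oplus>\<^bsub>quot_module M H\<^esub> X = \<zero>\<^bsub>quot_module M H\<^esub>"
        unfolding x quot_module_zero using x
        by (simp add: simps M.l_neg zero[symmetric])
      then show "\<exists>Y\<in>carrier (quot_module M H). Y \<oplus>\<^bsub>quot_module M H\<^esub> X = \<zero>\<^bsub>quot_module M H\<^esub>"
        using x by (auto simp: quot_module_carrier intro: exI[of _ "\<ominus>\<^bsub>M\<^esub> x"])
    next
      fix X Y assume "X \<in> carrier (quot_module M H)" "Y \<in> carrier (quot_module M H)"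
      then show "X \<oplus>\<^bsub>quot_module M H\<^esub> Y \<in> carrier (quot_module M H)"
        "X \<oplus>\<^bsub>quot_module M H\<^esub> Y = Y \<oplus>\<^bsub>quot_module M H\<^esub> X"
        by (auto simp: quot_module_carrier simps M.a_comm)
    qed (auto simp: quot_module_carrier simps M.a_assoc)
  qed (auto simp: quot_module_carrier simps M.smult_l_distr M.smult_r_distr M.smult_assoc1)
qed

subsection \<open>Semilinear maps\<close>

text \<open>\<open>h\<close> is an arbitrary function. It is the identity for linear maps, a ring
  homomorphism for localization maps, and \<open>frob_iter\<close> for z -> z^q.\<close>

definition semilinear ::
  "'r ring \<Rightarrow> ('r \<Rightarrow> 's) \<Rightarrow> ('r, 'm) module \<Rightarrow> ('s, 'n) module \<Rightarrow> ('m \<Rightarrow> 'n) set"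
  where "semilinear R h M N = {\<phi> \<in> carrier M \<rightarrow> carrier N.
      (\<forall>x \<in> carrier M. \<forall>y \<in> carrier M. \<phi> (x \<oplus>\<^bsub>M\<^esub> y) = \<phi> x \<oplus>\<^bsub>N\<^esub> \<phi> y)
      \<and> (\<forall>r \<in> carrier R. \<forall>x \<in> carrier M. \<phi> (r \<odot>\<^bsub>M\<^esub> x) = h r \<odot>\<^bsub>N\<^esub> \<phi> x)}"

lemma semilinearD:
  assumes "\<phi> \<in> semilinear R h M N"
  shows "\<And>x. x \<in> carrier M \<Longrightarrow> \<phi> x \<in> carrier N"
    and "\<And>x y. \<lbrakk>x \<in> carrier M; y \<in> carrier M\<rbrakk> \<Longrightarrow> \<phi> (x \<oplus>\<^bsub>M\<^esub> y) = \<phi> x \<oplus>\<^bsub>N\<^esub> \<phi> y"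
    and "\<And>r x. \<lbrakk>r \<in> carrier R; x \<in> carrier M\<rbrakk> \<Longrightarrow> \<phi> (r \<odot>\<^bsub>M\<^esub> x) = h r \<odot>\<^bsub>N\<^esub> \<phi> x"
  using assms unfolding semilinear_def by auto

lemma semilinear_zero:
  assumes "module R M" "module S N" "\<phi> \<in> semilinear R h M N"
  shows "\<phi> \<zero>\<^bsub>M\<^esub> = \<zero>\<^bsub>N\<^esub>"
proof -
  interpret M: module R M by fact
  interpret N: module S N by fact
  note \<phi> = semilinearD[OF assms(3)]
  have "\<phi> \<zero>\<^bsub>M\<^esub> \<oplus>\<^bsub>N\<^esub> \<phi> \<zero>\<^bsub>M\<^esub> = \<phi> \<zero>\<^bsub>M\<^esub>" using \<phi>(2)[of "\<zero>\<^bsub>M\<^esub>" "\<zero>\<^bsub>M\<^esub>"] by simp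
  then show ?thesis using \<phi>(1)[of "\<zero>\<^bsub>M\<^esub>"]
    by (metis M.M.zero_closed N.M.add.l_cancel_one')
qed

lemma semilinear_minus:
  assumes "module R M" "module S N" "\<phi> \<in> semilinear R h M N" "x \<in> carrier M"
  shows "\<phi> (\<ominus>\<^bsub>M\<^esub> x) = \<ominus>\<^bsub>N\<^esub> \<phi> x"
proof -
  interpret M: module R M by fact
  interpret N: module S N by fact
  note \<phi> = semilinearD[OF assms(3)]
  have "\<phi> (\<ominus>\<^bsub>M\<^esub> x) \<oplus>\<^bsub>N\<^esub> \<phi> x = \<phi> (\<ominus>\<^bsub>M\<^esub> x \<oplus>\<^bsub>M\<^esub> x)" using \<phi>(2)[of "\<ominus>\<^bsub>M\<^esub> x" x] assms(4) by simp
  also have "\<dots> = \<zero>\<^bsub>N\<^esub>" using semilinear_zero[OF assms(1-3)] assms(4) by (simp add: M.l_neg)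
  finally show ?thesis using \<phi>(1) assms(4) by (simp add: N.M.minus_equality)
qed

text \<open>Combined with \<open>gen_submodule_least\<close>, this reduces a claim about a generated
  submodule, such as \<open>rel\<close> or L^[q], to its generators. With H = 0 it shows that a map
  vanishes there.\<close>

lemma semilinear_vimage_submodule:
  assumes "module R M" "module S N" "h \<in> carrier R \<rightarrow> carrier S" "\<phi> \<in> semilinear R h M N"
    and "submodule H S N"
  shows "submodule {x \<in> carrier M. \<phi> x \<in> H} R M"
proof (rule submodule_intro[OF assms(1)])
  interpret M: module R M by fact
  note H = submodule_closed[OF assms(2,5)]
  note \<phi> = semilinearD[OF assms(4)]
  show "\<zero>\<^bsub>M\<^esub> \<in> {x \<in> carrier M. \<phi> x \<in> H}" using semilinear_zero[OF assms(1,2,4)] H by simp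
  show "a \<oplus>\<^bsub>M\<^esub> b \<in> {x \<in> carrier M. \<phi> x \<in> H}"
    if "a \<in> {x \<in> carrier M. \<phi> x \<in> H}" "b \<in> {x \<in> carrier M. \<phi> x \<in> H}" for a b
    using that \<phi> H by auto
  show "a \<odot>\<^bsub>M\<^esub> b \<in> {x \<in> carrier M. \<phi> x \<in> H}"
    if "a \<in> carrier R" "b \<in> {x \<in> carrier M. \<phi> x \<in> H}" for a b
    using that \<phi>(3) H(5) funcset_mem[OF assms(3)] by auto
qed auto

lemma quot_semilinear:
  assumes "module R M" "submodule H R M"
  shows "(\<lambda>x. H +>\<^bsub>M\<^esub> x) \<in> semilinear R (\<lambda>r. r) M (quot_module M H)"
  using quot_module_add[OF assms] quot_module_smult[OF assms]
  by (auto simp: semilinear_def quot_module_carrier)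

lemma restrict_scalars_module:
  assumes "module S N" "cring R" "h \<in> ring_hom R S"
  shows "module R (restrict_scalars h N)"
proof -
  interpret N: module S N by fact
  interpret R: cring R by fact
  show ?thesis
  proof (rule moduleI)
    show "abelian_group (restrict_scalars h N)"
    proof (rule abelian_groupI)
      fix x assume "x \<in> carrier (restrict_scalars h N)"
      then show "\<exists>y\<in>carrier (restrict_scalars h N). y \<oplus>\<^bsub>restrict_scalars h N\<^esub> x = \<zero>\<^bsub>restrict_scalars h N\<^esub>"
        by (auto simp: restrict_scalars_def intro!: bexI[of _ "\<ominus>\<^bsub>N\<^esub> x"] N.l_neg)
    qed (auto simp: restrict_scalars_def N.M.add.m_assoc N.M.add.m_comm N.M.add.m_lcomm)
  qed (use ring_hom_closed[OF assms(3)] ring_hom_add[OF assms(3)] ring_hom_mult[OF assms(3)]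
      ring_hom_one[OF assms(3)] in \<open>auto simp: restrict_scalars_def R.is_cring
        N.smult_l_distr N.smult_r_distr N.smult_assoc1\<close>)
qed


subsection \<open>Free modules and base change\<close>

lemma free_module_carrier:
  "f \<in> carrier (free_module S B) \<longleftrightarrow> (\<forall>m. f m \<in> carrier S) \<and> (\<forall>m. m \<notin> B \<longrightarrow> f m = \<zero>\<^bsub>S\<^esub>)
     \<and> finite {m. f m \<noteq> \<zero>\<^bsub>S\<^esub>}"
  by (simp add: free_module_def)

lemma free_module_ops:
  "\<zero>\<^bsub>free_module S B\<^esub> = (\<lambda>m. \<zero>\<^bsub>S\<^esub>)"
  "f \<oplus>\<^bsub>free_module S B\<^esub> g = (\<lambda>m. f m \<oplus>\<^bsub>S\<^esub> g m)"
  "s \<odot>\<^bsub>free_module S B\<^esub> f = (\<lambda>m. s \<otimes>\<^bsub>S\<^esub> f m)"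
  by (simp_all add: free_module_def)

lemma free_module_module:
  assumes "cring S"
  shows "module S (free_module S B)"
proof -
  interpret S: cring S by fact
  show ?thesis
  proof (rule moduleI)
    show "abelian_group (free_module S B)"
    proof (rule abelian_groupI)
      fix f g assume f: "f \<in> carrier (free_module S B)" and g: "g \<in> carrier (free_module S B)"
      have "{m. f m \<oplus>\<^bsub>S\<^esub> g m \<noteq> \<zero>\<^bsub>S\<^esub>} \<subseteq> {m. f m \<noteq> \<zero>\<^bsub>S\<^esub>} \<union> {m. g m \<noteq> \<zero>\<^bsub>S\<^esub>}" by auto
      then show "f \<oplus>\<^bsub>free_module S B\<^esub> g \<in> carrier (free_module S B)"
        using f g by (auto simp: free_module_carrier free_module_ops intro: finite_subset)
    next
      fix f assume f: "f \<in> carrier (free_module S B)"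
      have "{m. \<ominus>\<^bsub>S\<^esub> f m \<noteq> \<zero>\<^bsub>S\<^esub>} \<subseteq> {m. f m \<noteq> \<zero>\<^bsub>S\<^esub>}" by auto
      then have "(\<lambda>m. \<ominus>\<^bsub>S\<^esub> f m) \<in> carrier (free_module S B)"
        using f by (auto simp: free_module_carrier intro: finite_subset)
      then show "\<exists>g\<in>carrier (free_module S B). g \<oplus>\<^bsub>free_module S B\<^esub> f = \<zero>\<^bsub>free_module S B\<^esub>"
        using f by (intro bexI[of _ "\<lambda>m. \<ominus>\<^bsub>S\<^esub> f m"])
          (auto simp: free_module_carrier free_module_ops S.l_neg)
    qed (auto simp: free_module_carrier free_module_ops S.a_assoc S.a_comm S.a_lcomm)
  next
    fix s f assume "s \<in> carrier S" and f: "f \<in> carrier (free_module S B)"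
    moreover from this have "{m. s \<otimes>\<^bsub>S\<^esub> f m \<noteq> \<zero>\<^bsub>S\<^esub>} \<subseteq> {m. f m \<noteq> \<zero>\<^bsub>S\<^esub>}" by auto
    ultimately show "s \<odot>\<^bsub>free_module S B\<^esub> f \<in> carrier (free_module S B)"
      by (auto simp: free_module_carrier free_module_ops intro: finite_subset)
  qed (auto simp: assms free_module_carrier free_module_ops S.l_distr S.r_distr S.m_assoc)
qed

text \<open>The negative of an element is characterized rather than given by a field of the record,
  so the pointwise formula is reached through the scalar -1. It makes subtraction comparable between
  the free modules on L and on M.\<close>

lemma free_module_minus:
  assumes "cring S" "f \<in> carrier (free_module S B)" "g \<in> carrier (free_module S B)"
  shows "f \<ominus>\<^bsub>free_module S B\<^esub> g = (\<lambda>m. f m \<ominus>\<^bsub>S\<^esub> g m)"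
proof -
  interpret S: cring S by fact
  interpret F: module S "free_module S B" by (rule free_module_module[OF assms(1)])
  have "\<ominus>\<^bsub>free_module S B\<^esub> g = (\<ominus>\<^bsub>S\<^esub> \<one>\<^bsub>S\<^esub>) \<odot>\<^bsub>free_module S B\<^esub> g"
    using assms(3) by (subst F.smult_l_minus) auto
  also have "\<dots> = (\<lambda>m. \<ominus>\<^bsub>S\<^esub> g m)"
    using assms(3) by (auto simp: free_module_carrier free_module_ops S.l_minus)
  finally show ?thesis by (simp add: F.M.minus_eq free_module_ops S.minus_eq)
qed

lemma basis_elt_carrier:
  assumes "cring S" "m \<in> B"
  shows "basis_elt S m \<in> carrier (free_module S B)"
proof -
  interpret S: cring S by fact
  have "{n. basis_elt S m n \<noteq> \<zero>\<^bsub>S\<^esub>} \<subseteq> {m}" by (auto simp: basis_elt_def)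
  then show ?thesis using assms(2)
    by (auto simp: free_module_carrier basis_elt_def intro: finite_subset)
qed

lemma free_module_mono:
  "B \<subseteq> C \<Longrightarrow> carrier (free_module S B) \<subseteq> carrier (free_module S C)"
  unfolding free_module_carrier subset_iff by blast

text \<open>Induction on a finite set containing the support: removing the value at \<open>b\<close>
  splits off a multiple of one basis element. \<open>B\<close> and \<open>C\<close> are separate
  because the free module on L is used inside the one on M.\<close>

lemma free_module_generated:
  assumes "cring S" "submodule K S (free_module S C)" "\<And>b. b \<in> B \<Longrightarrow> basis_elt S b \<in> K"
  shows "carrier (free_module S B) \<subseteq> K"
proof
  interpret S: cring S by fact
  note F = free_module_module[OF assms(1)]
  fix f assume "f \<in> carrier (free_module S B)"
  moreover have mem: "f \<in> K" if "finite D" "D \<subseteq> B" "\<And>m. f m \<in> carrier S" "\<And>m. m \<notin> D \<Longrightarrow> f m = \<zero>\<^bsub>S\<^esub>" for D f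
    using that
  proof (induction D arbitrary: f)
    case empty
    then have "f = \<zero>\<^bsub>free_module S C\<^esub>" by (auto simp: free_module_ops)
    then show ?case using submodule_closed(2)[OF F assms(2)] by simp
  next
    case (insert b D)
    have "f(b := \<zero>\<^bsub>S\<^esub>) \<in> K" using insert.prems by (intro insert.IH) auto
    moreover have "f b \<odot>\<^bsub>free_module S C\<^esub> basis_elt S b \<in> K"
      using insert.prems assms(3) submodule_closed(5)[OF F assms(2)] by auto
    ultimately have "f(b := \<zero>\<^bsub>S\<^esub>) \<oplus>\<^bsub>free_module S C\<^esub> (f b \<odot>\<^bsub>free_module S C\<^esub> basis_elt S b) \<in> K"
      by (rule submodule_closed(3)[OF F assms(2)])
    moreover have "f(b := \<zero>\<^bsub>S\<^esub>) \<oplus>\<^bsub>free_module S C\<^esub> (f b \<odot>\<^bsub>free_module S C\<^esub> basis_elt S b) = f"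
      using insert.prems by (auto simp: free_module_ops basis_elt_def)
    ultimately show ?case by simp
  qed
  ultimately show "f \<in> K"
    by (auto simp: free_module_carrier intro: mem[of "{m. f m \<noteq> \<zero>\<^bsub>S\<^esub>}"])
qed

lemma free_module_lift:
  assumes "module S P" "\<phi> \<in> B \<rightarrow> carrier P"
  shows "\<exists>\<Psi> \<in> semilinear S (\<lambda>s. s) (free_module S B) P. \<forall>b\<in>B. \<Psi> (basis_elt S b) = \<phi> b"
proof -
  interpret P: module S P by fact
  define \<Psi> where "\<Psi> f = (\<Oplus>\<^bsub>P\<^esub>m\<in>{m. f m \<noteq> \<zero>\<^bsub>S\<^esub>}. f m \<odot>\<^bsub>P\<^esub> \<phi> m)" for f
  have \<phi>: "\<phi> m \<in> carrier P" if "m \<in> B" for m using assms(2) that by auto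
  \<comment> \<open>The supports of f, g and f + g differ; this allows all three sums to run over
    one common finite set \<open>D\<close>.\<close>
  have \<Psi>: "\<Psi> f = (\<Oplus>\<^bsub>P\<^esub>m\<in>D. f m \<odot>\<^bsub>P\<^esub> \<phi> m)"
    if "f \<in> carrier (free_module S B)" "finite D" "D \<subseteq> B" "{m. f m \<noteq> \<zero>\<^bsub>S\<^esub>} \<subseteq> D" for f D
    unfolding \<Psi>_def
    by (rule P.M.add.finprod_mono_neutral_cong_right[symmetric])
      (use that \<phi> in \<open>auto simp: free_module_carrier intro!: P.smult_closed\<close>)
  have supp: "finite {m. f m \<noteq> \<zero>\<^bsub>S\<^esub>}" "{m. f m \<noteq> \<zero>\<^bsub>S\<^esub>} \<subseteq> B" "\<And>m. f m \<in> carrier S"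
    if "f \<in> carrier (free_module S B)" for f
    using that by (auto simp: free_module_carrier)
  interpret F: module S "free_module S B" by (rule free_module_module[OF P.R.is_cring])
  have "\<Psi> \<in> semilinear S (\<lambda>s. s) (free_module S B) P"
    unfolding semilinear_def
  proof (intro CollectI conjI ballI)
    show "\<Psi> \<in> carrier (free_module S B) \<rightarrow> carrier P"
      unfolding \<Psi>_def using supp \<phi> by (intro Pi_I P.M.finsum_closed P.smult_closed) blast+
  next
    fix f g assume f: "f \<in> carrier (free_module S B)" and g: "g \<in> carrier (free_module S B)"
    define D where "D = {m. f m \<noteq> \<zero>\<^bsub>S\<^esub>} \<union> {m. g m \<noteq> \<zero>\<^bsub>S\<^esub>}"
    have D: "finite D" "D \<subseteq> B" using supp[OF f] supp[OF g] by (auto simp: D_def)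
    have cl: "(\<lambda>m. h m \<odot>\<^bsub>P\<^esub> \<phi> m) \<in> D \<rightarrow> carrier P" if "h \<in> carrier (free_module S B)" for h
      using supp[OF that] \<phi> D by auto
    have "\<Psi> (f \<oplus>\<^bsub>free_module S B\<^esub> g) = (\<Oplus>\<^bsub>P\<^esub>m\<in>D. (f m \<oplus>\<^bsub>S\<^esub> g m) \<odot>\<^bsub>P\<^esub> \<phi> m)"
      using D f g F.M.a_closed[OF f g] by (subst \<Psi>[of _ D]) (auto simp: free_module_ops D_def)
    also have "\<dots> = (\<Oplus>\<^bsub>P\<^esub>m\<in>D. f m \<odot>\<^bsub>P\<^esub> \<phi> m \<oplus>\<^bsub>P\<^esub> g m \<odot>\<^bsub>P\<^esub> \<phi> m)"
      using supp[OF f] supp[OF g] \<phi> D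
      by (intro P.M.finsum_cong') (auto intro!: P.smult_l_distr)
    also have "\<dots> = (\<Oplus>\<^bsub>P\<^esub>m\<in>D. f m \<odot>\<^bsub>P\<^esub> \<phi> m) \<oplus>\<^bsub>P\<^esub> (\<Oplus>\<^bsub>P\<^esub>m\<in>D. g m \<odot>\<^bsub>P\<^esub> \<phi> m)"
      using cl f g by (intro P.M.finsum_addf) auto
    also have "\<dots> = \<Psi> f \<oplus>\<^bsub>P\<^esub> \<Psi> g"
      using D f g by (subst (1 2) \<Psi>[of _ D]) (auto simp: D_def)
    finally show "\<Psi> (f \<oplus>\<^bsub>free_module S B\<^esub> g) = \<Psi> f \<oplus>\<^bsub>P\<^esub> \<Psi> g" .
  next
    fix s f assume s: "s \<in> carrier S" and f: "f \<in> carrier (free_module S B)"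
    let ?D = "{m. f m \<noteq> \<zero>\<^bsub>S\<^esub>}"
    have "\<Psi> (s \<odot>\<^bsub>free_module S B\<^esub> f) = (\<Oplus>\<^bsub>P\<^esub>m\<in>?D. (s \<otimes>\<^bsub>S\<^esub> f m) \<odot>\<^bsub>P\<^esub> \<phi> m)"
      using supp[OF f] s F.smult_closed[OF s f]
      by (subst \<Psi>[of _ ?D]) (auto simp: free_module_ops)
    also have "\<dots> = (\<Oplus>\<^bsub>P\<^esub>m\<in>?D. s \<odot>\<^bsub>P\<^esub> (f m \<odot>\<^bsub>P\<^esub> \<phi> m))"
      using supp[OF f] s \<phi> by (intro P.M.finsum_cong') (auto intro!: P.smult_assoc1)
    also have "\<dots> = s \<odot>\<^bsub>P\<^esub> \<Psi> f"
      unfolding \<Psi>_def using supp[OF f] s \<phi>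
      by (intro P.finsum_smult_ldistr[symmetric]) auto
    finally show "\<Psi> (s \<odot>\<^bsub>free_module S B\<^esub> f) = s \<odot>\<^bsub>P\<^esub> \<Psi> f" .
  qed
  moreover have "\<Psi> (basis_elt S b) = \<phi> b" if b: "b \<in> B" for b
  proof -
    have "\<Psi> (basis_elt S b) = (\<Oplus>\<^bsub>P\<^esub>m\<in>{b}. basis_elt S b m \<odot>\<^bsub>P\<^esub> \<phi> m)"
      using b by (intro \<Psi> basis_elt_carrier P.R.is_cring) (auto simp: basis_elt_def)
    then show ?thesis using \<phi>[OF b] by (simp add: basis_elt_def)
  qed
  ultimately show ?thesis by blast
qed

lemma (in abelian_group) eq_if_diff_zero:
  assumes "a \<oplus> \<ominus> b = \<zero>" "b \<in> carrier G" "a \<in> carrier G"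
  shows "a = b"
proof -
  have "a = (a \<oplus> \<ominus> b) \<oplus> b" using assms(2,3) by (simp add: a_assoc l_neg)
  then show ?thesis using assms by simp
qed

section \<open>Base change of modules\<close>

definition base_change_gens where
  "base_change_gens R S h M = (let F = free_module S (carrier M) in
      {basis_elt S (m \<oplus>\<^bsub>M\<^esub> n) \<ominus>\<^bsub>F\<^esub> (basis_elt S m \<oplus>\<^bsub>F\<^esub> basis_elt S n)
          | m n. m \<in> carrier M \<and> n \<in> carrier M}
       \<union> {basis_elt S (r \<odot>\<^bsub>M\<^esub> m) \<ominus>\<^bsub>F\<^esub> (h r \<odot>\<^bsub>F\<^esub> basis_elt S m)
          | r m. r \<in> carrier R \<and> m \<in> carrier M})"

lemma base_change_rel_eq:
  "base_change_rel R S h M = gen_submodule S (free_module S (carrier M)) (base_change_gens R S h M)"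
  by (simp add: base_change_rel_def base_change_gens_def Let_def)

text \<open>\<open>h\<close> is a map of carriers, so the same facts serve twice: for restriction
  maps O(U) -> O(V), and with S = R for the iterated Frobenius, where the base change is
  F^e(M).\<close>

locale base_change_setup =
  fixes R :: "'r ring" and S :: "'s ring" and h :: "'r \<Rightarrow> 's" and M :: "('r, 'm) module"
  assumes M: "module R M" and S: "cring S" and h: "h \<in> carrier R \<rightarrow> carrier S"
begin

abbreviation "F \<equiv> free_module S (carrier M)"
abbreviation "rel \<equiv> base_change_rel R S h M"
abbreviation "B \<equiv> base_change R S h M"
abbreviation "elt \<equiv> base_change_elt R S h M"

lemma F: "module S F"
  by (rule free_module_module[OF S])

lemma gens_subset: "base_change_gens R S h M \<subseteq> carrier F"
proof -
  interpret M: module R M by (rule M)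
  interpret F: module S F by (rule F)
  show ?thesis unfolding base_change_gens_def Let_def
    using h by (auto intro!: F.M.minus_closed F.M.a_closed F.smult_closed basis_elt_carrier[OF S])
qed

lemma rel: "submodule rel S F"
  unfolding base_change_rel_eq by (rule gen_submodule_submodule[OF F gens_subset])

lemma gens_rel: "base_change_gens R S h M \<subseteq> rel"
  unfolding base_change_rel_eq by (rule gen_submodule_superset)

lemma base_change_module: "module S B"
  unfolding base_change_def by (rule quot_module_module[OF F rel])

lemma basis: "m \<in> carrier M \<Longrightarrow> basis_elt S m \<in> carrier F"
  by (rule basis_elt_carrier[OF S])

lemma base_change_elt_semilinear: "elt \<in> semilinear R h M B"
  unfolding semilinear_def
proof (intro CollectI conjI ballI)
  interpret M: module R M by (rule M)
  interpret F: module S F by (rule F)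
  show "elt \<in> carrier M \<rightarrow> carrier B"
    using basis by (auto simp: base_change_def quot_module_carrier base_change_elt_def)
  fix m assume m: "m \<in> carrier M"
  {
    fix n assume n: "n \<in> carrier M"
    have "basis_elt S (m \<oplus>\<^bsub>M\<^esub> n) \<ominus>\<^bsub>F\<^esub> (basis_elt S m \<oplus>\<^bsub>F\<^esub> basis_elt S n) \<in> base_change_gens R S h M"
      unfolding base_change_gens_def Let_def using m n by blast
    then have "basis_elt S (m \<oplus>\<^bsub>M\<^esub> n) \<oplus>\<^bsub>F\<^esub> \<ominus>\<^bsub>F\<^esub> (basis_elt S m \<oplus>\<^bsub>F\<^esub> basis_elt S n) \<in> rel"
      using subsetD[OF gens_rel] by (simp add: F.M.minus_eq)
    then have "rel +>\<^bsub>F\<^esub> basis_elt S (m \<oplus>\<^bsub>M\<^esub> n) = rel +>\<^bsub>F\<^esub> (basis_elt S m \<oplus>\<^bsub>F\<^esub> basis_elt S n)"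
      using m n by (subst coset_eq_iff[OF F rel]) (auto simp: basis)
    then show "elt (m \<oplus>\<^bsub>M\<^esub> n) = elt m \<oplus>\<^bsub>B\<^esub> elt n"
      using m n by (simp add: base_change_elt_def base_change_def quot_module_add[OF F rel] basis)
  }
  fix r assume r: "r \<in> carrier R"
  then have hr: "h r \<in> carrier S" using h by auto
  have "basis_elt S (r \<odot>\<^bsub>M\<^esub> m) \<ominus>\<^bsub>F\<^esub> (h r \<odot>\<^bsub>F\<^esub> basis_elt S m) \<in> base_change_gens R S h M"
    unfolding base_change_gens_def Let_def using m r by blast
  then have "basis_elt S (r \<odot>\<^bsub>M\<^esub> m) \<oplus>\<^bsub>F\<^esub> \<ominus>\<^bsub>F\<^esub> (h r \<odot>\<^bsub>F\<^esub> basis_elt S m) \<in> rel"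
    using subsetD[OF gens_rel] by (simp add: F.M.minus_eq)
  then have "rel +>\<^bsub>F\<^esub> basis_elt S (r \<odot>\<^bsub>M\<^esub> m) = rel +>\<^bsub>F\<^esub> (h r \<odot>\<^bsub>F\<^esub> basis_elt S m)"
    using m r hr by (subst coset_eq_iff[OF F rel]) (auto simp: basis)
  then show "elt (r \<odot>\<^bsub>M\<^esub> m) = h r \<odot>\<^bsub>B\<^esub> elt m"
    using m hr by (simp add: base_change_elt_def base_change_def quot_module_smult[OF F rel] basis)
qed

text \<open>Existence in the universal property. The extension of \<phi> to the free module kills
  the generators of \<open>rel\<close> by semilinearity, hence all of \<open>rel\<close>, and so
  descends to the quotient.\<close>

lemma base_change_lift:
  assumes P: "module S P" and \<phi>: "\<phi> \<in> semilinear R h M P"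
  shows "\<exists>\<Psi> \<in> semilinear S (\<lambda>s. s) B P. \<forall>m\<in>carrier M. \<Psi> (elt m) = \<phi> m"
proof -
  interpret M: module R M by (rule M)
  interpret F: module S F by (rule F)
  interpret P: module S P by (rule P)
  note \<phi>D = semilinearD[OF \<phi>]
  obtain \<Psi> where \<Psi>: "\<Psi> \<in> semilinear S (\<lambda>s. s) F P"
    and \<Psi>b: "\<And>m. m \<in> carrier M \<Longrightarrow> \<Psi> (basis_elt S m) = \<phi> m"
    using free_module_lift[OF P, of \<phi> "carrier M"] \<phi>D(1) by blast
  note \<Psi>D = semilinearD[OF \<Psi>]
  have \<Psi>m: "\<Psi> (f \<ominus>\<^bsub>F\<^esub> g) = \<Psi> f \<ominus>\<^bsub>P\<^esub> \<Psi> g" if "f \<in> carrier F" "g \<in> carrier F" for f g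
    unfolding F.M.minus_eq P.M.minus_eq using that semilinear_minus[OF F P \<Psi>] \<Psi>D by simp
  have "submodule {f \<in> carrier F. \<Psi> f \<in> {\<zero>\<^bsub>P\<^esub>}} S F"
    by (rule semilinear_vimage_submodule[OF F P _ \<Psi>]) (auto intro: submodule_intro[OF P])
  moreover have "base_change_gens R S h M \<subseteq> {f \<in> carrier F. \<Psi> f \<in> {\<zero>\<^bsub>P\<^esub>}}"
  proof -
    have "\<Psi> (basis_elt S (m \<oplus>\<^bsub>M\<^esub> n) \<ominus>\<^bsub>F\<^esub> (basis_elt S m \<oplus>\<^bsub>F\<^esub> basis_elt S n)) = \<zero>\<^bsub>P\<^esub>"
      if "m \<in> carrier M" "n \<in> carrier M" for m n
      using that by (simp add: basis \<Psi>m \<Psi>D(2) \<Psi>b \<phi>D P.M.r_neg P.M.minus_eq)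
    moreover have "\<Psi> (basis_elt S (r \<odot>\<^bsub>M\<^esub> m) \<ominus>\<^bsub>F\<^esub> (h r \<odot>\<^bsub>F\<^esub> basis_elt S m)) = \<zero>\<^bsub>P\<^esub>"
      if "m \<in> carrier M" "r \<in> carrier R" for m r
      using that funcset_mem[OF h that(2)]
      by (simp add: basis \<Psi>m \<Psi>D(3) \<Psi>b \<phi>D P.M.r_neg P.M.minus_eq)
    ultimately have "\<Psi> f = \<zero>\<^bsub>P\<^esub>" if "f \<in> base_change_gens R S h M" for f
      using that unfolding base_change_gens_def Let_def by blast
    then show ?thesis using gens_subset by blast
  qed
  ultimately have ker: "rel \<subseteq> {f \<in> carrier F. \<Psi> f \<in> {\<zero>\<^bsub>P\<^esub>}}"
    unfolding base_change_rel_eq by (rule gen_submodule_least)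
  \<comment> \<open>A coset is evaluated at a representative picked by choice; by \<open>ker\<close>
    all representatives give the same value.\<close>
  define \<Theta> where "\<Theta> X = \<Psi> (SOME f. f \<in> X)" for X
  have \<Theta>: "\<Theta> (rel +>\<^bsub>F\<^esub> f) = \<Psi> f" if f: "f \<in> carrier F" for f
  proof -
    define g where "g = (SOME g. g \<in> rel +>\<^bsub>F\<^esub> f)"
    have "g \<in> rel +>\<^bsub>F\<^esub> f" unfolding g_def using coset_self[OF F rel f] by (rule someI[of "\<lambda>g. g \<in> rel +>\<^bsub>F\<^esub> f"])
    note g = coset_elem[OF F rel f this]
    then have "g \<oplus>\<^bsub>F\<^esub> \<ominus>\<^bsub>F\<^esub> f \<in> rel" using coset_eq_iff[OF F rel _ f] by simp
    then have "\<Psi> (g \<ominus>\<^bsub>F\<^esub> f) = \<zero>\<^bsub>P\<^esub>" using ker unfolding F.M.minus_eq by auto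
    then have "\<Psi> g \<oplus>\<^bsub>P\<^esub> \<ominus>\<^bsub>P\<^esub> \<Psi> f = \<zero>\<^bsub>P\<^esub>" using \<Psi>m[OF g(1) f] by (simp add: P.M.minus_eq)
    then have "\<Psi> g = \<Psi> f" using \<Psi>D(1)[OF f] \<Psi>D(1)[OF g(1)] by (rule P.M.eq_if_diff_zero)
    then show ?thesis by (simp add: \<Theta>_def g_def)
  qed
  have "\<Theta> \<in> semilinear S (\<lambda>s. s) B P"
    unfolding semilinear_def base_change_def
    by (auto simp: quot_module_carrier quot_module_add[OF F rel] quot_module_smult[OF F rel] \<Theta> \<Psi>D)
  moreover have "\<Theta> (elt m) = \<phi> m" if "m \<in> carrier M" for m
    using that by (simp add: base_change_elt_def \<Theta> basis \<Psi>b)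
  ultimately show ?thesis by blast
qed

text \<open>The point is \<open>relL\<close>: relations formed in the free module on L are also
  relations for M. Therefore the union in \<open>base_change_incl\<close> over a coset of
  \<open>L.rel\<close> is a single coset of \<open>rel\<close>.\<close>

lemma base_change_image_eq:
  assumes L: "submodule L R M"
  shows "base_change_image R S h M L = {rel +>\<^bsub>F\<^esub> f | f. f \<in> carrier (free_module S L)}"
proof -
  interpret M: module R M by (rule M)
  note L_sub = submodule_closed(1)[OF M L]
  let ?M = "M\<lparr>carrier := L\<rparr>"
  let ?FL = "free_module S L"
  interpret L: base_change_setup R S h ?M
    by (intro base_change_setup.intro S h submodule.submodule_is_module[OF L M])
  interpret FL: module S ?FL by (rule free_module_module[OF S])
  note sub = free_module_mono[OF L_sub, of S]
  have FL: "module S ?FL" by (rule free_module_module[OF S])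
  have "submodule (rel \<inter> carrier ?FL) S ?FL"
    by (rule submodule_intro[OF FL])
      (use submodule_closed[OF F rel] in \<open>auto simp: free_module_ops FL.smult_closed[unfolded free_module_ops]
          FL.M.a_closed[unfolded free_module_ops] FL.M.zero_closed[unfolded free_module_ops]\<close>)
  moreover have "base_change_gens R S h ?M \<subseteq> rel \<inter> carrier ?FL"
  proof -
    have "base_change_gens R S h ?M \<subseteq> base_change_gens R S h M"
    proof -
      \<comment> \<open>On functions supported in L the two free modules have the same operations,
        so each generator for L is literally a generator for M.\<close>
      have eq: "f \<ominus>\<^bsub>?FL\<^esub> g = f \<ominus>\<^bsub>F\<^esub> g" if "f \<in> carrier ?FL" "g \<in> carrier ?FL" for f g
        using that sub by (simp add: free_module_minus[OF S] subset_iff)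
      have "basis_elt S (m \<oplus>\<^bsub>M\<^esub> n) \<ominus>\<^bsub>?FL\<^esub> (basis_elt S m \<oplus>\<^bsub>?FL\<^esub> basis_elt S n)
          = basis_elt S (m \<oplus>\<^bsub>M\<^esub> n) \<ominus>\<^bsub>F\<^esub> (basis_elt S m \<oplus>\<^bsub>F\<^esub> basis_elt S n)" if "m \<in> L" "n \<in> L" for m n
        using that submodule_closed[OF M L]
        by (subst eq) (auto simp: basis_elt_carrier[OF S] intro!: FL.M.a_closed, simp add: free_module_ops(2))
      then have "basis_elt S (m \<oplus>\<^bsub>M\<^esub> n) \<ominus>\<^bsub>?FL\<^esub> (basis_elt S m \<oplus>\<^bsub>?FL\<^esub> basis_elt S n)
          \<in> base_change_gens R S h M" if "m \<in> L" "n \<in> L" for m n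
        using that L_sub unfolding base_change_gens_def Let_def by blast
      moreover have "basis_elt S (r \<odot>\<^bsub>M\<^esub> m) \<ominus>\<^bsub>?FL\<^esub> (h r \<odot>\<^bsub>?FL\<^esub> basis_elt S m)
          = basis_elt S (r \<odot>\<^bsub>M\<^esub> m) \<ominus>\<^bsub>F\<^esub> (h r \<odot>\<^bsub>F\<^esub> basis_elt S m)" if "m \<in> L" "r \<in> carrier R" for m r
        using that submodule_closed[OF M L] funcset_mem[OF h]
        by (subst eq) (auto simp: basis_elt_carrier[OF S] intro!: FL.smult_closed, simp add: free_module_ops(3))
      then have "basis_elt S (r \<odot>\<^bsub>M\<^esub> m) \<ominus>\<^bsub>?FL\<^esub> (h r \<odot>\<^bsub>?FL\<^esub> basis_elt S m)
          \<in> base_change_gens R S h M" if "m \<in> L" "r \<in> carrier R" for m r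
        using that L_sub unfolding base_change_gens_def Let_def by blast
      ultimately show ?thesis
        by (subst base_change_gens_def) (auto simp: Let_def)
    qed
    then show ?thesis using L.gens_subset gens_rel by auto
  qed
  ultimately have "gen_submodule S ?FL (base_change_gens R S h ?M) \<subseteq> rel \<inter> carrier ?FL"
    by (rule gen_submodule_least)
  then have relL: "L.rel \<subseteq> rel"
    using base_change_rel_eq[of R S h ?M] by simp
  have incl: "base_change_incl R S h M (L.rel +>\<^bsub>?FL\<^esub> f) = rel +>\<^bsub>F\<^esub> f" if f: "f \<in> carrier ?FL" for f
    unfolding base_change_incl_def
  proof (rule UN_const_on)
    show "L.rel +>\<^bsub>?FL\<^esub> f \<noteq> {}" using coset_self[OF FL, of L.rel f] L.rel f by auto
    fix g assume "g \<in> L.rel +>\<^bsub>?FL\<^esub> f"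
    then obtain k where "k \<in> L.rel" "g = k \<oplus>\<^bsub>F\<^esub> f"
      by (auto simp: a_r_coset_def' free_module_ops)
    then have "g \<in> rel +>\<^bsub>F\<^esub> f" using relL by (auto simp: a_r_coset_def')
    then show "rel +>\<^bsub>F\<^esub> g = rel +>\<^bsub>F\<^esub> f" using coset_elem(2)[OF F rel] f sub by blast
  qed
  have "carrier L.B = (\<lambda>f. L.rel +>\<^bsub>?FL\<^esub> f) ` carrier ?FL"
    by (simp add: base_change_def quot_module_carrier setcompr_eq_image)
  then have "base_change_image R S h M L = (\<lambda>f. base_change_incl R S h M (L.rel +>\<^bsub>?FL\<^esub> f)) ` carrier ?FL"
    by (simp add: base_change_image_def image_image)
  also have "\<dots> = (\<lambda>f. rel +>\<^bsub>F\<^esub> f) ` carrier ?FL"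
    by (rule image_cong[OF refl incl])
  finally show ?thesis by (simp add: setcompr_eq_image)
qed

text \<open>For the Frobenius this describes L^[q] as the submodule generated by the z^q with z in
  L. All later arguments use this description, and cosets in the free module do not occur
  again.\<close>

lemma base_change_image:
  assumes L: "submodule L R M"
  shows "base_change_image R S h M L = gen_submodule S B (elt ` L)"
proof -
  note L_sub = submodule_closed(1)[OF M L]
  let ?FL = "free_module S L"
  note sub = free_module_mono[OF L_sub, of S]
  interpret FL: module S ?FL by (rule free_module_module[OF S])
  interpret B: module S B by (rule base_change_module)
  have im: "\<exists>f. f \<in> carrier ?FL \<and> a = rel +>\<^bsub>F\<^esub> f" if "a \<in> base_change_image R S h M L" for a
    using that by (auto simp: base_change_image_eq[OF L])
  have "submodule (base_change_image R S h M L) S B"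
  proof (rule submodule_intro[OF base_change_module])
    show "base_change_image R S h M L \<subseteq> carrier B" using sub
      by (auto simp: base_change_image_eq[OF L] base_change_def quot_module_carrier)
    show "\<zero>\<^bsub>B\<^esub> \<in> base_change_image R S h M L"
      using abelian_group.a_coset_add_zero[of F rel] submodule_closed(1)[OF F rel] FL.M.zero_closed
        module.axioms(2)[OF F]
      by (auto simp: base_change_image_eq[OF L] base_change_def quot_module_zero free_module_ops intro!: exI[of _ "\<lambda>m. \<zero>\<^bsub>S\<^esub>"])
    show "a \<oplus>\<^bsub>B\<^esub> b \<in> base_change_image R S h M L"
      if ab: "a \<in> base_change_image R S h M L" "b \<in> base_change_image R S h M L" for a b
    proof -
      obtain f g where fg: "f \<in> carrier ?FL" "g \<in> carrier ?FL" "a = rel +>\<^bsub>F\<^esub> f" "b = rel +>\<^bsub>F\<^esub> g"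
        using im[OF ab(1)] im[OF ab(2)] by metis
      then have "a \<oplus>\<^bsub>B\<^esub> b = rel +>\<^bsub>F\<^esub> (f \<oplus>\<^bsub>F\<^esub> g)"
        using sub unfolding base_change_def by (simp add: quot_module_add[OF F rel] subset_iff)
      moreover have "f \<oplus>\<^bsub>F\<^esub> g \<in> carrier ?FL" using FL.M.a_closed[OF fg(1,2)] by (simp add: free_module_ops)
      ultimately show ?thesis by (auto simp: base_change_image_eq[OF L])
    qed
    show "s \<odot>\<^bsub>B\<^esub> a \<in> base_change_image R S h M L"
      if s: "s \<in> carrier S" and a: "a \<in> base_change_image R S h M L" for s a
    proof -
      obtain f where f: "f \<in> carrier ?FL" "a = rel +>\<^bsub>F\<^esub> f"
        using im[OF a] by metis
      then have "s \<odot>\<^bsub>B\<^esub> a = rel +>\<^bsub>F\<^esub> (s \<odot>\<^bsub>F\<^esub> f)"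
        using sub s unfolding base_change_def by (simp add: quot_module_smult[OF F rel] subset_iff)
      moreover have "s \<odot>\<^bsub>F\<^esub> f \<in> carrier ?FL" using FL.smult_closed[OF s f(1)] by (simp add: free_module_ops)
      ultimately show ?thesis by (auto simp: base_change_image_eq[OF L])
    qed
  qed
  moreover have "elt ` L \<subseteq> base_change_image R S h M L"
    by (auto simp: base_change_image_eq[OF L] base_change_elt_def basis_elt_carrier[OF S])
  moreover have "base_change_image R S h M L \<subseteq> H" if H: "submodule H S B" and "elt ` L \<subseteq> H" for H
  proof -
    \<comment> \<open>Minimality is tested in the free module: the preimage of \<open>H\<close>
      contains the basis elements that belong to L, hence all of \<open>?FL\<close>.\<close>
    have "submodule {f \<in> carrier F. rel +>\<^bsub>F\<^esub> f \<in> H} S F"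
      using semilinear_vimage_submodule[OF F base_change_module _ _ H, of "\<lambda>s. s"] quot_semilinear[OF F rel]
      by (simp add: base_change_def)
    then have "carrier ?FL \<subseteq> {f \<in> carrier F. rel +>\<^bsub>F\<^esub> f \<in> H}"
      by (rule free_module_generated[OF S])
        (use that L_sub basis in \<open>auto simp: base_change_elt_def\<close>)
    then show ?thesis by (auto simp: base_change_image_eq[OF L])
  qed
  ultimately show ?thesis
    unfolding gen_submodule_def by (intro equalityI Inf_greatest Inf_lower) simp_all
qed

lemma base_change_image_submodule:
  assumes "submodule L R M"
  shows "submodule (base_change_image R S h M L) S B"
proof -
  have "elt ` L \<subseteq> carrier B"
    using semilinearD(1)[OF base_change_elt_semilinear] submodule_closed(1)[OF M assms] by auto
  then show ?thesis
    unfolding base_change_image[OF assms] by (rule gen_submodule_submodule[OF base_change_module])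
qed

lemma base_change_elt_image:
  assumes "submodule L R M" "m \<in> L"
  shows "elt m \<in> base_change_image R S h M L"
  using subsetD[OF gen_submodule_superset, of "elt m" "elt ` L"] assms(2)
  by (simp add: base_change_image[OF assms(1)])

end


subsection \<open>Fractions\<close>

locale fractions = M: module R M + T: submonoid T R
  for R :: "'r ring" and T :: "'r set" and M :: "('r, 'm) module"
begin

abbreviation "frc \<equiv> fraction R T M"
abbreviation "loc \<equiv> loc_module R T M"

lemma T_carrier: "t \<in> T \<Longrightarrow> t \<in> carrier R"
  using T.subset by blast

lemmas T_simps [simp] = T_carrier T.m_closed T.one_closed

lemma mem_frac:
  "(n, t) \<in> frc m s \<longleftrightarrow> n \<in> carrier M \<and> t \<in> T
    \<and> (\<exists>u \<in> T. u \<odot>\<^bsub>M\<^esub> (t \<odot>\<^bsub>M\<^esub> m) = u \<odot>\<^bsub>M\<^esub> (s \<odot>\<^bsub>M\<^esub> n))"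
  by (simp add: fraction_def)

lemma frac_self: "\<lbrakk>m \<in> carrier M; s \<in> T\<rbrakk> \<Longrightarrow> (m, s) \<in> frc m s"
  by (auto simp: mem_frac intro!: bexI[of _ "\<one>\<^bsub>R\<^esub>"])

lemma mem_frac_subset:
  assumes m: "m \<in> carrier M" and s: "s \<in> T" and nt: "(n, t) \<in> frc m s"
  shows "frc n t \<subseteq> frc m s"
proof clarify
  fix x v assume "(x, v) \<in> frc n t"
  then obtain w where w: "x \<in> carrier M" "v \<in> T" "w \<in> T" "w \<odot>\<^bsub>M\<^esub> (v \<odot>\<^bsub>M\<^esub> n) = w \<odot>\<^bsub>M\<^esub> (t \<odot>\<^bsub>M\<^esub> x)"
    by (auto simp: mem_frac)
  from nt obtain u where u: "n \<in> carrier M" "t \<in> T" "u \<in> T" "u \<odot>\<^bsub>M\<^esub> (t \<odot>\<^bsub>M\<^esub> m) = u \<odot>\<^bsub>M\<^esub> (s \<odot>\<^bsub>M\<^esub> n)"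
    by (auto simp: mem_frac)
  note simps = M.smult_assoc1[symmetric] M.R.m_ac
  \<comment> \<open>Joining u t m = u s n and w v n = w t x through n costs a factor t, so w u t is
    the witness for m/s = x/v.\<close>
  have "(w \<otimes>\<^bsub>R\<^esub> u \<otimes>\<^bsub>R\<^esub> t) \<odot>\<^bsub>M\<^esub> (v \<odot>\<^bsub>M\<^esub> m) = (w \<otimes>\<^bsub>R\<^esub> v) \<odot>\<^bsub>M\<^esub> (u \<odot>\<^bsub>M\<^esub> (t \<odot>\<^bsub>M\<^esub> m))"
    using m s u(1-3) w(1-3) by (simp add: simps)
  also have "\<dots> = (u \<otimes>\<^bsub>R\<^esub> s) \<odot>\<^bsub>M\<^esub> (w \<odot>\<^bsub>M\<^esub> (v \<odot>\<^bsub>M\<^esub> n))"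
    unfolding u(4) using m s u(1-3) w(1-3) by (simp add: simps)
  also have "\<dots> = (w \<otimes>\<^bsub>R\<^esub> u \<otimes>\<^bsub>R\<^esub> t) \<odot>\<^bsub>M\<^esub> (s \<odot>\<^bsub>M\<^esub> x)"
    unfolding w(4) using m s u(1-3) w(1-3) by (simp add: simps)
  finally show "(x, v) \<in> frc m s" using w u m by (auto simp: mem_frac)
qed

lemma mem_frac_sym:
  assumes "m \<in> carrier M" "s \<in> T" "(n, t) \<in> frc m s"
  shows "(m, s) \<in> frc n t" "n \<in> carrier M" "t \<in> T"
  using assms by (auto simp: mem_frac) metis

lemma frac_eqI:
  assumes "m \<in> carrier M" "s \<in> T" "(n, t) \<in> frc m s"
  shows "frc n t = frc m s"
  using mem_frac_subset[OF assms] mem_frac_subset[of n t m s] mem_frac_sym[OF assms] by auto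

lemma frac_eq_iff:
  assumes "m \<in> carrier M" "s \<in> T" "n \<in> carrier M" "t \<in> T"
  shows "frc m s = frc n t \<longleftrightarrow> (\<exists>u \<in> T. u \<odot>\<^bsub>M\<^esub> (t \<odot>\<^bsub>M\<^esub> m) = u \<odot>\<^bsub>M\<^esub> (s \<odot>\<^bsub>M\<^esub> n))"
  using frac_eqI[OF assms(1,2), of n t] frac_self[OF assms(3,4)] assms mem_frac[of n t m s] by auto

lemma frac_scale:
  assumes "m \<in> carrier M" "s \<in> T" "u \<in> T"
  shows "frc m s = frc (u \<odot>\<^bsub>M\<^esub> m) (u \<otimes>\<^bsub>R\<^esub> s)"
  using assms by (subst frac_eq_iff)
    (auto intro!: bexI[of _ "\<one>\<^bsub>R\<^esub>"] simp: M.smult_assoc1[symmetric] M.R.m_ac)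

lemma loc_carrier: "carrier loc = {frc m s | m s. m \<in> carrier M \<and> s \<in> T}"
  by (simp add: loc_module_def)

lemma frac_in_loc: "\<lbrakk>m \<in> carrier M; s \<in> T\<rbrakk> \<Longrightarrow> frc m s \<in> carrier loc"
  unfolding loc_carrier by (intro CollectI exI[of _ m] exI[of _ s] conjI refl)

lemma UN_frac:
  assumes "m \<in> carrier M" "s \<in> T"
    and "\<And>n t. \<lbrakk>n \<in> carrier M; t \<in> T; frc n t = frc m s\<rbrakk> \<Longrightarrow> g n t = c"
  shows "(\<Union>(n, t)\<in>frc m s. g n t) = c"
proof (rule UN_const_on)
  show "frc m s \<noteq> {}" using frac_self[OF assms(1,2)] by blast
  fix x assume "x \<in> frc m s"
  then have *: "(fst x, snd x) \<in> frc m s" by simp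
  show "(case x of (n, t) \<Rightarrow> g n t) = c"
    unfolding case_prod_beta
    using mem_frac_sym(2,3)[OF assms(1,2) *] frac_eqI[OF assms(1,2) *] by (rule assms(3))
qed

lemma loc_add:
  assumes m: "m \<in> carrier M" and s: "s \<in> T" and n: "n \<in> carrier M" and t: "t \<in> T"
  shows "frc m s \<oplus>\<^bsub>loc\<^esub> frc n t = frc (t \<odot>\<^bsub>M\<^esub> m \<oplus>\<^bsub>M\<^esub> s \<odot>\<^bsub>M\<^esub> n) (s \<otimes>\<^bsub>R\<^esub> t)"
proof -
  have "frc (t' \<odot>\<^bsub>M\<^esub> m' \<oplus>\<^bsub>M\<^esub> s' \<odot>\<^bsub>M\<^esub> n') (s' \<otimes>\<^bsub>R\<^esub> t') = frc (t \<odot>\<^bsub>M\<^esub> m \<oplus>\<^bsub>M\<^esub> s \<odot>\<^bsub>M\<^esub> n) (s \<otimes>\<^bsub>R\<^esub> t)"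
    if m': "m' \<in> carrier M" "s' \<in> T" "frc m' s' = frc m s"
      and n': "n' \<in> carrier M" "t' \<in> T" "frc n' t' = frc n t" for m' s' n' t'
  proof -
    obtain u where u: "u \<in> T" "u \<odot>\<^bsub>M\<^esub> (s \<odot>\<^bsub>M\<^esub> m') = u \<odot>\<^bsub>M\<^esub> (s' \<odot>\<^bsub>M\<^esub> m)"
      using m' m s frac_eq_iff by auto
    obtain v where v: "v \<in> T" "v \<odot>\<^bsub>M\<^esub> (t \<odot>\<^bsub>M\<^esub> n') = v \<odot>\<^bsub>M\<^esub> (t' \<odot>\<^bsub>M\<^esub> n)"
      using n' n t frac_eq_iff by auto
    note simps = M.smult_assoc1[symmetric] M.R.m_ac M.smult_r_distr
    have "(u \<otimes>\<^bsub>R\<^esub> v) \<odot>\<^bsub>M\<^esub> ((s \<otimes>\<^bsub>R\<^esub> t) \<odot>\<^bsub>M\<^esub> (t' \<odot>\<^bsub>M\<^esub> m' \<oplus>\<^bsub>M\<^esub> s' \<odot>\<^bsub>M\<^esub> n'))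
        = (v \<otimes>\<^bsub>R\<^esub> t \<otimes>\<^bsub>R\<^esub> t') \<odot>\<^bsub>M\<^esub> (u \<odot>\<^bsub>M\<^esub> (s \<odot>\<^bsub>M\<^esub> m')) \<oplus>\<^bsub>M\<^esub> (u \<otimes>\<^bsub>R\<^esub> s \<otimes>\<^bsub>R\<^esub> s') \<odot>\<^bsub>M\<^esub> (v \<odot>\<^bsub>M\<^esub> (t \<odot>\<^bsub>M\<^esub> n'))"
      using m s n t m'(1,2) n'(1,2) u(1) v(1) by (simp add: simps)
    also have "\<dots> = (u \<otimes>\<^bsub>R\<^esub> v) \<odot>\<^bsub>M\<^esub> ((s' \<otimes>\<^bsub>R\<^esub> t') \<odot>\<^bsub>M\<^esub> (t \<odot>\<^bsub>M\<^esub> m \<oplus>\<^bsub>M\<^esub> s \<odot>\<^bsub>M\<^esub> n))"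
      unfolding u(2) v(2) using m s n t m'(1,2) n'(1,2) u(1) v(1) by (simp add: simps)
    finally show ?thesis
      using m s n t m'(1,2) n'(1,2) u(1) v(1) by (subst frac_eq_iff) auto
  qed
  note eq = this
  have "(\<Union>(m', s')\<in>frc m s. \<Union>(n', t')\<in>frc n t.
      frc (t' \<odot>\<^bsub>M\<^esub> m' \<oplus>\<^bsub>M\<^esub> s' \<odot>\<^bsub>M\<^esub> n') (s' \<otimes>\<^bsub>R\<^esub> t')) = frc (t \<odot>\<^bsub>M\<^esub> m \<oplus>\<^bsub>M\<^esub> s \<odot>\<^bsub>M\<^esub> n) (s \<otimes>\<^bsub>R\<^esub> t)"
    by (intro UN_frac m s n t eq)
  then show ?thesis by (simp add: loc_module_def)
qed

lemma loc_smult: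
  assumes r: "r \<in> carrier R" and m: "m \<in> carrier M" and s: "s \<in> T"
  shows "r \<odot>\<^bsub>loc\<^esub> frc m s = frc (r \<odot>\<^bsub>M\<^esub> m) s"
proof -
  have "frc (r \<odot>\<^bsub>M\<^esub> m') s' = frc (r \<odot>\<^bsub>M\<^esub> m) s"
    if m': "m' \<in> carrier M" "s' \<in> T" "frc m' s' = frc m s" for m' s'
  proof -
    obtain u where u: "u \<in> T" "u \<odot>\<^bsub>M\<^esub> (s \<odot>\<^bsub>M\<^esub> m') = u \<odot>\<^bsub>M\<^esub> (s' \<odot>\<^bsub>M\<^esub> m)"
      using m' m s frac_eq_iff by auto
    note simps = M.smult_assoc1[symmetric] M.R.m_ac
    have "u \<odot>\<^bsub>M\<^esub> (s \<odot>\<^bsub>M\<^esub> (r \<odot>\<^bsub>M\<^esub> m')) = r \<odot>\<^bsub>M\<^esub> (u \<odot>\<^bsub>M\<^esub> (s \<odot>\<^bsub>M\<^esub> m'))"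
      using m s m'(1,2) u(1) r by (simp add: simps)
    also have "\<dots> = u \<odot>\<^bsub>M\<^esub> (s' \<odot>\<^bsub>M\<^esub> (r \<odot>\<^bsub>M\<^esub> m))"
      unfolding u(2) using m s m'(1,2) u(1) r by (simp add: simps)
    finally show ?thesis
      using m s m'(1,2) u(1) r by (subst frac_eq_iff) auto
  qed
  then have "(\<Union>(m', s')\<in>frc m s. frc (r \<odot>\<^bsub>M\<^esub> m') s') = frc (r \<odot>\<^bsub>M\<^esub> m) s"
    by (intro UN_frac m s)
  then show ?thesis by (simp add: loc_module_def)
qed

lemma loc_zero: "\<zero>\<^bsub>loc\<^esub> = frc \<zero>\<^bsub>M\<^esub> \<one>\<^bsub>R\<^esub>"
  by (simp add: loc_module_def)

lemma frac_zero: "s \<in> T \<Longrightarrow> frc \<zero>\<^bsub>M\<^esub> s = frc \<zero>\<^bsub>M\<^esub> \<one>\<^bsub>R\<^esub>"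
  by (subst frac_eq_iff) (auto intro: bexI[of _ "\<one>\<^bsub>R\<^esub>"])

lemma loc_add_same_denominator:
  assumes "m \<in> carrier M" "n \<in> carrier M" "s \<in> T"
  shows "frc m s \<oplus>\<^bsub>loc\<^esub> frc n s = frc (m \<oplus>\<^bsub>M\<^esub> n) s"
  using assms frac_scale[of "m \<oplus>\<^bsub>M\<^esub> n" s s] by (simp add: loc_add M.smult_r_distr)

text \<open>Three fractions are treated at once for the sake of associativity. With equal
  denominators the group axioms turn into those of M.\<close>

lemma common_denominator:
  assumes "x \<in> carrier loc" "y \<in> carrier loc" "z \<in> carrier loc"
  shows "\<exists>m n k. \<exists>s\<in>T. m \<in> carrier M \<and> n \<in> carrier M \<and> k \<in> carrier M
    \<and> x = frc m s \<and> y = frc n s \<and> z = frc k s"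
proof -
  obtain m s n t k u where eqs: "x = frc m s" "y = frc n t" "z = frc k u"
    and mem: "m \<in> carrier M" "n \<in> carrier M" "k \<in> carrier M" "s \<in> T" "t \<in> T" "u \<in> T"
    using assms by (auto simp: loc_carrier)
  have "x = frc ((t \<otimes>\<^bsub>R\<^esub> u) \<odot>\<^bsub>M\<^esub> m) (s \<otimes>\<^bsub>R\<^esub> t \<otimes>\<^bsub>R\<^esub> u)" "y = frc ((s \<otimes>\<^bsub>R\<^esub> u) \<odot>\<^bsub>M\<^esub> n) (s \<otimes>\<^bsub>R\<^esub> t \<otimes>\<^bsub>R\<^esub> u)"
    "z = frc ((s \<otimes>\<^bsub>R\<^esub> t) \<odot>\<^bsub>M\<^esub> k) (s \<otimes>\<^bsub>R\<^esub> t \<otimes>\<^bsub>R\<^esub> u)"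
    unfolding eqs using mem frac_scale[of m s "t \<otimes>\<^bsub>R\<^esub> u"] frac_scale[of n t "s \<otimes>\<^bsub>R\<^esub> u"] frac_scale[of k u "s \<otimes>\<^bsub>R\<^esub> t"]
    by (simp_all add: M.R.m_ac)
  then show ?thesis using mem
    by (intro exI[of _ "(t \<otimes>\<^bsub>R\<^esub> u) \<odot>\<^bsub>M\<^esub> m"] exI[of _ "(s \<otimes>\<^bsub>R\<^esub> u) \<odot>\<^bsub>M\<^esub> n"] exI[of _ "(s \<otimes>\<^bsub>R\<^esub> t) \<odot>\<^bsub>M\<^esub> k"]
        bexI[of _ "s \<otimes>\<^bsub>R\<^esub> t \<otimes>\<^bsub>R\<^esub> u"] conjI) auto
qed

lemma loc_abelian_group: "abelian_group loc"
proof (rule abelian_groupI)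
  fix x y assume xy: "x \<in> carrier loc" "y \<in> carrier loc"
  obtain m n s where *: "s \<in> T" "m \<in> carrier M" "n \<in> carrier M" "x = frc m s" "y = frc n s"
    using common_denominator[OF xy xy(1)] by metis
  show "x \<oplus>\<^bsub>loc\<^esub> y \<in> carrier loc" using * by (simp add: loc_add_same_denominator frac_in_loc)
  show "x \<oplus>\<^bsub>loc\<^esub> y = y \<oplus>\<^bsub>loc\<^esub> x" using * by (simp add: loc_add_same_denominator M.a_comm)
  fix z assume z: "z \<in> carrier loc"
  obtain m n k s where *: "s \<in> T" "m \<in> carrier M" "n \<in> carrier M" "k \<in> carrier M"
    "x = frc m s" "y = frc n s" "z = frc k s"
    using common_denominator[OF xy z] by metis
  show "x \<oplus>\<^bsub>loc\<^esub> y \<oplus>\<^bsub>loc\<^esub> z = x \<oplus>\<^bsub>loc\<^esub> (y \<oplus>\<^bsub>loc\<^esub> z)"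
    using * by (simp add: loc_add_same_denominator M.a_assoc)
next
  show "\<zero>\<^bsub>loc\<^esub> \<in> carrier loc" by (simp add: loc_zero frac_in_loc)
  fix x assume "x \<in> carrier loc"
  then obtain m s where *: "s \<in> T" "m \<in> carrier M" "x = frc m s" by (auto simp: loc_carrier)
  show "\<zero>\<^bsub>loc\<^esub> \<oplus>\<^bsub>loc\<^esub> x = x"
    using * loc_add_same_denominator[of "\<zero>\<^bsub>M\<^esub>" m s] by (simp add: loc_zero frac_zero[of s, symmetric])
  show "\<exists>y\<in>carrier loc. y \<oplus>\<^bsub>loc\<^esub> x = \<zero>\<^bsub>loc\<^esub>"
    using * loc_add_same_denominator[of "\<ominus>\<^bsub>M\<^esub> m" m s]
    by (intro bexI[of _ "frc (\<ominus>\<^bsub>M\<^esub> m) s"]) (simp_all add: loc_zero frac_zero[of s] M.l_neg frac_in_loc)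
qed

end

subsection \<open>Localization maps\<close>

text \<open>These conditions say that \<open>h\<close> becomes an isomorphism once \<open>T\<close>
  is inverted in R and its image in S.\<close>

definition ring_localization :: "'r ring \<Rightarrow> 's ring \<Rightarrow> ('r \<Rightarrow> 's) \<Rightarrow> 'r set \<Rightarrow> bool"
  where "ring_localization R S h T \<longleftrightarrow> cring R \<and> cring S \<and> h \<in> ring_hom R S \<and> submonoid T R
    \<and> (\<forall>s \<in> carrier S. \<exists>t \<in> T. \<exists>r \<in> carrier R. h t \<otimes>\<^bsub>S\<^esub> s = h r)
    \<and> (\<forall>r \<in> carrier R. h r = \<zero>\<^bsub>S\<^esub> \<longrightarrow> (\<exists>t \<in> T. t \<otimes>\<^bsub>R\<^esub> r = \<zero>\<^bsub>R\<^esub>))"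

definition module_localization ::
  "'r ring \<Rightarrow> ('r \<Rightarrow> 's) \<Rightarrow> 'r set \<Rightarrow> ('r, 'm) module \<Rightarrow> ('s, 'n) module \<Rightarrow> ('m \<Rightarrow> 'n) \<Rightarrow> bool"
  where "module_localization R h T M N \<phi> \<longleftrightarrow> \<phi> \<in> semilinear R h M N
    \<and> (\<forall>x \<in> carrier N. \<exists>t \<in> T. \<exists>m \<in> carrier M. h t \<odot>\<^bsub>N\<^esub> x = \<phi> m)
    \<and> (\<forall>m \<in> carrier M. \<phi> m = \<zero>\<^bsub>N\<^esub> \<longrightarrow> (\<exists>t \<in> T. t \<odot>\<^bsub>M\<^esub> m = \<zero>\<^bsub>M\<^esub>))"

locale ring_loc =
  fixes R :: "'r ring" and S :: "'s ring" and h :: "'r \<Rightarrow> 's" and T :: "'r set"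
  assumes loc: "ring_localization R S h T"
begin

lemma R: "cring R" and S: "cring S" and hom: "h \<in> ring_hom R S" and T: "submonoid T R"
  and surj: "s \<in> carrier S \<Longrightarrow> \<exists>t \<in> T. \<exists>r \<in> carrier R. h t \<otimes>\<^bsub>S\<^esub> s = h r"
  and ker: "r \<in> carrier R \<Longrightarrow> h r = \<zero>\<^bsub>S\<^esub> \<Longrightarrow> \<exists>t \<in> T. t \<otimes>\<^bsub>R\<^esub> r = \<zero>\<^bsub>R\<^esub>"
  using loc by (auto simp: ring_localization_def)

sublocale h: ring_hom_cring R S h
  by (intro ring_hom_cring.intro ring_hom_cring_axioms.intro R S hom)

lemma T_in_R: "t \<in> T \<Longrightarrow> t \<in> carrier R"
  using submonoid.subset[OF T] by blast

lemma hom_eqD: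
  assumes "a \<in> carrier R" "b \<in> carrier R" "h a = h b"
  shows "\<exists>t\<in>T. t \<otimes>\<^bsub>R\<^esub> a = t \<otimes>\<^bsub>R\<^esub> b"
proof -
  have "h (a \<oplus>\<^bsub>R\<^esub> \<ominus>\<^bsub>R\<^esub> b) = \<zero>\<^bsub>S\<^esub>" using assms by (simp add: h.S.r_neg)
  then obtain t where t: "t \<in> T" "t \<otimes>\<^bsub>R\<^esub> (a \<oplus>\<^bsub>R\<^esub> \<ominus>\<^bsub>R\<^esub> b) = \<zero>\<^bsub>R\<^esub>"
    using ker[of "a \<oplus>\<^bsub>R\<^esub> \<ominus>\<^bsub>R\<^esub> b"] assms by auto
  have tc: "t \<in> carrier R" using submonoid.subset[OF T] t(1) by auto
  have "t \<otimes>\<^bsub>R\<^esub> a \<oplus>\<^bsub>R\<^esub> \<ominus>\<^bsub>R\<^esub> (t \<otimes>\<^bsub>R\<^esub> b) = \<zero>\<^bsub>R\<^esub>"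
    using t(2) assms(1,2) tc by (simp add: h.R.r_distr h.R.r_minus)
  then have "t \<otimes>\<^bsub>R\<^esub> a = t \<otimes>\<^bsub>R\<^esub> b"
    by (rule h.R.eq_if_diff_zero) (simp_all add: assms tc)
  then show ?thesis using t(1) by blast
qed

end

locale ring_loc_units = ring_loc R S h T
  for R :: "'r ring" and S :: "'s ring" and h :: "'r \<Rightarrow> 's" and T :: "'r set" +
  assumes units: "h ` T \<subseteq> Units S"


context ring_loc_units begin

lemma hT_unit: "t \<in> T \<Longrightarrow> h t \<in> Units S"
  using units by blast

lemma unit_smult_cancel:
  assumes "module S P" "u \<in> Units S" "x \<in> carrier P" "y \<in> carrier P" "u \<odot>\<^bsub>P\<^esub> x = u \<odot>\<^bsub>P\<^esub> y"
  shows "x = y"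
proof -
  interpret P: module S P by fact
  have *: "inv\<^bsub>S\<^esub> u \<odot>\<^bsub>P\<^esub> (u \<odot>\<^bsub>P\<^esub> z) = z" if "z \<in> carrier P" for z
    using that assms(2) by (simp add: P.smult_assoc1[symmetric] h.S.Units_closed)
  have "x = inv\<^bsub>S\<^esub> u \<odot>\<^bsub>P\<^esub> (u \<odot>\<^bsub>P\<^esub> y)" using *[OF assms(3)] unfolding assms(5) ..
  then show ?thesis unfolding *[OF assms(4)] .
qed

text \<open>\<open>loc_module\<close> has scalars in R only. Here s in S acts on T^-1 Q: from h v s
  = h r it should act as r/v. The union runs over all such pairs (r, v), and
  \<open>loc_over_smult\<close> shows that they agree.\<close>

definition loc_over :: "('r, 'm) module \<Rightarrow> ('s, ('m \<times> 'r) set) module"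
  where "loc_over Q = \<lparr>carrier = carrier (loc_module R T Q), monoid.mult = undefined, one = undefined,
      zero = \<zero>\<^bsub>loc_module R T Q\<^esub>, add = add (loc_module R T Q),
      smult = (\<lambda>s x. \<Union>(m, t)\<in>x. \<Union>(r, v)\<in>{(r, v). r \<in> carrier R \<and> v \<in> T \<and> h v \<otimes>\<^bsub>S\<^esub> s = h r}.
        fraction R T Q (r \<odot>\<^bsub>Q\<^esub> m) (v \<otimes>\<^bsub>R\<^esub> t))\<rparr>"

context
  fixes Q :: "('r, 'm) module"
  assumes Q: "module R Q"
begin

interpretation Q: fractions R T Q
  by (intro fractions.intro Q T)

lemma loc_over_smult:
  assumes s: "s \<in> carrier S" and r: "r \<in> carrier R" and v: "v \<in> T" and eq: "h v \<otimes>\<^bsub>S\<^esub> s = h r"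
    and m: "m \<in> carrier Q" and t: "t \<in> T"
  shows "s \<odot>\<^bsub>loc_over Q\<^esub> Q.frc m t = Q.frc (r \<odot>\<^bsub>Q\<^esub> m) (v \<otimes>\<^bsub>R\<^esub> t)"
proof -
  have "Q.frc (r' \<odot>\<^bsub>Q\<^esub> m') (v' \<otimes>\<^bsub>R\<^esub> t') = Q.frc (r \<odot>\<^bsub>Q\<^esub> m) (v \<otimes>\<^bsub>R\<^esub> t)"
    if m': "m' \<in> carrier Q" "t' \<in> T" "Q.frc m' t' = Q.frc m t"
      and r': "r' \<in> carrier R" "v' \<in> T" "h v' \<otimes>\<^bsub>S\<^esub> s = h r'" for m' t' r' v'
  proof -
    obtain u where u: "u \<in> T" "u \<odot>\<^bsub>Q\<^esub> (t \<odot>\<^bsub>Q\<^esub> m') = u \<odot>\<^bsub>Q\<^esub> (t' \<odot>\<^bsub>Q\<^esub> m)"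
      using m' m t Q.frac_eq_iff by auto
    have "h (v \<otimes>\<^bsub>R\<^esub> r') = h v \<otimes>\<^bsub>S\<^esub> (h v' \<otimes>\<^bsub>S\<^esub> s)" using r' v T_in_R by simp
    also have "\<dots> = h v' \<otimes>\<^bsub>S\<^esub> (h v \<otimes>\<^bsub>S\<^esub> s)"
      using s v r' T_in_R by (intro h.S.m_lcomm) auto
    also have "\<dots> = h (v' \<otimes>\<^bsub>R\<^esub> r)" using r r' eq T_in_R by simp
    finally obtain w where w: "w \<in> T" "w \<otimes>\<^bsub>R\<^esub> (v \<otimes>\<^bsub>R\<^esub> r') = w \<otimes>\<^bsub>R\<^esub> (v' \<otimes>\<^bsub>R\<^esub> r)"
      using hom_eqD[of "v \<otimes>\<^bsub>R\<^esub> r'" "v' \<otimes>\<^bsub>R\<^esub> r"] r r' v T_in_R by auto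
    note simps = Q.M.smult_assoc1[symmetric] h.R.m_ac
    have "(u \<otimes>\<^bsub>R\<^esub> w) \<odot>\<^bsub>Q\<^esub> ((v \<otimes>\<^bsub>R\<^esub> t) \<odot>\<^bsub>Q\<^esub> (r' \<odot>\<^bsub>Q\<^esub> m'))
        = (w \<otimes>\<^bsub>R\<^esub> (v \<otimes>\<^bsub>R\<^esub> r')) \<odot>\<^bsub>Q\<^esub> (u \<odot>\<^bsub>Q\<^esub> (t \<odot>\<^bsub>Q\<^esub> m'))"
      using m t v r m'(1,2) r'(1,2) u(1) w(1) by (simp add: simps)
    also have "\<dots> = (u \<otimes>\<^bsub>R\<^esub> w) \<odot>\<^bsub>Q\<^esub> ((v' \<otimes>\<^bsub>R\<^esub> t') \<odot>\<^bsub>Q\<^esub> (r \<odot>\<^bsub>Q\<^esub> m))"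
      unfolding u(2) w(2) using m t v r m'(1,2) r'(1,2) u(1) w(1) by (simp add: simps)
    finally show ?thesis
      using m t v r m'(1,2) r'(1,2) u(1) w(1)
      by (subst Q.frac_eq_iff) (auto intro!: bexI[of _ "u \<otimes>\<^bsub>R\<^esub> w"])
  qed
  note eq' = this
  have "(\<Union>(m', t')\<in>Q.frc m t. \<Union>(r', v')\<in>{(r, v). r \<in> carrier R \<and> v \<in> T \<and> h v \<otimes>\<^bsub>S\<^esub> s = h r}.
        Q.frc (r' \<odot>\<^bsub>Q\<^esub> m') (v' \<otimes>\<^bsub>R\<^esub> t')) = Q.frc (r \<odot>\<^bsub>Q\<^esub> m) (v \<otimes>\<^bsub>R\<^esub> t)"
    by (intro Q.UN_frac m t UN_const_on) (use r v eq eq' in auto)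
  then show ?thesis by (simp add: loc_over_def)
qed

lemma loc_over_simps:
  "carrier (loc_over Q) = carrier Q.loc" "add (loc_over Q) = add Q.loc"
  "\<zero>\<^bsub>loc_over Q\<^esub> = \<zero>\<^bsub>Q.loc\<^esub>"
  by (simp_all add: loc_over_def)

lemma loc_over_module: "module S (loc_over Q)"
proof (rule moduleI[OF S])
  note simps = Q.M.smult_assoc1[symmetric] h.R.m_ac
  show "abelian_group (loc_over Q)"
  proof -
    interpret L: abelian_group Q.loc by (rule Q.loc_abelian_group)
    show ?thesis
      by (rule abelian_groupI)
        (auto simp: loc_over_simps L.a_assoc L.a_comm L.a_lcomm intro!: bexI[of _ "\<ominus>\<^bsub>Q.loc\<^esub> _"] L.l_neg)
  qed
  fix a x assume a: "a \<in> carrier S" and x: "x \<in> carrier (loc_over Q)"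
  obtain r v where rv: "r \<in> carrier R" "v \<in> T" "h v \<otimes>\<^bsub>S\<^esub> a = h r" using surj[OF a] by auto
  obtain m t where mt: "m \<in> carrier Q" "t \<in> T" "x = Q.frc m t"
    using x by (auto simp: loc_over_simps Q.loc_carrier)
  note ax = loc_over_smult[OF a rv(1,2,3) mt(1,2)]
  show "a \<odot>\<^bsub>loc_over Q\<^esub> x \<in> carrier (loc_over Q)"
    unfolding mt(3) ax loc_over_simps using mt(1,2) rv(1,2) by (intro Q.frac_in_loc) auto
  {
    fix y assume y: "y \<in> carrier (loc_over Q)"
    obtain m n t where *: "m \<in> carrier Q" "n \<in> carrier Q" "t \<in> T" "x = Q.frc m t" "y = Q.frc n t"
      using Q.common_denominator[of x y y] x y unfolding loc_over_simps by metis
    show "a \<odot>\<^bsub>loc_over Q\<^esub> (x \<oplus>\<^bsub>loc_over Q\<^esub> y) = a \<odot>\<^bsub>loc_over Q\<^esub> x \<oplus>\<^bsub>loc_over Q\<^esub> a \<odot>\<^bsub>loc_over Q\<^esub> y"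
      unfolding *(4,5) loc_over_simps using *(1-3) rv(1,2)
      by (simp add: Q.loc_add_same_denominator loc_over_smult[OF a rv] Q.M.smult_r_distr)
  }
  {
    fix b assume b: "b \<in> carrier S"
    obtain q w where qw: "q \<in> carrier R" "w \<in> T" "h w \<otimes>\<^bsub>S\<^esub> b = h q" using surj[OF b] by auto
    \<comment> \<open>Both scalars are rewritten with the common denominator v w, so that their sum
      has an obvious numerator.\<close>
    have a': "h (v \<otimes>\<^bsub>R\<^esub> w) \<otimes>\<^bsub>S\<^esub> a = h (w \<otimes>\<^bsub>R\<^esub> r)"
      using rv qw T_in_R a by (simp add: h.S.m_ac rv(3)[symmetric])
    have b': "h (v \<otimes>\<^bsub>R\<^esub> w) \<otimes>\<^bsub>S\<^esub> b = h (v \<otimes>\<^bsub>R\<^esub> q)"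
      using rv qw T_in_R b by (simp add: h.S.m_ac qw(3)[symmetric])
    have sum: "h (v \<otimes>\<^bsub>R\<^esub> w) \<otimes>\<^bsub>S\<^esub> (a \<oplus>\<^bsub>S\<^esub> b) = h (w \<otimes>\<^bsub>R\<^esub> r \<oplus>\<^bsub>R\<^esub> v \<otimes>\<^bsub>R\<^esub> q)"
    proof -
      have "h (v \<otimes>\<^bsub>R\<^esub> w) \<otimes>\<^bsub>S\<^esub> (a \<oplus>\<^bsub>S\<^esub> b) = h (v \<otimes>\<^bsub>R\<^esub> w) \<otimes>\<^bsub>S\<^esub> a \<oplus>\<^bsub>S\<^esub> h (v \<otimes>\<^bsub>R\<^esub> w) \<otimes>\<^bsub>S\<^esub> b"
        using a b rv(2) qw(2) T_in_R by (intro h.S.r_distr) auto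
      then show ?thesis unfolding a' b' using rv qw T_in_R by simp
    qed
    have prod: "h (v \<otimes>\<^bsub>R\<^esub> w) \<otimes>\<^bsub>S\<^esub> (a \<otimes>\<^bsub>S\<^esub> b) = h (r \<otimes>\<^bsub>R\<^esub> q)"
      using a b rv qw T_in_R by (simp add: h.S.m_ac rv(3)[symmetric] qw(3)[symmetric])
    have vw: "v \<otimes>\<^bsub>R\<^esub> w \<in> T" using rv qw by simp
    have cl: "w \<otimes>\<^bsub>R\<^esub> r \<in> carrier R" "v \<otimes>\<^bsub>R\<^esub> q \<in> carrier R" "r \<otimes>\<^bsub>R\<^esub> q \<in> carrier R"
      using rv qw T_in_R by auto
    show "(a \<oplus>\<^bsub>S\<^esub> b) \<odot>\<^bsub>loc_over Q\<^esub> x = a \<odot>\<^bsub>loc_over Q\<^esub> x \<oplus>\<^bsub>loc_over Q\<^esub> b \<odot>\<^bsub>loc_over Q\<^esub> x"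
      unfolding mt(3) loc_over_simps loc_over_smult[OF a cl(1) vw a' mt(1,2)]
        loc_over_smult[OF b cl(2) vw b' mt(1,2)]
        loc_over_smult[OF h.S.a_closed[OF a b] h.R.a_closed[OF cl(1,2)] vw sum mt(1,2)]
      using cl vw mt(1,2) by (simp add: Q.loc_add_same_denominator Q.M.smult_l_distr)
    show "(a \<otimes>\<^bsub>S\<^esub> b) \<odot>\<^bsub>loc_over Q\<^esub> x = a \<odot>\<^bsub>loc_over Q\<^esub> (b \<odot>\<^bsub>loc_over Q\<^esub> x)"
      unfolding mt(3) loc_over_smult[OF b qw mt(1,2)]
        loc_over_smult[OF h.S.m_closed[OF a b] cl(3) vw prod mt(1,2)]
      using rv qw mt(1,2) by (subst loc_over_smult[OF a rv]) (auto simp: simps)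
  }
next
  fix x assume x: "x \<in> carrier (loc_over Q)"
  obtain m t where mt: "m \<in> carrier Q" "t \<in> T" "x = Q.frc m t"
    using x by (auto simp: loc_over_simps Q.loc_carrier)
  show "\<one>\<^bsub>S\<^esub> \<odot>\<^bsub>loc_over Q\<^esub> x = x"
    unfolding mt(3) using mt(1,2)
    by (subst loc_over_smult[of _ "\<one>\<^bsub>R\<^esub>" "\<one>\<^bsub>R\<^esub>"]) auto
qed

lemma loc_over_localization:
  "module_localization R h T Q (loc_over Q) (\<lambda>m. Q.frc m \<one>\<^bsub>R\<^esub>)"
  unfolding module_localization_def semilinear_def
proof (intro conjI ballI impI CollectI)
  show "(\<lambda>m. Q.frc m \<one>\<^bsub>R\<^esub>) \<in> carrier Q \<rightarrow> carrier (loc_over Q)"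
    by (auto simp: loc_over_simps intro: Q.frac_in_loc)
  show "Q.frc (x \<oplus>\<^bsub>Q\<^esub> y) \<one>\<^bsub>R\<^esub> = Q.frc x \<one>\<^bsub>R\<^esub> \<oplus>\<^bsub>loc_over Q\<^esub> Q.frc y \<one>\<^bsub>R\<^esub>"
    if "x \<in> carrier Q" "y \<in> carrier Q" for x y
    using that by (simp add: loc_over_simps Q.loc_add_same_denominator)
  show "Q.frc (r \<odot>\<^bsub>Q\<^esub> x) \<one>\<^bsub>R\<^esub> = h r \<odot>\<^bsub>loc_over Q\<^esub> Q.frc x \<one>\<^bsub>R\<^esub>"
    if "r \<in> carrier R" "x \<in> carrier Q" for r x
    using that by (subst loc_over_smult[of _ r "\<one>\<^bsub>R\<^esub>"]) auto
next
  fix x assume x: "x \<in> carrier (loc_over Q)"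
  obtain m t where mt: "m \<in> carrier Q" "t \<in> T" "x = Q.frc m t"
    using x by (auto simp: loc_over_simps Q.loc_carrier)
  have "h t \<odot>\<^bsub>loc_over Q\<^esub> x = Q.frc (t \<odot>\<^bsub>Q\<^esub> m) (\<one>\<^bsub>R\<^esub> \<otimes>\<^bsub>R\<^esub> t)"
    unfolding mt(3) using mt(1,2) by (subst loc_over_smult[of _ t "\<one>\<^bsub>R\<^esub>"]) auto
  also have "\<dots> = Q.frc m \<one>\<^bsub>R\<^esub>"
    using mt(1,2) Q.frac_scale[of m "\<one>\<^bsub>R\<^esub>" t] by simp
  finally show "\<exists>t\<in>T. \<exists>m\<in>carrier Q. h t \<odot>\<^bsub>loc_over Q\<^esub> x = Q.frc m \<one>\<^bsub>R\<^esub>"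
    using mt(1,2) by auto
next
  fix m assume m: "m \<in> carrier Q" and "Q.frc m \<one>\<^bsub>R\<^esub> = \<zero>\<^bsub>loc_over Q\<^esub>"
  then have "Q.frc m \<one>\<^bsub>R\<^esub> = Q.frc \<zero>\<^bsub>Q\<^esub> \<one>\<^bsub>R\<^esub>" by (simp add: loc_over_simps Q.loc_zero)
  then show "\<exists>t\<in>T. t \<odot>\<^bsub>Q\<^esub> m = \<zero>\<^bsub>Q\<^esub>" using m by (subst (asm) Q.frac_eq_iff) auto
qed

end

lemma module_localization_eq:
  assumes "module R M" "module S N" and loc: "module_localization R h T M N \<phi>"
    and "m \<in> carrier M" "n \<in> carrier M" "\<phi> m = \<phi> n"
  shows "\<exists>t\<in>T. t \<odot>\<^bsub>M\<^esub> m = t \<odot>\<^bsub>M\<^esub> n"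
proof -
  interpret M: module R M by fact
  interpret N: module S N by fact
  have \<phi>: "\<phi> \<in> semilinear R h M N" using loc by (simp add: module_localization_def)
  have "\<phi> (m \<oplus>\<^bsub>M\<^esub> \<ominus>\<^bsub>M\<^esub> n) = \<phi> m \<oplus>\<^bsub>N\<^esub> \<ominus>\<^bsub>N\<^esub> \<phi> n"
    using semilinearD[OF \<phi>] semilinear_minus[OF assms(1,2) \<phi>] assms(4,5) by simp
  also have "\<dots> = \<zero>\<^bsub>N\<^esub>" using semilinearD(1)[OF \<phi>] assms(4-6) by (simp add: N.M.r_neg)
  finally obtain t where t: "t \<in> T" "t \<odot>\<^bsub>M\<^esub> (m \<oplus>\<^bsub>M\<^esub> \<ominus>\<^bsub>M\<^esub> n) = \<zero>\<^bsub>M\<^esub>"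
    using loc assms(4,5) unfolding module_localization_def by (meson M.M.a_closed M.M.a_inv_closed)
  then have "t \<odot>\<^bsub>M\<^esub> m \<oplus>\<^bsub>M\<^esub> \<ominus>\<^bsub>M\<^esub> (t \<odot>\<^bsub>M\<^esub> n) = \<zero>\<^bsub>M\<^esub>"
    using assms(4,5) T_in_R by (simp add: M.smult_r_distr M.smult_r_minus)
  then have "t \<odot>\<^bsub>M\<^esub> m = t \<odot>\<^bsub>M\<^esub> n"
    by (rule M.M.eq_if_diff_zero) (use assms(4,5) t T_in_R in auto)
  then show ?thesis using t by blast
qed

text \<open>Only multiplicativity of \<open>g\<close> is required since additivity of \<open>\<psi>\<close> comes from that of \<open>\<kappa>\<close>; the
  Frobenius of \<open>S\<close> is an instance.\<close>

lemma module_localization_lift: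
  assumes M: "module R M" and N: "module S N" and P: "module S P"
    and loc: "module_localization R h T M N \<phi>"
    and g: "g \<in> carrier S \<rightarrow> carrier S" "g ` Units S \<subseteq> Units S" "g \<one>\<^bsub>S\<^esub> = \<one>\<^bsub>S\<^esub>"
      "\<And>x y. \<lbrakk>x \<in> carrier S; y \<in> carrier S\<rbrakk> \<Longrightarrow> g (x \<otimes>\<^bsub>S\<^esub> y) = g x \<otimes>\<^bsub>S\<^esub> g y"
    and \<kappa>: "\<kappa> \<in> semilinear R (\<lambda>r. g (h r)) M P"
  shows "\<exists>\<psi> \<in> semilinear S g N P. \<forall>m\<in>carrier M. \<psi> (\<phi> m) = \<kappa> m"
proof -
  interpret M: module R M by fact
  interpret N: module S N by fact
  interpret P: module S P by fact
  have \<phi>: "\<phi> \<in> semilinear R h M N" using loc by (simp add: module_localization_def)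
  note \<phi>D = semilinearD[OF \<phi>] and \<kappa>D = semilinearD[OF \<kappa>]
  have gu: "g (h t) \<in> Units S" "g (h t) \<in> carrier S" if "t \<in> T" for t
    using hT_unit[OF that] g(2) by auto
  have gc: "g s \<in> carrier S" if "s \<in> carrier S" for s using g(1) that by auto
  have ex: "\<exists>t m. t \<in> T \<and> m \<in> carrier M \<and> h t \<odot>\<^bsub>N\<^esub> x = \<phi> m" if "x \<in> carrier N" for x
    using loc that unfolding module_localization_def by blast
  define t0 where "t0 x = fst (SOME (t, m). t \<in> T \<and> m \<in> carrier M \<and> h t \<odot>\<^bsub>N\<^esub> x = \<phi> m)" for x
  define m0 where "m0 x = snd (SOME (t, m). t \<in> T \<and> m \<in> carrier M \<and> h t \<odot>\<^bsub>N\<^esub> x = \<phi> m)" for x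
  have tm0: "t0 x \<in> T" "m0 x \<in> carrier M" "h (t0 x) \<odot>\<^bsub>N\<^esub> x = \<phi> (m0 x)" if "x \<in> carrier N" for x
  proof -
    have "case (SOME (t, m). t \<in> T \<and> m \<in> carrier M \<and> h t \<odot>\<^bsub>N\<^esub> x = \<phi> m) of (t, m) \<Rightarrow>
        t \<in> T \<and> m \<in> carrier M \<and> h t \<odot>\<^bsub>N\<^esub> x = \<phi> m"
      using someI_ex[of "\<lambda>(t, m). t \<in> T \<and> m \<in> carrier M \<and> h t \<odot>\<^bsub>N\<^esub> x = \<phi> m"] ex[OF that] by simp
    then show "t0 x \<in> T" "m0 x \<in> carrier M" "h (t0 x) \<odot>\<^bsub>N\<^esub> x = \<phi> (m0 x)"
      unfolding t0_def m0_def by (simp_all add: case_prod_beta)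
  qed
  \<comment> \<open>Semilinearity forces this value: from h t x = \<phi> m it follows that g (h t)
    \<psi>(x) = \<kappa>(m), and g (h t) is a unit.\<close>
  define \<psi> where "\<psi> x = inv\<^bsub>S\<^esub> (g (h (t0 x))) \<odot>\<^bsub>P\<^esub> \<kappa> (m0 x)" for x
  have \<psi>c: "\<psi> x \<in> carrier P" if "x \<in> carrier N" for x
    unfolding \<psi>_def using tm0[OF that] gu \<kappa>D(1) by auto
  have \<psi>0: "g (h (t0 x)) \<odot>\<^bsub>P\<^esub> \<psi> x = \<kappa> (m0 x)" if "x \<in> carrier N" for x
    unfolding \<psi>_def using tm0[OF that] gu \<kappa>D(1) by (simp add: P.smult_assoc1[symmetric])
  \<comment> \<open>Any denominator computes \<psi>, not only the chosen \<open>t0 x\<close>. Sums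
    and scalar multiples can then be treated with the product denominators that occur
    naturally.\<close>
  have key: "g (h t) \<odot>\<^bsub>P\<^esub> \<psi> x = \<kappa> m"
    if x: "x \<in> carrier N" and t: "t \<in> T" and m: "m \<in> carrier M" and eq: "h t \<odot>\<^bsub>N\<^esub> x = \<phi> m" for x t m
  proof -
    note t0 = tm0(1)[OF x] and m0 = tm0(2)[OF x] and eq0 = tm0(3)[OF x]
    note Tc = T_in_R[OF t] T_in_R[OF t0]
    have "\<phi> (t \<odot>\<^bsub>M\<^esub> m0 x) = h t \<odot>\<^bsub>N\<^esub> (h (t0 x) \<odot>\<^bsub>N\<^esub> x)" using m0 eq0 Tc \<phi>D(3) by simp
    also have "\<dots> = h (t0 x) \<odot>\<^bsub>N\<^esub> (h t \<odot>\<^bsub>N\<^esub> x)"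
      using Tc x by (simp add: N.smult_assoc1[symmetric] h.S.m_comm)
    also have "\<dots> = \<phi> (t0 x \<odot>\<^bsub>M\<^esub> m)" using m eq Tc \<phi>D(3) by simp
    finally obtain u where u: "u \<in> T" "u \<odot>\<^bsub>M\<^esub> (t \<odot>\<^bsub>M\<^esub> m0 x) = u \<odot>\<^bsub>M\<^esub> (t0 x \<odot>\<^bsub>M\<^esub> m)"
      using module_localization_eq[OF M N loc, of "t \<odot>\<^bsub>M\<^esub> m0 x" "t0 x \<odot>\<^bsub>M\<^esub> m"] m m0 Tc by auto
    note uc = T_in_R[OF u(1)]
    have "g (h u) \<odot>\<^bsub>P\<^esub> (g (h (t0 x)) \<odot>\<^bsub>P\<^esub> (g (h t) \<odot>\<^bsub>P\<^esub> \<psi> x))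
        = g (h u) \<odot>\<^bsub>P\<^esub> (g (h t) \<odot>\<^bsub>P\<^esub> (g (h (t0 x)) \<odot>\<^bsub>P\<^esub> \<psi> x))"
      using gu(2)[OF t] gu(2)[OF t0] gu(2)[OF u(1)] \<psi>c[OF x]
      by (simp add: P.smult_assoc1[symmetric] h.S.m_ac)
    also have "\<dots> = \<kappa> (u \<odot>\<^bsub>M\<^esub> (t \<odot>\<^bsub>M\<^esub> m0 x))" using \<psi>0[OF x] \<kappa>D(3) m0 Tc uc by simp
    also have "\<dots> = g (h u) \<odot>\<^bsub>P\<^esub> (g (h (t0 x)) \<odot>\<^bsub>P\<^esub> \<kappa> m)" unfolding u(2) using \<kappa>D(3) m Tc uc by simp
    finally have "g (h (t0 x)) \<odot>\<^bsub>P\<^esub> (g (h t) \<odot>\<^bsub>P\<^esub> \<psi> x) = g (h (t0 x)) \<odot>\<^bsub>P\<^esub> \<kappa> m"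
      by (rule unit_smult_cancel[OF P gu(1)[OF u(1)], rotated 2])
        (use gu(2)[OF t] gu(2)[OF t0] \<psi>c[OF x] \<kappa>D(1)[OF m] in auto)
    then show ?thesis
      by (rule unit_smult_cancel[OF P gu(1)[OF t0], rotated 2])
        (use gu(2)[OF t] \<psi>c[OF x] \<kappa>D(1)[OF m] in auto)
  qed
  have "\<psi> \<in> semilinear S g N P"
    unfolding semilinear_def
  proof (intro CollectI conjI ballI Pi_I)
    show "\<psi> x \<in> carrier P" if "x \<in> carrier N" for x by (rule \<psi>c[OF that])
  next
    fix x y assume x: "x \<in> carrier N" and y: "y \<in> carrier N"
    note tx = tm0[OF x] and ty = tm0[OF y]
    let ?t = "t0 x" and ?v = "t0 y" and ?m = "m0 x" and ?n = "m0 y"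
    note Tc = T_in_R[OF tx(1)] T_in_R[OF ty(1)]
    have tv: "?t \<otimes>\<^bsub>R\<^esub> ?v \<in> T" using tx ty submonoid.m_closed[OF T] by simp
    have "h (?t \<otimes>\<^bsub>R\<^esub> ?v) \<odot>\<^bsub>N\<^esub> (x \<oplus>\<^bsub>N\<^esub> y) = h ?v \<odot>\<^bsub>N\<^esub> (h ?t \<odot>\<^bsub>N\<^esub> x) \<oplus>\<^bsub>N\<^esub> h ?t \<odot>\<^bsub>N\<^esub> (h ?v \<odot>\<^bsub>N\<^esub> y)"
      using x y Tc by (simp add: N.smult_r_distr N.smult_assoc1[symmetric] h.S.m_comm)
    also have "\<dots> = \<phi> (?v \<odot>\<^bsub>M\<^esub> ?m \<oplus>\<^bsub>M\<^esub> ?t \<odot>\<^bsub>M\<^esub> ?n)"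
      unfolding tx(3) ty(3) using tx(2) ty(2) Tc \<phi>D by simp
    finally have "g (h (?t \<otimes>\<^bsub>R\<^esub> ?v)) \<odot>\<^bsub>P\<^esub> \<psi> (x \<oplus>\<^bsub>N\<^esub> y) = \<kappa> (?v \<odot>\<^bsub>M\<^esub> ?m \<oplus>\<^bsub>M\<^esub> ?t \<odot>\<^bsub>M\<^esub> ?n)"
      using x y tv tx(2) ty(2) Tc by (intro key) auto
    also have "\<dots> = g (h ?v) \<odot>\<^bsub>P\<^esub> (g (h ?t) \<odot>\<^bsub>P\<^esub> \<psi> x) \<oplus>\<^bsub>P\<^esub> g (h ?t) \<odot>\<^bsub>P\<^esub> (g (h ?v) \<odot>\<^bsub>P\<^esub> \<psi> y)"
      unfolding \<psi>0[OF x] \<psi>0[OF y] using tx(2) ty(2) Tc \<kappa>D by simp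
    also have "\<dots> = g (h (?t \<otimes>\<^bsub>R\<^esub> ?v)) \<odot>\<^bsub>P\<^esub> (\<psi> x \<oplus>\<^bsub>P\<^esub> \<psi> y)"
      using \<psi>c[OF x] \<psi>c[OF y] gu(2)[OF tx(1)] gu(2)[OF ty(1)] Tc
      by (simp add: P.smult_r_distr P.smult_assoc1[symmetric] h.S.m_comm g(4))
    finally show "\<psi> (x \<oplus>\<^bsub>N\<^esub> y) = \<psi> x \<oplus>\<^bsub>P\<^esub> \<psi> y"
      by (rule unit_smult_cancel[OF P gu(1)[OF tv], rotated 2]) (use x y \<psi>c in auto)
  next
    fix s x assume s: "s \<in> carrier S" and x: "x \<in> carrier N"
    note tx = tm0[OF x]
    let ?t = "t0 x" and ?m = "m0 x"
    obtain v r where vr: "v \<in> T" "r \<in> carrier R" "h v \<otimes>\<^bsub>S\<^esub> s = h r" using surj[OF s] by blast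
    note Tc = T_in_R[OF tx(1)] T_in_R[OF vr(1)]
    have tv: "v \<otimes>\<^bsub>R\<^esub> ?t \<in> T" using tx vr submonoid.m_closed[OF T] by simp
    have "h (v \<otimes>\<^bsub>R\<^esub> ?t) \<odot>\<^bsub>N\<^esub> (s \<odot>\<^bsub>N\<^esub> x) = (h v \<otimes>\<^bsub>S\<^esub> s) \<odot>\<^bsub>N\<^esub> (h ?t \<odot>\<^bsub>N\<^esub> x)"
      using x s Tc by (simp add: N.smult_assoc1[symmetric] h.S.m_ac)
    also have "\<dots> = \<phi> (r \<odot>\<^bsub>M\<^esub> ?m)" unfolding vr(3) tx(3) using vr(2) tx(2) \<phi>D by simp
    finally have "g (h (v \<otimes>\<^bsub>R\<^esub> ?t)) \<odot>\<^bsub>P\<^esub> \<psi> (s \<odot>\<^bsub>N\<^esub> x) = \<kappa> (r \<odot>\<^bsub>M\<^esub> ?m)"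
      using x s tv tx(2) vr(2) by (intro key) auto
    also have "\<dots> = g (h v \<otimes>\<^bsub>S\<^esub> s) \<odot>\<^bsub>P\<^esub> (g (h ?t) \<odot>\<^bsub>P\<^esub> \<psi> x)"
      unfolding \<psi>0[OF x] vr(3) using vr(2) tx(2) \<kappa>D by simp
    also have "\<dots> = g (h (v \<otimes>\<^bsub>R\<^esub> ?t)) \<odot>\<^bsub>P\<^esub> (g s \<odot>\<^bsub>P\<^esub> \<psi> x)"
      using \<psi>c[OF x] gu(2)[OF tx(1)] gu(2)[OF vr(1)] Tc s gc[OF s]
      by (simp add: P.smult_assoc1[symmetric] h.S.m_ac g(4))
    finally show "\<psi> (s \<odot>\<^bsub>N\<^esub> x) = g s \<odot>\<^bsub>P\<^esub> \<psi> x"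
      by (rule unit_smult_cancel[OF P gu(1)[OF tv], rotated 2]) (use x s gc \<psi>c in auto)
  qed
  moreover have "\<psi> (\<phi> m) = \<kappa> m" if m: "m \<in> carrier M" for m
  proof -
    have "g (h \<one>\<^bsub>R\<^esub>) \<odot>\<^bsub>P\<^esub> \<psi> (\<phi> m) = \<kappa> m"
      using m \<phi>D(1)[OF m] submonoid.one_closed[OF T] by (intro key) auto
    then show ?thesis using g(3) \<psi>c[OF \<phi>D(1)[OF m]] by simp
  qed
  ultimately show ?thesis by blast
qed

end


subsection \<open>Frobenius powers of submodules\<close>

lemma ring_hom_nat_pow:
  assumes "cring R" "cring S" "h \<in> ring_hom R S" "x \<in> carrier R"
  shows "h (x [^]\<^bsub>R\<^esub> (n::nat)) = h x [^]\<^bsub>S\<^esub> n"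
proof -
  interpret R: cring R by fact
  interpret S: cring S by fact
  show ?thesis
    using assms(3,4) by (induction n) (auto simp: ring_hom_one ring_hom_mult)
qed

lemma (in cring) ideal_intro:
  assumes "I \<subseteq> carrier R" "\<zero> \<in> I" "\<And>a b. \<lbrakk>a \<in> I; b \<in> I\<rbrakk> \<Longrightarrow> a \<oplus> b \<in> I"
    and mult: "\<And>x a. \<lbrakk>x \<in> carrier R; a \<in> I\<rbrakk> \<Longrightarrow> x \<otimes> a \<in> I"
  shows "ideal I R"
proof (rule idealI[OF ring_axioms])
  have "\<ominus> a \<in> I" if "a \<in> I" for a
  proof -
    have "a \<in> carrier R" using that assms(1) by auto
    then have "\<ominus> a = (\<ominus> \<one>) \<otimes> a" by (simp add: l_minus)
    then show ?thesis using mult[OF _ that, of "\<ominus> \<one>"] by simp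
  qed
  then show "subgroup I (add_monoid R)"
    by (intro subgroup.intro) (use assms in \<open>auto simp: a_inv_def[symmetric]\<close>)
  show "x \<otimes> a \<in> I" if "a \<in> I" "x \<in> carrier R" for a x using mult that by simp
  then show "a \<otimes> x \<in> I" if "a \<in> I" "x \<in> carrier R" for a x
    using that assms(1) m_comm[of a x] by auto
qed

text \<open>Membership of \<open>s z\<^sup>q\<close> in \<open>L\<^sup>[\<^sup>q\<^sup>]\<close>, where \<open>q = p\<^sup>e\<close>.\<close>

definition frob_mem :: "nat \<Rightarrow> nat \<Rightarrow> 'r ring \<Rightarrow> ('r, 'm) module \<Rightarrow> 'm set \<Rightarrow> 'm \<Rightarrow> 'r \<Rightarrow> bool"
  where "frob_mem p e R M L z s \<longleftrightarrow>
    s \<odot>\<^bsub>base_change R R (frob_iter p e R) M\<^esub> base_change_elt R R (frob_iter p e R) M z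
      \<in> base_change_image R R (frob_iter p e R) M L"

lemma frob_setup:
  assumes "module R M"
  shows "base_change_setup R R (frob_iter p e R) M"
proof -
  interpret M: module R M by fact
  show ?thesis by unfold_locales (auto simp: assms frob_iter_def M.R.is_cring)
qed

context
  fixes p e :: nat and R :: "'r ring" and M :: "('r, 'm) module" and L :: "'m set"
  assumes M: "module R M" and L: "submodule L R M"
begin

interpretation M: module R M by (rule M)
interpretation F: base_change_setup R R "frob_iter p e R" M by (rule frob_setup[OF M])
interpretation B: module R F.B by (rule F.base_change_module)

lemmas im = submodule_closed[OF F.base_change_module F.base_change_image_submodule[OF L]]
lemmas el = semilinearD[OF F.base_change_elt_semilinear]

text \<open>Treating all multipliers of z^q together is what makes the radical arguments available:
  a membership may be tested after multiplication by powers of generators.\<close>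

lemma frob_mem_ideal:
  assumes z: "z \<in> carrier M"
  shows "ideal {s \<in> carrier R. frob_mem p e R M L z s} R"
  by (rule M.R.ideal_intro)
    (use im el(1)[OF z] in \<open>auto simp: frob_mem_def B.smult_l_distr B.smult_assoc1\<close>)

lemma frob_mem_multc:
  assumes "z \<in> carrier M" "frob_mem p e R M L z s" "s \<in> carrier R" "r \<in> carrier R"
  shows "frob_mem p e R M L z (r \<otimes>\<^bsub>R\<^esub> s)"
  using ideal.I_l_closed[OF frob_mem_ideal[OF assms(1)], of s r] assms by simp

lemma frob_mem_base:
  assumes "z \<in> L" "s \<in> carrier R"
  shows "frob_mem p e R M L z s"
  unfolding frob_mem_def using assms im(5) F.base_change_elt_image[OF L] by simp

lemma frob_mem_add:
  assumes "z \<in> carrier M" "w \<in> carrier M" "s \<in> carrier R"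
    and "frob_mem p e R M L z s" "frob_mem p e R M L w s"
  shows "frob_mem p e R M L (z \<oplus>\<^bsub>M\<^esub> w) s"
  using assms im(3) unfolding frob_mem_def by (simp add: el B.smult_r_distr)

text \<open>From (r z)^q = r^q z^q: the factor r^q is a scalar and leaves L^[q] stable, so the
  multiplier s stays the same.\<close>

lemma frob_mem_smult:
  assumes "z \<in> carrier M" "r \<in> carrier R" "s \<in> carrier R" "frob_mem p e R M L z s"
  shows "frob_mem p e R M L (r \<odot>\<^bsub>M\<^esub> z) s"
proof -
  have fr: "frob_iter p e R r \<in> carrier R" using assms(2) by (simp add: frob_iter_def)
  have "s \<odot>\<^bsub>F.B\<^esub> F.elt (r \<odot>\<^bsub>M\<^esub> z) = frob_iter p e R r \<odot>\<^bsub>F.B\<^esub> (s \<odot>\<^bsub>F.B\<^esub> F.elt z)"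
    using assms fr el(1)[OF assms(1)] by (simp add: el(3) B.smult_assoc1[symmetric] M.R.m_comm)
  then show ?thesis using im(5)[OF fr] assms(4) unfolding frob_mem_def by simp
qed

lemma frob_mem_mono:
  assumes L': "submodule L' R M" "L \<subseteq> L'" and "frob_mem p e R M L z s"
  shows "frob_mem p e R M L' z s"
proof -
  have "F.elt ` L \<subseteq> base_change_image R R (frob_iter p e R) M L'"
    using F.base_change_elt_image[OF L'(1)] L'(2) by auto
  then have "base_change_image R R (frob_iter p e R) M L \<subseteq> base_change_image R R (frob_iter p e R) M L'"
    unfolding F.base_change_image[OF L]
    by (rule gen_submodule_least[OF F.base_change_image_submodule[OF L'(1)]])
  then show ?thesis using assms(3) unfolding frob_mem_def by auto
qed

text \<open>Since h(r^q) = h(r)^q, the map m -> \<phi>(m)^q is semilinear over the Frobenius of R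
  and induces a map F^e(M) -> F^e(N). This map sends the generators z^q of L^[q] into
  L'^[q].\<close>

lemma frob_mem_push:
  fixes S :: "'s ring" and N :: "('s, 'n) module"
  assumes N: "module S N" and h: "h \<in> ring_hom R S" and \<phi>: "\<phi> \<in> semilinear R h M N"
    and L': "submodule L' S N" and \<phi>L: "\<phi> ` L \<subseteq> L'"
    and z: "z \<in> carrier M" and s: "s \<in> carrier R" and mem: "frob_mem p e R M L z s"
  shows "frob_mem p e S N L' (\<phi> z) (h s)"
proof -
  interpret N: module S N by (rule N)
  interpret G: base_change_setup S S "frob_iter p e S" N by (rule frob_setup[OF N])
  note gl = semilinearD[OF G.base_change_elt_semilinear] and \<phi>D = semilinearD[OF \<phi>]
  \<comment> \<open>F^e(N) is viewed as an R-module through h, because the universal property of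
    F^e(M) concerns R-modules.\<close>
  let ?P = "restrict_scalars h G.B"
  have P: "module R ?P" by (rule restrict_scalars_module[OF G.base_change_module M.R.is_cring h])
  have "(\<lambda>m. G.elt (\<phi> m)) \<in> semilinear R (frob_iter p e R) M ?P"
    unfolding semilinear_def
    using gl \<phi>D ring_hom_closed[OF h] ring_hom_nat_pow[OF M.R.is_cring N.R.is_cring h]
    by (auto simp: restrict_scalars_def frob_iter_def)
  from F.base_change_lift[OF P this]
  obtain \<Psi> where \<Psi>: "\<Psi> \<in> semilinear R (\<lambda>s. s) F.B ?P"
    and \<Psi>e: "\<And>m. m \<in> carrier M \<Longrightarrow> \<Psi> (F.elt m) = G.elt (\<phi> m)"
    by auto
  let ?I = "base_change_image S S (frob_iter p e S) N L'"
  note im' = submodule_closed[OF G.base_change_module G.base_change_image_submodule[OF L']]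
  have "submodule ?I R ?P"
    by (rule submodule_intro[OF P])
      (use im' ring_hom_closed[OF h] in \<open>auto simp: restrict_scalars_def\<close>)
  then have "submodule {u \<in> carrier F.B. \<Psi> u \<in> ?I} R F.B"
    by (intro semilinear_vimage_submodule[OF F.base_change_module P _ \<Psi>]) auto
  moreover have "F.elt ` L \<subseteq> {u \<in> carrier F.B. \<Psi> u \<in> ?I}"
    using \<phi>L \<Psi>e el(1) submodule_closed(1)[OF M L] G.base_change_elt_image[OF L']
    unfolding image_subset_iff by (simp add: subset_eq)
  ultimately have "base_change_image R R (frob_iter p e R) M L \<subseteq> {u \<in> carrier F.B. \<Psi> u \<in> ?I}"
    unfolding F.base_change_image[OF L] by (rule gen_submodule_least)
  then have "\<Psi> (s \<odot>\<^bsub>F.B\<^esub> F.elt z) \<in> ?I" using mem unfolding frob_mem_def by auto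
  also have "\<Psi> (s \<odot>\<^bsub>F.B\<^esub> F.elt z) = h s \<odot>\<^bsub>G.B\<^esub> G.elt (\<phi> z)"
    using semilinearD(3)[OF \<Psi> s el(1)[OF z]] \<Psi>e[OF z] by (simp add: restrict_scalars_def)
  finally show ?thesis unfolding frob_mem_def .
qed

text \<open>The universal property of F^e(N) provides an S-linear map to T^-1 (F^e(M)/L^[q]) that
  sends \<phi>(m)^q to the class of m^q over 1. It kills L'^[q], so s z^q becomes 0 there, and a
  vanishing fraction has a numerator killed by some t in T.\<close>

lemma frob_mem_pull:
  fixes S :: "'s ring" and N :: "('s, 'n) module"
  assumes RS: "ring_loc_units R S h T" and N: "module S N" and loc: "module_localization R h T M N \<phi>"
    and L': "submodule L' S N" and L'L: "\<And>x. x \<in> L' \<Longrightarrow> \<exists>t\<in>T. \<exists>m\<in>L. h t \<odot>\<^bsub>N\<^esub> x = \<phi> m"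
    and z: "z \<in> carrier M" and s: "s \<in> carrier R" and mem: "frob_mem p e S N L' (\<phi> z) (h s)"
  shows "\<exists>t\<in>T. frob_mem p e R M L z (t \<otimes>\<^bsub>R\<^esub> s)"
proof -
  interpret RS: ring_loc_units R S h T by (rule RS)
  interpret N: module S N by (rule N)
  interpret G: base_change_setup S S "frob_iter p e S" N by (rule frob_setup[OF N])
  note gl = semilinearD[OF G.base_change_elt_semilinear]
  let ?I = "base_change_image R R (frob_iter p e R) M L"
  have I: "submodule ?I R F.B" by (rule F.base_change_image_submodule[OF L])
  define Q where "Q = quot_module F.B ?I"
  have Q: "module R Q" unfolding Q_def by (rule quot_module_module[OF F.base_change_module I])
  interpret Q: module R Q by (rule Q)
  define P where "P = RS.loc_over Q"
  define \<mu> where "\<mu> m = fraction R T Q m \<one>\<^bsub>R\<^esub>" for m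
  have P: "module S P" unfolding P_def by (rule RS.loc_over_module[OF Q])
  interpret P: module S P by (rule P)
  have \<mu>loc: "module_localization R h T Q P \<mu>"
    unfolding P_def \<mu>_def by (rule RS.loc_over_localization[OF Q])
  then have \<mu>: "\<mu> \<in> semilinear R h Q P" by (simp add: module_localization_def)
  have coset: "(\<lambda>u. ?I +>\<^bsub>F.B\<^esub> u) \<in> semilinear R (\<lambda>r. r) F.B Q"
    unfolding Q_def by (rule quot_semilinear[OF F.base_change_module I])
  define \<kappa> where "\<kappa> m = \<mu> (?I +>\<^bsub>F.B\<^esub> F.elt m)" for m
  note cD = semilinearD[OF coset] and \<mu>D = semilinearD[OF \<mu>]
  have frobR: "frob_iter p e R r \<in> carrier R" if "r \<in> carrier R" for r
    using that by (simp add: frob_iter_def)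
  have \<kappa>: "\<kappa> \<in> semilinear R (\<lambda>r. frob_iter p e S (h r)) M P"
    unfolding semilinear_def \<kappa>_def
    using el cD \<mu>D frobR ring_hom_nat_pow[OF M.R.is_cring RS.S RS.hom]
    by (auto simp: frob_iter_def)
  have "\<exists>\<psi> \<in> semilinear S (frob_iter p e S) N P. \<forall>m\<in>carrier M. \<psi> (\<phi> m) = \<kappa> m"
  proof (rule RS.module_localization_lift[OF M N P loc _ _ _ _ \<kappa>])
    show "frob_iter p e S ` Units S \<subseteq> Units S"
      by (auto simp: frob_iter_def intro!: RS.h.S.Units_pow_closed)
  qed (auto simp: frob_iter_def RS.h.S.nat_pow_distrib)
  then obtain \<psi> where \<psi>: "\<psi> \<in> semilinear S (frob_iter p e S) N P"
    and \<psi>\<phi>: "\<And>m. m \<in> carrier M \<Longrightarrow> \<psi> (\<phi> m) = \<kappa> m" by blast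
  note \<psi>D = semilinearD[OF \<psi>]
  obtain \<Psi> where \<Psi>: "\<Psi> \<in> semilinear S (\<lambda>s. s) G.B P"
    and \<Psi>e: "\<And>x. x \<in> carrier N \<Longrightarrow> \<Psi> (G.elt x) = \<psi> x"
    using G.base_change_lift[OF P \<psi>] by auto
  have \<kappa>L: "\<kappa> m = \<zero>\<^bsub>P\<^esub>" if m: "m \<in> L" for m
  proof -
    interpret ab: abelian_subgroup ?I F.B by (rule submodule_abelian_subgroup[OF F.base_change_module I])
    have "?I +>\<^bsub>F.B\<^esub> F.elt m = \<zero>\<^bsub>Q\<^esub>"
      unfolding Q_def quot_module_zero by (rule ab.a_rcos_const[OF F.base_change_elt_image[OF L m]])
    then show ?thesis unfolding \<kappa>_def using semilinear_zero[OF Q P \<mu>] by simp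
  qed
  \<comment> \<open>An element of L' is \<phi>(m) divided by some h t, with m in L. Under \<psi> the
    denominator becomes the unit (h t)^q, while \<phi>(m) goes to 0.\<close>
  have \<psi>L': "\<psi> x = \<zero>\<^bsub>P\<^esub>" if x: "x \<in> L'" for x
  proof -
    have xN: "x \<in> carrier N" using x submodule_closed(1)[OF N L'] by auto
    obtain t m where tm: "t \<in> T" "m \<in> L" "h t \<odot>\<^bsub>N\<^esub> x = \<phi> m" using L'L[OF x] by auto
    have m: "m \<in> carrier M" using tm(2) submodule_closed(1)[OF M L] by auto
    have u: "frob_iter p e S (h t) \<in> Units S"
      using RS.hT_unit[OF tm(1)] by (auto simp: frob_iter_def intro: RS.h.S.Units_pow_closed)
    have "frob_iter p e S (h t) \<odot>\<^bsub>P\<^esub> \<psi> x = \<psi> (\<phi> m)"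
      using \<psi>D(3)[of "h t" x] xN tm RS.hT_unit[OF tm(1)] by auto
    also have "\<dots> = \<zero>\<^bsub>P\<^esub>" using \<psi>\<phi>[OF m] \<kappa>L[OF tm(2)] by simp
    also have "\<dots> = frob_iter p e S (h t) \<odot>\<^bsub>P\<^esub> \<zero>\<^bsub>P\<^esub>" using u by auto
    finally show ?thesis
      by (rule RS.unit_smult_cancel[OF P u, rotated 2]) (use \<psi>D(1)[OF xN] in auto)
  qed
  have "submodule {u \<in> carrier G.B. \<Psi> u \<in> {\<zero>\<^bsub>P\<^esub>}} S G.B"
    by (rule semilinear_vimage_submodule[OF G.base_change_module P _ \<Psi>])
      (auto intro: submodule_intro[OF P])
  moreover have "G.elt ` L' \<subseteq> {u \<in> carrier G.B. \<Psi> u \<in> {\<zero>\<^bsub>P\<^esub>}}"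
    using gl(1) \<Psi>e \<psi>L' submodule_closed(1)[OF N L'] unfolding image_subset_iff by (simp add: subset_eq)
  ultimately have ker: "base_change_image S S (frob_iter p e S) N L' \<subseteq> {u \<in> carrier G.B. \<Psi> u \<in> {\<zero>\<^bsub>P\<^esub>}}"
    unfolding G.base_change_image[OF L'] by (rule gen_submodule_least)
  have \<phi>z: "\<phi> z \<in> carrier N"
    using loc z unfolding module_localization_def semilinear_def by auto
  have hs: "h s \<in> carrier S" using s by simp
  have "\<Psi> (h s \<odot>\<^bsub>G.B\<^esub> G.elt (\<phi> z)) = \<zero>\<^bsub>P\<^esub>"
    using mem ker unfolding frob_mem_def by auto
  also have "\<Psi> (h s \<odot>\<^bsub>G.B\<^esub> G.elt (\<phi> z)) = h s \<odot>\<^bsub>P\<^esub> \<kappa> z"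
    using semilinearD(3)[OF \<Psi> hs gl(1)[OF \<phi>z]] \<Psi>e[OF \<phi>z] \<psi>\<phi>[OF z] by simp
  also have "\<dots> = \<mu> (?I +>\<^bsub>F.B\<^esub> (s \<odot>\<^bsub>F.B\<^esub> F.elt z))"
    unfolding \<kappa>_def using \<mu>D(3)[OF s cD(1)[OF el(1)[OF z]]] cD(3)[OF s el(1)[OF z]] by simp
  finally have "\<mu> (?I +>\<^bsub>F.B\<^esub> (s \<odot>\<^bsub>F.B\<^esub> F.elt z)) = \<zero>\<^bsub>P\<^esub>" .
  moreover have sz: "s \<odot>\<^bsub>F.B\<^esub> F.elt z \<in> carrier F.B" using s el(1)[OF z] by simp
  ultimately obtain t where t: "t \<in> T" "t \<odot>\<^bsub>Q\<^esub> (?I +>\<^bsub>F.B\<^esub> (s \<odot>\<^bsub>F.B\<^esub> F.elt z)) = \<zero>\<^bsub>Q\<^esub>"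
    using \<mu>loc cD(1)[OF sz] unfolding module_localization_def by auto
  have tR: "t \<in> carrier R" by (rule RS.T_in_R[OF t(1)])
  have "?I +>\<^bsub>F.B\<^esub> (t \<odot>\<^bsub>F.B\<^esub> (s \<odot>\<^bsub>F.B\<^esub> F.elt z)) = ?I"
    using t(2) cD(3)[OF tR sz] unfolding Q_def quot_module_zero by simp
  moreover have "t \<odot>\<^bsub>F.B\<^esub> (s \<odot>\<^bsub>F.B\<^esub> F.elt z) \<in> carrier F.B" using tR sz by simp
  ultimately have "t \<odot>\<^bsub>F.B\<^esub> (s \<odot>\<^bsub>F.B\<^esub> F.elt z) \<in> ?I"
    using coset_self[OF F.base_change_module I] by metis
  then have "frob_mem p e R M L z (t \<otimes>\<^bsub>R\<^esub> s)"
    unfolding frob_mem_def using tR s el(1)[OF z] by (simp add: B.smult_assoc1)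
  then show ?thesis using t(1) by blast
qed

end


subsection \<open>Prime ideals\<close>

context cring begin

lemma idealD:
  assumes "ideal I R"
  shows "I \<subseteq> carrier R" "\<zero> \<in> I" "\<And>a b. \<lbrakk>a \<in> I; b \<in> I\<rbrakk> \<Longrightarrow> a \<oplus> b \<in> I"
    and "\<And>x a. \<lbrakk>x \<in> carrier R; a \<in> I\<rbrakk> \<Longrightarrow> x \<otimes> a \<in> I"
    and "\<And>x a. \<lbrakk>x \<in> carrier R; a \<in> I\<rbrakk> \<Longrightarrow> a \<otimes> x \<in> I"
    and "\<And>a b. \<lbrakk>a \<in> I; b \<in> carrier R; a \<oplus> b \<in> I\<rbrakk> \<Longrightarrow> b \<in> I"
proof -
  interpret I: ideal I R by fact
  show "I \<subseteq> carrier R" "\<zero> \<in> I" "\<And>a b. \<lbrakk>a \<in> I; b \<in> I\<rbrakk> \<Longrightarrow> a \<oplus> b \<in> I"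
    "\<And>x a. \<lbrakk>x \<in> carrier R; a \<in> I\<rbrakk> \<Longrightarrow> x \<otimes> a \<in> I"
    "\<And>x a. \<lbrakk>x \<in> carrier R; a \<in> I\<rbrakk> \<Longrightarrow> a \<otimes> x \<in> I"
    using I.Icarr I.zero_closed I.a_closed I.I_l_closed I.I_r_closed by auto
  fix a b assume a: "a \<in> I" and b: "b \<in> carrier R" and ab: "a \<oplus> b \<in> I"
  have "b = \<ominus> a \<oplus> (a \<oplus> b)" using I.Icarr[OF a] b by (simp add: r_neg1)
  then show "b \<in> I" using I.a_closed[OF I.a_inv_closed[OF a] ab] by simp
qed

lemma primeD:
  assumes "primeideal P R"
  shows "ideal P R" "\<one> \<notin> P"
    and "\<And>a b. \<lbrakk>a \<in> carrier R; b \<in> carrier R\<rbrakk> \<Longrightarrow> a \<otimes> b \<in> P \<longleftrightarrow> a \<in> P \<or> b \<in> P"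
    and "\<And>a n. \<lbrakk>a \<in> carrier R; a [^] (n::nat) \<in> P\<rbrakk> \<Longrightarrow> a \<in> P"
proof -
  interpret P: primeideal P R by fact
  show 1: "ideal P R" by (rule P.is_ideal)
  show 2: "\<one> \<notin> P" using P.one_imp_carrier P.I_notcarr by auto
  show 3: "\<And>a b. \<lbrakk>a \<in> carrier R; b \<in> carrier R\<rbrakk> \<Longrightarrow> a \<otimes> b \<in> P \<longleftrightarrow> a \<in> P \<or> b \<in> P"
    using P.I_prime idealD(4,5)[OF 1] by blast
  fix a and n :: nat assume "a \<in> carrier R" "a [^] n \<in> P"
  then show "a \<in> P" using 2 3 by (induction n) auto
qed

lemma ideal_add_principal:
  assumes "ideal I R" "x \<in> carrier R"
  shows "ideal {a \<oplus> r \<otimes> x | a r. a \<in> I \<and> r \<in> carrier R} R" (is "ideal ?J R")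
    and "I \<subseteq> {a \<oplus> r \<otimes> x | a r. a \<in> I \<and> r \<in> carrier R}"
    and "x \<in> {a \<oplus> r \<otimes> x | a r. a \<in> I \<and> r \<in> carrier R}"
proof -
  note I = idealD(1-5)[OF assms(1)]
  have Ic: "a \<in> carrier R" if "a \<in> I" for a using that I(1) by auto
  have memI: "u \<in> ?J" if "u = a \<oplus> r \<otimes> x" "a \<in> I" "r \<in> carrier R" for u a r
    using that by auto
  show "ideal ?J R"
  proof (rule ideal_intro)
    show "?J \<subseteq> carrier R" using Ic assms(2) by auto
    show "\<zero> \<in> ?J" using I(2) assms(2) by (intro CollectI exI[of _ \<zero>]) auto
  next
    fix a b assume "a \<in> ?J" "b \<in> ?J"
    then obtain c r d s where *: "a = c \<oplus> r \<otimes> x" "b = d \<oplus> s \<otimes> x"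
      "c \<in> I" "d \<in> I" "r \<in> carrier R" "s \<in> carrier R" by auto
    have "a \<oplus> b = (c \<oplus> d) \<oplus> (r \<oplus> s) \<otimes> x"
      using * Ic assms(2) by (simp add: l_distr a_ac)
    then show "a \<oplus> b \<in> ?J" by (rule memI) (simp_all add: * I(3))
  next
    fix y a assume y: "y \<in> carrier R" and "a \<in> ?J"
    then obtain c r where *: "a = c \<oplus> r \<otimes> x" "c \<in> I" "r \<in> carrier R" by auto
    have "y \<otimes> a = (y \<otimes> c) \<oplus> (y \<otimes> r) \<otimes> x"
      using * Ic assms(2) y by (simp add: r_distr m_assoc)
    then show "y \<otimes> a \<in> ?J" by (rule memI) (simp_all add: * I(4) y)
  qed
  show "I \<subseteq> ?J"
  proof
    fix a assume "a \<in> I"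
    then show "a \<in> ?J" using Ic assms(2) by (intro CollectI exI[of _ a] exI[of _ \<zero>]) auto
  qed
  show "x \<in> ?J" using I(2) assms(2) by (intro CollectI exI[of _ \<zero>] exI[of _ \<one>]) auto
qed

text \<open>An ideal P maximal among those containing I and avoiding the powers of a is prime: for
  x, y outside P, both P + (x) and P + (y) contain a power of a, and the product of these powers
  lies in P + (x y).\<close>

lemma exists_prime_avoiding_powers:
  assumes I: "ideal I R" and a: "a \<in> carrier R" and pow: "\<And>n::nat. a [^] n \<notin> I"
  shows "\<exists>P. primeideal P R \<and> I \<subseteq> P \<and> a \<notin> P"
proof -
  define A where "A = {J. ideal J R \<and> I \<subseteq> J \<and> (\<forall>n::nat. a [^] n \<notin> J)}"
  have "\<exists>P\<in>A. \<forall>J\<in>A. P \<subseteq> J \<longrightarrow> J = P"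
  proof (rule subset_Zorn_nonempty)
    show "A \<noteq> {}" using I pow by (auto simp: A_def)
    fix C assume C: "C \<noteq> {}" "subset.chain A C"
    then have "subset.chain {J. ideal J R} C" by (auto simp: A_def pred_on.chain_def)
    then have "ideal (\<Union>C) R" using chain_Union_is_ideal[of C] C(1) by simp
    then show "\<Union>C \<in> A" using C by (fastforce simp: A_def pred_on.chain_def)
  qed
  then obtain P where P: "ideal P R" "I \<subseteq> P" "\<And>n::nat. a [^] n \<notin> P"
    and max: "\<And>J. \<lbrakk>ideal J R; I \<subseteq> J; \<And>n::nat. a [^] n \<notin> J; P \<subseteq> J\<rbrakk> \<Longrightarrow> J = P"
    by (auto simp: A_def)
  have pw: "\<exists>c r. \<exists>n::nat. c \<in> P \<and> r \<in> carrier R \<and> a [^] n = c \<oplus> r \<otimes> x"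
    if x: "x \<in> carrier R" "x \<notin> P" for x
  proof (rule ccontr)
    assume *: "\<not> ?thesis"
    let ?J = "{a \<oplus> r \<otimes> x | a r. a \<in> P \<and> r \<in> carrier R}"
    note J = ideal_add_principal[OF P(1) x(1)]
    have "?J = P" by (rule max[OF J(1)]) (use J(2) P(2) * in auto)
    then show False using J(3) x(2) by auto
  qed
  have "primeideal P R"
  proof (rule primeidealI[OF P(1) is_cring])
    show "carrier R \<noteq> P" using P(3)[of 0] by auto
    fix x y assume xy: "x \<in> carrier R" "y \<in> carrier R" "x \<otimes> y \<in> P"
    show "x \<in> P \<or> y \<in> P"
    proof (rule ccontr)
      assume "\<not> (x \<in> P \<or> y \<in> P)"
      then obtain c r n d s k where *: "c \<in> P" "r \<in> carrier R" "a [^] (n::nat) = c \<oplus> r \<otimes> x"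
        "d \<in> P" "s \<in> carrier R" "a [^] (k::nat) = d \<oplus> s \<otimes> y"
        using pw[OF xy(1)] pw[OF xy(2)] by metis
      have cd: "c \<in> carrier R" "d \<in> carrier R" using * idealD(1)[OF P(1)] by auto
      have "a [^] (n + k) = (c \<oplus> r \<otimes> x) \<otimes> (d \<oplus> s \<otimes> y)"
        using a * by (simp add: nat_pow_mult[symmetric])
      also have "\<dots> = (d \<oplus> s \<otimes> y) \<otimes> c \<oplus> ((r \<otimes> x) \<otimes> d \<oplus> (r \<otimes> s) \<otimes> (x \<otimes> y))"
        using cd * xy by (simp add: l_distr r_distr m_ac a_ac)
      also have "\<dots> \<in> P"
        by (intro idealD(3)[OF P(1)] idealD(4)[OF P(1) _ *(1)] idealD(4)[OF P(1) _ *(4)]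
            idealD(4)[OF P(1) _ xy(3)]) (use cd * xy in auto)
      finally show False using P(3) by simp
    qed
  qed
  then show ?thesis using P(2) P(3)[of 1] a by (intro exI[of _ P]) simp
qed

text \<open>Otherwise some prime contains I but not g. It contains every f in G, hence g^m, hence g.
  Arguing by primes avoids counting exponents in an expansion of a power of g^m.\<close>

lemma radical_generators:
  assumes I: "ideal I R" and G: "G \<subseteq> carrier R" and pow: "\<And>f. f \<in> G \<Longrightarrow> \<exists>k::nat. f [^] k \<in> I"
    and g: "g \<in> carrier R" "g [^] (m::nat) \<in> Idl G"
  shows "\<exists>n::nat. g [^] n \<in> I"
proof (rule ccontr)
  assume "\<not> ?thesis"
  then obtain P where P: "primeideal P R" "I \<subseteq> P" "g \<notin> P"
    using exists_prime_avoiding_powers[OF I g(1)] by auto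
  note Pd = primeD[OF P(1)]
  have "G \<subseteq> P"
  proof
    fix f assume f: "f \<in> G"
    then obtain k :: nat where "f [^] k \<in> I" using pow by blast
    then show "f \<in> P" using Pd(4) f G P(2) by blast
  qed
  then have "g [^] m \<in> P" using genideal_minimal[OF Pd(1)] g(2) by auto
  then show False using Pd(4) g(1) P(3) by blast
qed

text \<open>The case g = 1 of \<open>radical_generators\<close>, in the form needed for open
  covers.\<close>

lemma one_in_ideal_if_powers:
  assumes "ideal I R" "G \<subseteq> carrier R" "\<And>f. f \<in> G \<Longrightarrow> \<exists>k::nat. f [^] k \<in> I" "\<one> \<in> Idl G"
  shows "\<one> \<in> I"
  using radical_generators[OF assms(1-3), of \<one> 0] assms(4) by auto

text \<open>The elements that lie in the ideal of some finite subset of G form an ideal containing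
  G. This plays the part of quasi-compactness: it makes maxima of exponents and products of
  multipliers possible.\<close>

lemma finite_generators:
  assumes G: "G \<subseteq> carrier R" and x: "x \<in> Idl G"
  shows "\<exists>F \<subseteq> G. finite F \<and> x \<in> Idl F"
proof -
  let ?J = "{x. \<exists>F \<subseteq> G. finite F \<and> x \<in> Idl F}"
  have idl: "ideal (Idl F) R" if "F \<subseteq> G" for F using that G genideal_ideal by auto
  have mono: "Idl F \<subseteq> Idl F'" if "F \<subseteq> F'" "F' \<subseteq> G" for F F'
    using that G by (intro subset_Idl_subset) auto
  have "ideal ?J R"
  proof (rule ideal_intro)
    show "?J \<subseteq> carrier R" using idealD(1)[OF idl] by blast
    show "\<zero> \<in> ?J" using idealD(2)[OF idl, of "{}"] by blast
    fix a b assume "a \<in> ?J" "b \<in> ?J"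
    then obtain F F' where *: "F \<subseteq> G" "finite F" "a \<in> Idl F" "F' \<subseteq> G" "finite F'" "b \<in> Idl F'" by auto
    have "a \<oplus> b \<in> Idl (F \<union> F')"
      using * mono[of F "F \<union> F'"] mono[of F' "F \<union> F'"] by (intro idealD(3)[OF idl]) auto
    then show "a \<oplus> b \<in> ?J" using * by (intro CollectI exI[of _ "F \<union> F'"]) auto
  next
    fix y a assume "y \<in> carrier R" "a \<in> ?J"
    then show "y \<otimes> a \<in> ?J" using idealD(4)[OF idl] by blast
  qed
  moreover have "G \<subseteq> ?J"
  proof
    fix f assume f: "f \<in> G"
    then have "f \<in> Idl {f}" using G genideal_self'[of f] by auto
    then show "f \<in> ?J" using f by (intro CollectI exI[of _ "{f}"]) auto
  qed
  ultimately have "Idl G \<subseteq> ?J" by (rule genideal_minimal)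
  then show ?thesis using x by auto
qed

end

section \<open>Elements outside all minimal primes\<close>

lemma off_minimal_primes_mult:
  fixes R :: "'r ring" (structure)
  assumes "cring R" "c \<in> off_minimal_primes R" "d \<in> off_minimal_primes R"
  shows "c \<otimes> d \<in> off_minimal_primes R"
proof -
  interpret cring R by fact
  show ?thesis using assms primeD(3) by (auto simp: off_minimal_primes_def minimal_primes_def)
qed

lemma off_minimal_primes_one:
  assumes "cring R"
  shows "\<one>\<^bsub>R\<^esub> \<in> off_minimal_primes R"
  using cring.primeD(2)[OF assms] monoid.one_closed[of R] assms[unfolded cring_def ring_def] by (auto simp: off_minimal_primes_def minimal_primes_def)

text \<open>The product of all \<open>c f\<close> works. Recording divisibility alone makes each
  induction step a multiplication by one further factor.\<close>

lemma off_minimal_primes_finprod: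
  fixes R :: "'r ring" (structure)
  assumes "cring R" "finite F" "\<And>f. f \<in> F \<Longrightarrow> c f \<in> off_minimal_primes R"
  shows "\<exists>d \<in> off_minimal_primes R. \<forall>f\<in>F. \<exists>r \<in> carrier R. d = r \<otimes> c f"
  using assms(2,3)
proof (induction F rule: finite_induct)
  case empty
  then show ?case using off_minimal_primes_one[OF assms(1)] by auto
next
  interpret cring R by fact
  case (insert f F)
  then obtain d where d: "d \<in> off_minimal_primes R" "\<And>g. g \<in> F \<Longrightarrow> \<exists>r \<in> carrier R. d = r \<otimes> c g"
    by auto
  have dc: "d \<in> carrier R" using d(1) by (simp add: off_minimal_primes_def)
  have cc: "c g \<in> carrier R" if "g \<in> insert f F" for g
    using insert.prems[OF that] by (simp add: off_minimal_primes_def)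
  have "\<exists>r\<in>carrier R. c f \<otimes> d = r \<otimes> c g" if g: "g \<in> insert f F" for g
  proof (cases "g = f")
    case True
    then show ?thesis using dc cc[of f] m_comm by auto
  next
    case False
    then obtain r where "r \<in> carrier R" "d = r \<otimes> c g" using d(2) g by auto
    then show ?thesis using cc[of f] cc[of g] g by (intro bexI[of _ "c f \<otimes> r"]) (auto simp: m_assoc)
  qed
  moreover have "c f \<otimes> d \<in> off_minimal_primes R"
    using off_minimal_primes_mult[OF assms(1)] insert.prems d(1) by auto
  ultimately show ?case by blast
qed

section \<open>Minimal primes of a Noetherian ring\<close>

text \<open>Noetherian induction. A maximal counterexample M is proper and not prime, so it contains
  some x y with neither x nor y in M. A prime over M contains M + (x) or M + (y), so the finite sets
  for these two ideals together serve for M.\<close>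

lemma noetherian_finite_primes:
  fixes R :: "'r ring" (structure)
  assumes "cring R" "noetherian_ring R" "ideal J R"
  shows "\<exists>F. finite F \<and> (\<forall>P\<in>F. primeideal P R \<and> J \<subseteq> P)
    \<and> (\<forall>Q. primeideal Q R \<and> J \<subseteq> Q \<longrightarrow> (\<exists>P\<in>F. P \<subseteq> Q))"
proof (rule ccontr)
  interpret cring R by fact
  interpret noetherian_ring R by fact
  define good where "good J \<longleftrightarrow> (\<exists>F. finite F \<and> (\<forall>P\<in>F. primeideal P R \<and> J \<subseteq> P)
    \<and> (\<forall>Q. primeideal Q R \<and> J \<subseteq> Q \<longrightarrow> (\<exists>P\<in>F. P \<subseteq> Q)))" for J
  define A where "A = {J. ideal J R \<and> \<not> good J}"
  assume "\<not> ?thesis"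
  then have "J \<in> A" using assms(3) by (auto simp: A_def good_def)
  have "\<exists>M\<in>A. \<forall>K\<in>A. M \<subseteq> K \<longrightarrow> K = M"
  proof (rule subset_Zorn_nonempty)
    show "A \<noteq> {}" using \<open>J \<in> A\<close> by auto
    fix C assume C: "C \<noteq> {}" "subset.chain A C"
    then have "subset.chain {J. ideal J R} C" by (auto simp: A_def pred_on.chain_def)
    \<comment> \<open>In a Noetherian ring the union of a nonempty chain of ideals is a member of
      the chain, so chains of counterexamples have upper bounds.\<close>
    then show "\<Union>C \<in> A" using ideal_chain_is_trivial[OF C(1)] C(2) by (auto simp: pred_on.chain_def)
  qed
  then obtain M where M: "ideal M R" "\<not> good M"
    and max: "\<And>K. \<lbrakk>ideal K R; M \<subseteq> K; K \<noteq> M\<rbrakk> \<Longrightarrow> good K"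
    by (auto simp: A_def)
  have "\<not> primeideal M R" using M(2) unfolding good_def by (metis finite.simps insertI1 singletonD order_refl)
  moreover have "carrier R \<noteq> M"
  proof
    assume "carrier R = M"
    \<comment> \<open>No prime contains 1, so the empty set of primes serves for the unit
      ideal.\<close>
    then have "good M" unfolding good_def using primeD(2) by (intro exI[of _ "{}"]) auto
    then show False using M(2) by simp
  qed
  ultimately obtain x y where xy: "x \<in> carrier R" "y \<in> carrier R" "x \<otimes> y \<in> M" "x \<notin> M" "y \<notin> M"
    using primeidealI[OF M(1) is_cring] by blast
  have ext: "\<exists>K. good K \<and> M \<subseteq> K \<and> (\<forall>Q. ideal Q R \<longrightarrow> M \<subseteq> Q \<longrightarrow> z \<in> Q \<longrightarrow> K \<subseteq> Q)"
    if z: "z \<in> carrier R" "z \<notin> M" for z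
  proof -
    let ?K = "{a \<oplus> r \<otimes> z | a r. a \<in> M \<and> r \<in> carrier R}"
    note K = ideal_add_principal[OF M(1) z(1)]
    have "good ?K" by (rule max[OF K(1,2)]) (use K(3) z(2) in blast)
    moreover have "?K \<subseteq> Q" if "ideal Q R" "M \<subseteq> Q" "z \<in> Q" for Q
      using idealD(3,4)[OF that(1)] that(2,3) by blast
    ultimately show ?thesis using K(2) by blast
  qed
  from ext[OF xy(1,4)] obtain K where K: "good K" "M \<subseteq> K"
    "\<And>Q. \<lbrakk>ideal Q R; M \<subseteq> Q; x \<in> Q\<rbrakk> \<Longrightarrow> K \<subseteq> Q" by auto
  from ext[OF xy(2,5)] obtain K' where K': "good K'" "M \<subseteq> K'"
    "\<And>Q. \<lbrakk>ideal Q R; M \<subseteq> Q; y \<in> Q\<rbrakk> \<Longrightarrow> K' \<subseteq> Q" by auto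
  from K(1)[unfolded good_def] obtain F where F: "finite F" "\<And>P. P \<in> F \<Longrightarrow> primeideal P R \<and> K \<subseteq> P"
    "\<And>Q. \<lbrakk>primeideal Q R; K \<subseteq> Q\<rbrakk> \<Longrightarrow> \<exists>P\<in>F. P \<subseteq> Q"
    by (elim exE conjE) simp
  from K'(1)[unfolded good_def] obtain F' where F': "finite F'" "\<And>P. P \<in> F' \<Longrightarrow> primeideal P R \<and> K' \<subseteq> P"
    "\<And>Q. \<lbrakk>primeideal Q R; K' \<subseteq> Q\<rbrakk> \<Longrightarrow> \<exists>P\<in>F'. P \<subseteq> Q"
    by (elim exE conjE) simp
  have "\<exists>P\<in>F \<union> F'. P \<subseteq> Q" if Q: "primeideal Q R" "M \<subseteq> Q" for Q
  proof -
    have "x \<in> Q \<or> y \<in> Q" using primeD(3)[OF Q(1) xy(1,2)] xy(3) Q(2) by blast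
    then have "K \<subseteq> Q \<or> K' \<subseteq> Q"
      using K(3)[OF primeD(1)[OF Q(1)] Q(2)] K'(3)[OF primeD(1)[OF Q(1)] Q(2)] by auto
    then show ?thesis using F(3)[OF Q(1)] F'(3)[OF Q(1)] by auto
  qed
  then have "good M" unfolding good_def
  proof (intro exI[of _ "F \<union> F'"] conjI ballI allI impI)
    show "M \<subseteq> P" "primeideal P R" if "P \<in> F \<union> F'" for P
      using that F(2)[of P] F'(2)[of P] K(2) K'(2) by auto
  qed (use F(1) F'(1) in auto)
  then show False using M(2) by simp
qed

text \<open>The preceding lemma for the zero ideal gives a finite set F. A minimal prime contains a
  member of F and so equals it; a member of F inside Q that is minimal among such members is a
  minimal prime.\<close>

lemma noetherian_minimal_primes:
  assumes "cring R" "noetherian_ring R"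
  shows "finite (minimal_primes R)"
    and "primeideal Q R \<Longrightarrow> \<exists>P \<in> minimal_primes R. P \<subseteq> Q"
proof -
  interpret cring R by fact
  obtain F where F: "finite F" "\<And>P. P \<in> F \<Longrightarrow> primeideal P R"
    "\<And>Q. primeideal Q R \<Longrightarrow> \<exists>P\<in>F. P \<subseteq> Q"
    using noetherian_finite_primes[OF assms zeroideal] idealD(2)[OF primeD(1)] by (metis empty_subsetI insert_subset)
  have "minimal_primes R \<subseteq> F"
  proof
    fix P assume "P \<in> minimal_primes R"
    then have P: "primeideal P R" "\<And>Q. \<lbrakk>primeideal Q R; Q \<subseteq> P\<rbrakk> \<Longrightarrow> Q = P"
      by (auto simp: minimal_primes_def)
    then show "P \<in> F" using F(2,3) by metis
  qed
  then show "finite (minimal_primes R)" using F(1) finite_subset by blast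
  assume Q: "primeideal Q R"
  let ?S = "{P \<in> F. P \<subseteq> Q}"
  obtain P where P: "P \<in> ?S" "\<And>P'. \<lbrakk>P' \<in> ?S; P' \<subseteq> P\<rbrakk> \<Longrightarrow> P' = P"
    using finite_has_minimal[of ?S] F(1) F(3)[OF Q] by (auto, metis)
  have "P \<in> minimal_primes R"
    unfolding minimal_primes_def
  proof (intro CollectI conjI allI impI)
    show "primeideal P R" using P(1) F(2) by auto
    fix Q' assume Q': "primeideal Q' R \<and> Q' \<subseteq> P"
    then obtain P' where "P' \<in> F" "P' \<subseteq> Q'" using F(3) by blast
    moreover have "P' = P" by (rule P(2)) (use calculation P(1) Q' in auto)
    ultimately show "Q' = P" using Q' by auto
  qed
  then show "\<exists>P \<in> minimal_primes R. P \<subseteq> Q" using P(1) by auto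
qed

text \<open>From each Q take an element outside P. The product lies in every Q, and outside P
  because P is prime.\<close>

lemma (in cring) exists_outside_prime:
  assumes "finite Z" "primeideal P R" "\<And>Q. Q \<in> Z \<Longrightarrow> ideal Q R \<and> \<not> Q \<subseteq> P"
  shows "\<exists>x \<in> carrier R. x \<notin> P \<and> (\<forall>Q\<in>Z. x \<in> Q)"
  using assms(1,3)
proof (induction Z rule: finite_induct)
  case empty
  then show ?case using primeD(2)[OF assms(2)] by auto
next
  case (insert Q Z)
  then obtain x where x: "x \<in> carrier R" "x \<notin> P" "\<forall>Q\<in>Z. x \<in> Q" by auto
  obtain y where y: "y \<in> Q" "y \<notin> P" using insert.prems by auto
  have yc: "y \<in> carrier R" using y(1) insert.prems idealD(1) by blast
  have "x \<otimes> y \<notin> P" using primeD(3)[OF assms(2)] x y yc by blast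
  moreover have "x \<otimes> y \<in> K" if K: "K \<in> insert Q Z" for K
  proof (cases "K = Q")
    case True
    then show ?thesis using idealD(4)[of Q x y] insert.prems[of Q] x(1) y(1) by simp
  next
    case False
    then show ?thesis using idealD(5)[of K y x] insert.prems[of K] x(3) K yc by simp
  qed
  ultimately show ?case using x(1) yc by (intro bexI[of _ "x \<otimes> y"]) auto
qed

text \<open>Distinct minimal primes do not contain each other. If the element d found so far lies in
  the new prime P, adding some x that lies in all the other primes but not in P moves d out of P and
  changes nothing elsewhere.\<close>

lemma exists_separating_minimal_primes:
  fixes R :: "'r ring" (structure)
  assumes "cring R" "finite D" "finite E" "D \<subseteq> minimal_primes R" "E \<subseteq> minimal_primes R" "D \<inter> E = {}"
  shows "\<exists>d \<in> carrier R. (\<forall>P\<in>E. d \<in> P) \<and> (\<forall>P\<in>D. d \<notin> P)"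
proof -
  interpret cring R by fact
  show ?thesis
    using assms(2,4,6)
  proof (induction D rule: finite_induct)
    case empty
    then show ?case using idealD(2) primeD(1) assms(5) by (intro bexI[of _ \<zero>]) (auto simp: minimal_primes_def)
  next
    case (insert P D)
    then obtain d where d: "d \<in> carrier R" "\<And>P. P \<in> E \<Longrightarrow> d \<in> P" "\<And>P. P \<in> D \<Longrightarrow> d \<notin> P" by auto
    have mp: "primeideal Q R" if "Q \<in> insert P (D \<union> E)" for Q
      using that insert.prems assms(5) by (auto simp: minimal_primes_def)
    show ?case
    proof (cases "d \<in> P")
      case False
      then show ?thesis using d by auto
    next
      case True
      have "\<not> Q \<subseteq> P" if "Q \<in> D \<union> E" for Q
      proof
        assume "Q \<subseteq> P"
        then have "Q = P" using mp[of Q] that insert.prems(1) by (auto simp: minimal_primes_def)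
        then show False using that insert.hyps insert.prems by auto
      qed
      then obtain x where x: "x \<in> carrier R" "x \<notin> P" "\<And>Q. Q \<in> D \<union> E \<Longrightarrow> x \<in> Q"
        using exists_outside_prime[of "D \<union> E" P] mp primeD(1) insert.hyps assms(3) by (metis UnCI finite_UnI insertCI)
      have "d \<oplus> x \<in> Q" if "Q \<in> E" for Q
        using idealD(3)[OF primeD(1)[OF mp]] that d x by auto
      moreover have "d \<oplus> x \<notin> Q" if "Q \<in> insert P D" for Q
      proof (cases "Q = P")
        case True
        then show ?thesis using idealD(6)[OF primeD(1)[OF mp], of P d x] \<open>d \<in> P\<close> x by auto
      next
        case False
        then have Q: "Q \<in> D" using that by simp
        then show ?thesis
          using idealD(6)[OF primeD(1)[OF mp], of Q x d] d x a_comm[of d x] by auto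
      qed
      ultimately show ?thesis using d(1) x(1) by blast
    qed
  qed
qed

text \<open>Add to \<open>c\<close> an element that is killed by a power of \<open>f\<close> and lies in exactly those minimal
  primes that do not contain \<open>c\<close>.\<close>

lemma noetherian_lift_off_minimal_primes:
  fixes R :: "'r ring" (structure)
  assumes "cring R" "noetherian_ring R" and f: "f \<in> carrier R" and c: "c \<in> carrier R"
    and off: "\<And>P. \<lbrakk>P \<in> minimal_primes R; f \<notin> P\<rbrakk> \<Longrightarrow> c \<notin> P"
  shows "\<exists>c' \<in> off_minimal_primes R. \<exists>m::nat. f [^]\<^bsub>R\<^esub> m \<otimes>\<^bsub>R\<^esub> c' = f [^]\<^bsub>R\<^esub> m \<otimes>\<^bsub>R\<^esub> c"
proof -
  interpret cring R by fact
  let ?MP = "minimal_primes R"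
  have mp: "primeideal Q R" if "Q \<in> ?MP" for Q using that by (auto simp: minimal_primes_def)
  have fin: "finite ?MP" by (rule noetherian_minimal_primes(1)[OF assms(1,2)])
  obtain d where d: "d \<in> carrier R" "\<And>P. \<lbrakk>P \<in> ?MP; c \<notin> P\<rbrakk> \<Longrightarrow> d \<in> P" "\<And>P. \<lbrakk>P \<in> ?MP; c \<in> P\<rbrakk> \<Longrightarrow> d \<notin> P"
  proof -
    have "{P \<in> ?MP. c \<in> P} \<inter> {P \<in> ?MP. c \<notin> P} = {}" by blast
    with exists_separating_minimal_primes[OF assms(1), of "{P \<in> ?MP. c \<in> P}" "{P \<in> ?MP. c \<notin> P}"] fin
    have "\<exists>d \<in> carrier R. (\<forall>P\<in>{P \<in> ?MP. c \<notin> P}. d \<in> P) \<and> (\<forall>P\<in>{P \<in> ?MP. c \<in> P}. d \<notin> P)" by auto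
    then show thesis using that by auto
  qed
  \<comment> \<open>f d is nilpotent because it lies in every minimal prime P: if c is in P, then f
    is in P by \<open>off\<close>; otherwise d is in P.\<close>
  have "\<exists>n::nat. (f \<otimes> d) [^] n \<in> {\<zero>}"
  proof (rule ccontr)
    assume "\<not> ?thesis"
    then obtain Q where Q: "primeideal Q R" "f \<otimes> d \<notin> Q"
      using exists_prime_avoiding_powers[OF zeroideal, of "f \<otimes> d"] f d by auto
    obtain P where P: "P \<in> ?MP" "P \<subseteq> Q" using noetherian_minimal_primes(2)[OF assms(1,2) Q(1)] by auto
    have "f \<otimes> d \<in> P"
      using primeD(3)[OF mp[OF P(1)] f d(1)] d(2)[OF P(1)] off[OF P(1)] by blast
    then show False using P(2) Q(2) by auto
  qed
  then obtain n :: nat where "(f \<otimes> d) [^] n = \<zero>" by auto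
  \<comment> \<open>The exponent has to be positive for a power of d to lie in the same primes as
    d.\<close>
  then have "(f \<otimes> d) [^] (Suc n) = \<zero>" using f d by simp
  then have fd: "f [^] (Suc n) \<otimes> d [^] (Suc n) = \<zero>" using f d(1) by (metis nat_pow_distrib)
  define e where "e = d [^] (Suc n)"
  have e: "e \<in> carrier R" "f [^] (Suc n) \<otimes> e = \<zero>" using fd d(1) by (auto simp: e_def)
  have eP: "e \<in> P \<longleftrightarrow> c \<notin> P" if P: "P \<in> ?MP" for P
  proof -
    have "e \<in> P \<longleftrightarrow> d \<in> P"
    proof
      show "e \<in> P \<Longrightarrow> d \<in> P" unfolding e_def using primeD(4)[OF mp[OF P]] d(1) by blast
      show "d \<in> P \<Longrightarrow> e \<in> P" unfolding e_def using idealD(4)[OF primeD(1)[OF mp[OF P]], of "d [^] n" d] d(1) by simp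
    qed
    then show ?thesis using d(2,3)[OF P] by blast
  qed
  have "c \<oplus> e \<in> off_minimal_primes R"
    unfolding off_minimal_primes_def
  proof (intro DiffI notI)
    show "c \<oplus> e \<in> carrier R" using c e by simp
    assume "c \<oplus> e \<in> \<Union>?MP"
    then obtain P where P: "P \<in> ?MP" "c \<oplus> e \<in> P" by auto
    note I = idealD(6)[OF primeD(1)[OF mp[OF P(1)]]]
    have "c \<in> P \<Longrightarrow> e \<in> P" using I[of c e] P(2) e by simp
    moreover have "e \<in> P \<Longrightarrow> c \<in> P" using I[of e c] P(2) c e by (simp add: a_comm)
    ultimately show False using eP[OF P(1)] by blast
  qed
  moreover have "f [^] (Suc n) \<otimes> (c \<oplus> e) = f [^] (Suc n) \<otimes> c"
    using f c e by (simp add: r_distr del: nat_pow_Suc)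
  ultimately show ?thesis by blast
qed


subsection \<open>Localization of ideals\<close>

lemma powers_submonoid:
  assumes "cring R" "f \<in> carrier R"
  shows "submonoid (powers R f) R"
proof -
  interpret cring R by fact
  show ?thesis
  proof (rule submonoid.intro)
    show "powers R f \<subseteq> carrier R" using assms(2) by (auto simp: powers_def)
    show "\<one>\<^bsub>R\<^esub> \<in> powers R f"
      unfolding powers_def by (intro CollectI exI[of _ 0]) simp
    fix x y assume "x \<in> powers R f" "y \<in> powers R f"
    then obtain m n :: nat where "x = f [^]\<^bsub>R\<^esub> m" "y = f [^]\<^bsub>R\<^esub> n" by (auto simp: powers_def)
    then show "x \<otimes>\<^bsub>R\<^esub> y \<in> powers R f"
      using assms(2) unfolding powers_def by (intro CollectI exI[of _ "m + n"]) (simp add: nat_pow_mult)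
  qed
qed

lemma primeideal_vimage:
  assumes "cring R" "cring S" "h \<in> ring_hom R S" "primeideal P S"
  shows "primeideal {r \<in> carrier R. h r \<in> P} R"
proof -
  interpret R: cring R by fact
  interpret S: cring S by fact
  note P = S.primeD[OF assms(4)] and I = S.idealD[OF S.primeD(1)[OF assms(4)]]
  have zero: "h \<zero>\<^bsub>R\<^esub> = \<zero>\<^bsub>S\<^esub>"
    using ring_hom_zero[OF assms(3)] R.ring_axioms S.ring_axioms by simp
  show ?thesis
  proof (rule primeidealI)
    show "ideal {r \<in> carrier R. h r \<in> P} R"
      by (rule R.ideal_intro)
        (use I(2-4) zero ring_hom_closed[OF assms(3)] in \<open>auto simp: ring_hom_add[OF assms(3)] ring_hom_mult[OF assms(3)]\<close>)
    show "carrier R \<noteq> {r \<in> carrier R. h r \<in> P}"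
    proof
      assume "carrier R = {r \<in> carrier R. h r \<in> P}"
      then have "h \<one>\<^bsub>R\<^esub> \<in> P" using R.one_closed by blast
      then show False using P(2) ring_hom_one[OF assms(3)] by simp
    qed
    show "a \<in> {r \<in> carrier R. h r \<in> P} \<or> b \<in> {r \<in> carrier R. h r \<in> P}"
      if "a \<in> carrier R" "b \<in> carrier R" "a \<otimes>\<^bsub>R\<^esub> b \<in> {r \<in> carrier R. h r \<in> P}" for a b
      using that P(3) ring_hom_closed[OF assms(3)] by (auto simp: ring_hom_mult[OF assms(3)])
  qed (rule assms)
qed

lemma ideal_vimage:
  assumes "cring R" "cring S" "h \<in> ring_hom R S" "ideal I S"
  shows "ideal {r \<in> carrier R. h r \<in> I} R"
proof -
  interpret R: cring R by fact
  interpret S: cring S by fact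
  note I = S.idealD[OF assms(4)]
  have zero: "h \<zero>\<^bsub>R\<^esub> = \<zero>\<^bsub>S\<^esub>"
    using ring_hom_zero[OF assms(3)] R.ring_axioms S.ring_axioms by simp
  show ?thesis
    by (rule R.ideal_intro)
      (use I(2-4) zero ring_hom_closed[OF assms(3)] in \<open>auto simp: ring_hom_add[OF assms(3)] ring_hom_mult[OF assms(3)]\<close>)
qed

context ring_loc begin

text \<open>This is the preimage in S of the extension of J to T^-1 R. It is J S itself when the
  elements of h T are units.\<close>

definition ext_ideal :: "'r set \<Rightarrow> 's set"
  where "ext_ideal J = {s \<in> carrier S. \<exists>t\<in>T. \<exists>r\<in>J. h t \<otimes>\<^bsub>S\<^esub> s = h r}"

lemma T_closed: "\<lbrakk>t \<in> T; u \<in> T\<rbrakk> \<Longrightarrow> t \<otimes>\<^bsub>R\<^esub> u \<in> T" "\<one>\<^bsub>R\<^esub> \<in> T"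
  using submonoid.m_closed[OF T] submonoid.one_closed[OF T] by auto

lemma ext_ideal_ideal:
  assumes J: "ideal J R"
  shows "ideal (ext_ideal J) S"
proof (rule h.S.ideal_intro)
  note I = h.R.idealD(1-5)[OF J]
  have Jc: "r \<in> carrier R" if "r \<in> J" for r using that I(1) by auto
  have memI: "s \<in> ext_ideal J" if "s \<in> carrier S" "t \<in> T" "r \<in> J" "h t \<otimes>\<^bsub>S\<^esub> s = h r" for s t r
    using that by (auto simp: ext_ideal_def)
  show "ext_ideal J \<subseteq> carrier S" by (auto simp: ext_ideal_def)
  show "\<zero>\<^bsub>S\<^esub> \<in> ext_ideal J" by (rule memI[OF _ T_closed(2) I(2)]) auto
  fix a assume "a \<in> ext_ideal J"
  then obtain t r where a: "a \<in> carrier S" "t \<in> T" "r \<in> J" "h t \<otimes>\<^bsub>S\<^esub> a = h r"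
    by (auto simp: ext_ideal_def)
  note tr = T_in_R[OF a(2)] Jc[OF a(3)]
  {
    fix b assume "b \<in> ext_ideal J"
    then obtain u q where b: "b \<in> carrier S" "u \<in> T" "q \<in> J" "h u \<otimes>\<^bsub>S\<^esub> b = h q"
      by (auto simp: ext_ideal_def)
    note uq = T_in_R[OF b(2)] Jc[OF b(3)]
    have "h (t \<otimes>\<^bsub>R\<^esub> u) \<otimes>\<^bsub>S\<^esub> (a \<oplus>\<^bsub>S\<^esub> b) = h u \<otimes>\<^bsub>S\<^esub> (h t \<otimes>\<^bsub>S\<^esub> a) \<oplus>\<^bsub>S\<^esub> h t \<otimes>\<^bsub>S\<^esub> (h u \<otimes>\<^bsub>S\<^esub> b)"
      using a(1) b(1) tr uq by (simp add: h.S.r_distr h.S.m_ac)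
    also have "\<dots> = h (u \<otimes>\<^bsub>R\<^esub> r \<oplus>\<^bsub>R\<^esub> t \<otimes>\<^bsub>R\<^esub> q)" unfolding a(4) b(4) using tr uq by simp
    finally show "a \<oplus>\<^bsub>S\<^esub> b \<in> ext_ideal J"
      by (rule memI[rotated 3]) (use a(1) b(1) T_closed(1)[OF a(2) b(2)]
          I(3)[OF I(4)[OF uq(1) a(3)] I(4)[OF tr(1) b(3)]] in auto)
  }
  fix x assume x: "x \<in> carrier S"
  obtain v y where vy: "v \<in> T" "y \<in> carrier R" "h v \<otimes>\<^bsub>S\<^esub> x = h y" using surj[OF x] by auto
  have "h (v \<otimes>\<^bsub>R\<^esub> t) \<otimes>\<^bsub>S\<^esub> (x \<otimes>\<^bsub>S\<^esub> a) = (h v \<otimes>\<^bsub>S\<^esub> x) \<otimes>\<^bsub>S\<^esub> (h t \<otimes>\<^bsub>S\<^esub> a)"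
    using a(1) x tr T_in_R[OF vy(1)] by (simp add: h.S.m_ac)
  also have "\<dots> = h (y \<otimes>\<^bsub>R\<^esub> r)" unfolding a(4) vy(3) using tr vy(2) by simp
  finally show "x \<otimes>\<^bsub>S\<^esub> a \<in> ext_ideal J"
    by (rule memI[rotated 3]) (use a(1) x T_closed(1)[OF vy(1) a(2)] I(4)[OF vy(2) a(3)] in auto)
qed

lemma ext_ideal_contract:
  assumes "ideal J R" "r \<in> carrier R" "h r \<in> ext_ideal J"
  shows "\<exists>t\<in>T. t \<otimes>\<^bsub>R\<^esub> r \<in> J"
proof -
  obtain t q where q: "t \<in> T" "q \<in> J" "h t \<otimes>\<^bsub>S\<^esub> h r = h q" using assms(3) by (auto simp: ext_ideal_def)
  note tR = T_in_R[OF q(1)]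
  have qc: "q \<in> carrier R" using q(2) h.R.idealD(1)[OF assms(1)] by auto
  have "h (t \<otimes>\<^bsub>R\<^esub> r) = h q" using q(3) tR assms(2) by simp
  then obtain u where u: "u \<in> T" "u \<otimes>\<^bsub>R\<^esub> (t \<otimes>\<^bsub>R\<^esub> r) = u \<otimes>\<^bsub>R\<^esub> q"
    using hom_eqD[of "t \<otimes>\<^bsub>R\<^esub> r" q] tR qc assms(2) by auto
  have "(u \<otimes>\<^bsub>R\<^esub> t) \<otimes>\<^bsub>R\<^esub> r = u \<otimes>\<^bsub>R\<^esub> q" using u(2) tR T_in_R[OF u(1)] assms(2) by (simp add: h.R.m_assoc)
  also have "\<dots> \<in> J" using h.R.idealD(4)[OF assms(1) T_in_R[OF u(1)] q(2)] .
  finally show ?thesis using T_closed(1)[OF u(1) q(1)] by auto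
qed

lemma ext_ideal_hom:
  assumes "ideal J R" "r \<in> J"
  shows "h r \<in> ext_ideal J"
proof -
  have "r \<in> carrier R" using assms h.R.idealD(1) by auto
  then show ?thesis using T_closed(2) assms(2) unfolding ext_ideal_def
    by (intro CollectI conjI bexI[of _ "\<one>\<^bsub>R\<^esub>"] bexI[of _ r]) auto
qed

text \<open>Together with \<open>primeideal_vimage\<close> this supplies the correspondence of
  primes for T^-1 R, as far as it is used for minimal primes.\<close>

lemma ext_prime:
  assumes Q: "primeideal Q R" and disj: "Q \<inter> T = {}"
  shows "primeideal (ext_ideal Q) S" and "\<And>r. r \<in> carrier R \<Longrightarrow> h r \<in> ext_ideal Q \<longleftrightarrow> r \<in> Q"
proof -
  note Qd = h.R.primeD[OF Q]
  note ex = ext_ideal_ideal[OF Qd(1)]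
  show contr: "h r \<in> ext_ideal Q \<longleftrightarrow> r \<in> Q" if r: "r \<in> carrier R" for r
  proof
    assume "h r \<in> ext_ideal Q"
    then obtain t where "t \<in> T" "t \<otimes>\<^bsub>R\<^esub> r \<in> Q" using ext_ideal_contract[OF Qd(1) r] by auto
    then show "r \<in> Q" using Qd(3)[OF T_in_R r] disj by auto
  qed (rule ext_ideal_hom[OF Qd(1)])
  show "primeideal (ext_ideal Q) S"
  proof (rule primeidealI[OF ex S])
    show "carrier S \<noteq> ext_ideal Q" using contr[of "\<one>\<^bsub>R\<^esub>"] Qd(2) by auto
    fix a b assume ab: "a \<in> carrier S" "b \<in> carrier S" "a \<otimes>\<^bsub>S\<^esub> b \<in> ext_ideal Q"
    obtain t r where a: "t \<in> T" "r \<in> carrier R" "h t \<otimes>\<^bsub>S\<^esub> a = h r" using surj[OF ab(1)] by auto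
    obtain u q where b: "u \<in> T" "q \<in> carrier R" "h u \<otimes>\<^bsub>S\<^esub> b = h q" using surj[OF ab(2)] by auto
    have "h (r \<otimes>\<^bsub>R\<^esub> q) = (h t \<otimes>\<^bsub>S\<^esub> a) \<otimes>\<^bsub>S\<^esub> (h u \<otimes>\<^bsub>S\<^esub> b)" unfolding a(3) b(3) using a b by simp
    also have "\<dots> = (h t \<otimes>\<^bsub>S\<^esub> h u) \<otimes>\<^bsub>S\<^esub> (a \<otimes>\<^bsub>S\<^esub> b)"
      using ab(1,2) a(1,2) b(1,2) T_in_R by (simp add: h.S.m_ac)
    also have "\<dots> \<in> ext_ideal Q"
      by (rule h.S.idealD(4)[OF ex _ ab(3)]) (use a b T_in_R in simp)
    finally have "r \<otimes>\<^bsub>R\<^esub> q \<in> Q" using contr[of "r \<otimes>\<^bsub>R\<^esub> q"] a(2) b(2) by simp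
    then have "r \<in> Q \<or> q \<in> Q" using Qd(3)[OF a(2) b(2)] by simp
    then show "a \<in> ext_ideal Q \<or> b \<in> ext_ideal Q"
      using ab(1,2) a(1,3) b(1,3) unfolding ext_ideal_def by auto
  qed
qed

text \<open>A prime Q' inside the contraction extends to a prime inside P, since P avoids h T. By
  minimality the extension is P, and contracting it returns Q'.\<close>

lemma contract_minimal_prime:
  assumes P: "P \<in> minimal_primes S" and disj: "\<And>t. t \<in> T \<Longrightarrow> h t \<notin> P"
  shows "{r \<in> carrier R. h r \<in> P} \<in> minimal_primes R"
proof -
  let ?Q = "{r \<in> carrier R. h r \<in> P}"
  have P': "primeideal P S" "\<And>P'. \<lbrakk>primeideal P' S; P' \<subseteq> P\<rbrakk> \<Longrightarrow> P' = P"
    using P by (auto simp: minimal_primes_def)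
  note Pd = h.S.primeD[OF P'(1)]
  have "Q' = ?Q" if Q': "primeideal Q' R" "Q' \<subseteq> ?Q" for Q'
  proof -
    have "Q' \<inter> T = {}" using Q'(2) disj by auto
    note ext = ext_prime[OF Q'(1) this]
    have "ext_ideal Q' \<subseteq> P"
    proof
      fix s assume "s \<in> ext_ideal Q'"
      then obtain t r where s: "s \<in> carrier S" "t \<in> T" "r \<in> Q'" "h t \<otimes>\<^bsub>S\<^esub> s = h r"
        by (auto simp: ext_ideal_def)
      then have "h t \<otimes>\<^bsub>S\<^esub> s \<in> P" using Q'(2) by auto
      then show "s \<in> P" using Pd(3)[of "h t" s] s disj T_in_R by auto
    qed
    then have "ext_ideal Q' = P" using P'(2) ext(1) by simp
    then show ?thesis using ext(2) h.R.idealD(1)[OF h.R.primeD(1)[OF Q'(1)]] by auto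
  qed
  then show ?thesis using primeideal_vimage[OF R S hom P'(1)] by (simp add: minimal_primes_def)
qed

text \<open>Q extends to a minimal prime of S: a prime P inside the extension contracts into Q,
  hence to Q by minimality, and then P contains the whole extension because it avoids h T.\<close>

lemma off_minimal_primes_pull:
  assumes c: "c \<in> carrier R" "h c \<in> off_minimal_primes S"
    and Q: "Q \<in> minimal_primes R" "Q \<inter> T = {}"
  shows "c \<notin> Q"
proof -
  have Q': "primeideal Q R" "\<And>Q'. \<lbrakk>primeideal Q' R; Q' \<subseteq> Q\<rbrakk> \<Longrightarrow> Q' = Q"
    using Q by (auto simp: minimal_primes_def)
  note ext = ext_prime[OF Q'(1) Q(2)]
  have "P = ext_ideal Q" if P: "primeideal P S" "P \<subseteq> ext_ideal Q" for P
  proof -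
    note Pd = h.S.primeD[OF P(1)]
    let ?P = "{r \<in> carrier R. h r \<in> P}"
    have "?P = Q" using primeideal_vimage[OF R S hom P(1)] P(2) ext(2) by (intro Q'(2)) auto
    have "ext_ideal Q \<subseteq> P"
    proof
      fix s assume "s \<in> ext_ideal Q"
      then obtain t r where s: "s \<in> carrier S" "t \<in> T" "r \<in> Q" "h t \<otimes>\<^bsub>S\<^esub> s = h r"
        by (auto simp: ext_ideal_def)
      then have "h t \<otimes>\<^bsub>S\<^esub> s \<in> P" using \<open>?P = Q\<close> by auto
      moreover have "h t \<notin> P" using s(2) Q(2) T_in_R[OF s(2)] \<open>?P = Q\<close> by auto
      ultimately show "s \<in> P" using Pd(3)[of "h t" s] s(1) T_in_R[OF s(2)] by auto
    qed
    then show ?thesis using P(2) by auto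
  qed
  then have "ext_ideal Q \<in> minimal_primes S" using ext(1) by (simp add: minimal_primes_def)
  then show ?thesis using c ext(2) by (auto simp: off_minimal_primes_def)
qed

end

lemma powers_disjoint_prime:
  assumes "cring R" "primeideal P R" "f \<in> carrier R" "f \<notin> P"
  shows "t \<in> powers R f \<Longrightarrow> t \<notin> P"
  using cring.primeD(4)[OF assms(1,2,3)] assms(4) by (auto simp: powers_def)

text \<open>A minimal prime P of S misses some h f, since these elements generate 1. The
  localization at that f shows that P contracts to a minimal prime of R, and c avoids it. Thus S may
  be covered by localizations of R without being one.\<close>

lemma off_minimal_primes_push:
  assumes "cring R" "cring S" and h: "h \<in> ring_hom R S" and F: "F \<subseteq> carrier R"
    and loc: "\<And>f. f \<in> F \<Longrightarrow> ring_localization R S h (powers R f)"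
    and one: "\<one>\<^bsub>S\<^esub> \<in> Idl\<^bsub>S\<^esub> (h ` F)" and c: "c \<in> off_minimal_primes R"
  shows "h c \<in> off_minimal_primes S"
proof -
  interpret R: cring R by fact
  interpret S: cring S by fact
  have cR: "c \<in> carrier R" using c by (simp add: off_minimal_primes_def)
  have "h c \<notin> P" if P: "P \<in> minimal_primes S" for P
  proof
    assume "h c \<in> P"
    have P': "primeideal P S" using P by (simp add: minimal_primes_def)
    note Pd = S.primeD[OF P']
    have "\<not> h ` F \<subseteq> P" using S.genideal_minimal[OF Pd(1)] one Pd(2) by auto
    then obtain f where f: "f \<in> F" "h f \<notin> P" by auto
    interpret L: ring_loc R S h "powers R f" by (rule ring_loc.intro[OF loc[OF f(1)]])
    have fR: "f \<in> carrier R" using f(1) F by auto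
    have "h t \<notin> P" if t: "t \<in> powers R f" for t
    proof -
      obtain n :: nat where "t = f [^]\<^bsub>R\<^esub> n" using t by (auto simp: powers_def)
      then have "h t = h f [^]\<^bsub>S\<^esub> n" using ring_hom_nat_pow[OF assms(1,2) h fR] by simp
      then show ?thesis using Pd(4)[of "h f" n] f(2) fR by auto
    qed
    then have "{r \<in> carrier R. h r \<in> P} \<in> minimal_primes R" by (rule L.contract_minimal_prime[OF P])
    then show False using c cR \<open>h c \<in> P\<close> by (auto simp: off_minimal_primes_def)
  qed
  then show ?thesis using ring_hom_closed[OF h cR] by (auto simp: off_minimal_primes_def)
qed

section \<open>Noetherian rings and localization\<close>

text \<open>Generators of the contraction of I to R map to generators of I, because every x in I is
  a unit times the image of an element of the contraction.\<close>

lemma (in ring_loc_units) noetherian_localization: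
  assumes "noetherian_ring R"
  shows "noetherian_ring S"
proof (rule ring.noetherian_ringI[OF h.S.ring_axioms])
  interpret N: noetherian_ring R by fact
  fix I assume I: "ideal I S"
  let ?J = "{r \<in> carrier R. h r \<in> I}"
  note Id = h.S.idealD[OF I]
  obtain G where G: "G \<subseteq> carrier R" "finite G" "?J = Idl\<^bsub>R\<^esub> G"
    using N.finetely_gen[OF ideal_vimage[OF R S hom I]] by auto
  have hG: "h ` G \<subseteq> carrier S" using G(1) by auto
  have GI: "h ` G \<subseteq> I" using h.R.genideal_self[OF G(1)] G(3) by auto
  note K = h.S.genideal_ideal[OF hG]
  have "I \<subseteq> Idl\<^bsub>S\<^esub> (h ` G)"
  proof
    fix x assume x: "x \<in> I"
    have xc: "x \<in> carrier S" using x Id(1) by auto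
    obtain t r where tr: "t \<in> T" "r \<in> carrier R" "h t \<otimes>\<^bsub>S\<^esub> x = h r" using surj[OF xc] by auto
    have tu: "h t \<in> Units S" using units tr(1) by auto
    have "G \<subseteq> {r \<in> carrier R. h r \<in> Idl\<^bsub>S\<^esub> (h ` G)}" using G(1) h.S.genideal_self[OF hG] by auto
    then have "Idl\<^bsub>R\<^esub> G \<subseteq> {r \<in> carrier R. h r \<in> Idl\<^bsub>S\<^esub> (h ` G)}"
      by (rule h.R.genideal_minimal[OF ideal_vimage[OF R S hom K]])
    moreover have "r \<in> ?J" using tr Id(4)[of "h t" x] x T_in_R by auto
    ultimately have "h t \<otimes>\<^bsub>S\<^esub> x \<in> Idl\<^bsub>S\<^esub> (h ` G)" using G(3) tr(3) by auto
    then have "inv\<^bsub>S\<^esub> (h t) \<otimes>\<^bsub>S\<^esub> (h t \<otimes>\<^bsub>S\<^esub> x) \<in> Idl\<^bsub>S\<^esub> (h ` G)"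
      using h.S.idealD(4)[OF K h.S.Units_inv_closed[OF tu]] by simp
    then show "x \<in> Idl\<^bsub>S\<^esub> (h ` G)" using tu xc by (simp add: h.S.m_assoc[symmetric] h.S.Units_closed)
  qed
  moreover have "Idl\<^bsub>S\<^esub> (h ` G) \<subseteq> I" by (rule h.S.genideal_minimal[OF I GI])
  ultimately show "\<exists>A\<subseteq>carrier S. finite A \<and> I = Idl\<^bsub>S\<^esub> A"
    using hG G(2) by (intro exI[of _ "h ` G"]) auto
qed

text \<open>Clearing denominators in finitely many generators of \<open>ext_ideal J\<close> gives
  numerators in J. Contracting back to R costs a factor from T.\<close>

lemma (in ring_loc_units) noetherian_local_generators:
  assumes "noetherian_ring S" and J: "ideal J R"
  shows "\<exists>G \<subseteq> J. finite G \<and> (\<forall>x\<in>J. \<exists>t\<in>T. t \<otimes>\<^bsub>R\<^esub> x \<in> Idl\<^bsub>R\<^esub> G)"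
proof -
  interpret N: noetherian_ring S by fact
  obtain A where A: "A \<subseteq> carrier S" "finite A" "ext_ideal J = Idl\<^bsub>S\<^esub> A"
    using N.finetely_gen[OF ext_ideal_ideal[OF J]] by auto
  have "\<exists>t r. t \<in> T \<and> r \<in> J \<and> h t \<otimes>\<^bsub>S\<^esub> a = h r" if "a \<in> A" for a
  proof -
    have "a \<in> ext_ideal J" using that h.S.genideal_self[OF A(1)] A(3) by auto
    then show ?thesis by (auto simp: ext_ideal_def)
  qed
  then obtain t r where tr: "\<And>a. a \<in> A \<Longrightarrow> t a \<in> T" "\<And>a. a \<in> A \<Longrightarrow> r a \<in> J"
    "\<And>a. a \<in> A \<Longrightarrow> h (t a) \<otimes>\<^bsub>S\<^esub> a = h (r a)" by metis
  let ?G = "r ` A"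
  have Jc: "J \<subseteq> carrier R" by (rule h.R.idealD(1)[OF J])
  have G: "?G \<subseteq> carrier R" using tr(2) Jc by auto
  note K = h.R.genideal_ideal[OF G]
  note eK = ext_ideal_ideal[OF K]
  have "A \<subseteq> ext_ideal (Idl\<^bsub>R\<^esub> ?G)"
    using tr(1,3) A(1) h.R.genideal_self[OF G] unfolding ext_ideal_def by blast
  then have sub: "ext_ideal J \<subseteq> ext_ideal (Idl\<^bsub>R\<^esub> ?G)"
    unfolding A(3) by (rule h.S.genideal_minimal[OF eK])
  have "\<exists>t\<in>T. t \<otimes>\<^bsub>R\<^esub> x \<in> Idl\<^bsub>R\<^esub> ?G" if x: "x \<in> J" for x
    using ext_ideal_contract[OF K] ext_ideal_hom[OF J x] sub x Jc by auto
  then show ?thesis using tr(2) A(2) by (intro exI[of _ ?G]) auto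
qed

text \<open>The finite sets for a finite subcover together generate I: for x in I the elements r
  with r x in the generated ideal form an ideal, which contains a power of each f and hence
  1.\<close>

lemma noetherian_local:
  fixes R :: "'r ring" and S :: "'r \<Rightarrow> 's ring"
  assumes "cring R" and F: "F \<subseteq> carrier R" "\<one>\<^bsub>R\<^esub> \<in> Idl\<^bsub>R\<^esub> F"
    and loc: "\<And>f. f \<in> F \<Longrightarrow> ring_loc_units R (S f) (h f) (powers R f)"
    and noeth: "\<And>f. f \<in> F \<Longrightarrow> noetherian_ring (S f)"
  shows "noetherian_ring R"
proof -
  interpret cring R by fact
  obtain F' where F': "F' \<subseteq> F" "finite F'" "\<one>\<^bsub>R\<^esub> \<in> Idl\<^bsub>R\<^esub> F'"
    using finite_generators[OF F] by auto
  show ?thesis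
  proof (rule noetherian_ringI)
    fix I assume I: "ideal I R"
    have "\<exists>G. G \<subseteq> I \<and> finite G \<and> (\<forall>x\<in>I. \<exists>t\<in>powers R f. t \<otimes>\<^bsub>R\<^esub> x \<in> Idl\<^bsub>R\<^esub> G)" if "f \<in> F'" for f
      using ring_loc_units.noetherian_local_generators[OF loc noeth I] that F'(1) by blast
    then obtain G where G: "\<And>f. f \<in> F' \<Longrightarrow> G f \<subseteq> I" "\<And>f. f \<in> F' \<Longrightarrow> finite (G f)"
      "\<And>f x. \<lbrakk>f \<in> F'; x \<in> I\<rbrakk> \<Longrightarrow> \<exists>t\<in>powers R f. t \<otimes>\<^bsub>R\<^esub> x \<in> Idl\<^bsub>R\<^esub> (G f)" by metis
    let ?G = "\<Union>(G ` F')"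
    have GI: "?G \<subseteq> I" using G(1) by auto
    then have Gc: "?G \<subseteq> carrier R" using idealD(1)[OF I] by auto
    note K = genideal_ideal[OF Gc]
    have "x \<in> Idl\<^bsub>R\<^esub> ?G" if x: "x \<in> I" for x
    proof -
      have xc: "x \<in> carrier R" using x idealD(1)[OF I] by auto
      let ?A = "{r \<in> carrier R. r \<otimes>\<^bsub>R\<^esub> x \<in> Idl\<^bsub>R\<^esub> ?G}"
      have "ideal ?A R"
        by (rule ideal_intro)
          (use xc idealD(2-4)[OF K] in \<open>auto simp: l_distr m_assoc\<close>)
      then have "\<one>\<^bsub>R\<^esub> \<in> ?A"
      proof (rule one_in_ideal_if_powers)
        show "F' \<subseteq> carrier R" using F'(1) F(1) by auto
        show "\<one>\<^bsub>R\<^esub> \<in> Idl\<^bsub>R\<^esub> F'" by fact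
        fix f assume f: "f \<in> F'"
        obtain n :: nat where n: "f [^]\<^bsub>R\<^esub> n \<otimes>\<^bsub>R\<^esub> x \<in> Idl\<^bsub>R\<^esub> (G f)"
          using G(3)[OF f x] by (auto simp: powers_def)
        have "Idl\<^bsub>R\<^esub> (G f) \<subseteq> Idl\<^bsub>R\<^esub> ?G" using f Gc by (intro subset_Idl_subset) auto
        then show "\<exists>k::nat. f [^]\<^bsub>R\<^esub> k \<in> ?A" using n f F'(1) F(1) by (intro exI[of _ n]) auto
      qed
      then show ?thesis using xc by simp
    qed
    then have "I = Idl\<^bsub>R\<^esub> ?G" using genideal_minimal[OF I GI] by auto
    moreover have "finite ?G" using F'(2) G(2) by auto
    ultimately show "\<exists>A\<subseteq>carrier R. finite A \<and> I = Idl\<^bsub>R\<^esub> A" using Gc by (intro exI[of _ ?G]) auto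
  qed
qed


subsection \<open>The structure sheaf of a spectrum\<close>

lemma regular_module_module:
  assumes "cring R"
  shows "module R (regular_module R)"
proof -
  interpret cring R by fact
  show ?thesis
  proof (rule moduleI)
    show "abelian_group (regular_module R)"
      by (rule abelian_groupI)
        (auto simp: regular_module_def a_assoc a_comm a_lcomm intro: l_neg a_inv_closed)
  qed (auto simp: regular_module_def is_cring l_distr r_distr m_assoc)
qed

lemma regular_module_simps:
  "carrier (regular_module R) = carrier R" "smult (regular_module R) = mult R"
  "add (regular_module R) = add R" "\<zero>\<^bsub>regular_module R\<^esub> = \<zero>\<^bsub>R\<^esub>"
  by (simp_all add: regular_module_def)

text \<open>Used both for exponents of denominators and for the thresholds
  \<open>e0\<close>.\<close>

lemma finite_uniform_bound:
  assumes "finite F" "\<And>x. x \<in> F \<Longrightarrow> \<exists>n::nat. P x n" "\<And>x m n. \<lbrakk>P x m; m \<le> n\<rbrakk> \<Longrightarrow> P x n"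
  shows "\<exists>n. \<forall>x\<in>F. P x n"
  using assms(1,2)
proof (induction F rule: finite_induct)
  case (insert x F)
  then obtain n where n: "\<forall>x\<in>F. P x n" by auto
  obtain m where "P x m" using insert.prems by blast
  with n have "\<forall>y\<in>insert x F. P y (max n m)" using assms(3) by (metis insert_iff max.cobounded1 max.cobounded2)
  then show ?case by blast
qed simp

section \<open>Local rings of a spectrum\<close>

locale stalk =
  fixes A :: "'r ring" (structure) and P :: "'r set"
  assumes A: "cring A" and P: "primeideal P A"
begin

sublocale cring A by (rule A)

abbreviation "stalk_frac \<equiv> fraction A (carrier A - P) (regular_module A)"

lemma compl_submonoid: "submonoid (carrier A - P) A"
  by (rule submonoid.intro) (use primeD[OF P] in auto)

sublocale frac: fractions A "carrier A - P" "regular_module A"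
  by (intro fractions.intro regular_module_module A compl_submonoid)

declare frac.T_simps [simp del]

lemma stalk_carrier: "carrier (loc_at A P) = {stalk_frac a f | a f. a \<in> carrier A \<and> f \<in> carrier A - P}"
  by (simp add: loc_at_def loc_ring_def Let_def frac.loc_carrier regular_module_simps)

lemma stalk_frac_in: "\<lbrakk>a \<in> carrier A; f \<in> carrier A - P\<rbrakk> \<Longrightarrow> stalk_frac a f \<in> carrier (loc_at A P)"
  using frac.frac_in_loc[of a f] by (simp add: loc_at_def loc_ring_def Let_def regular_module_simps)

lemma stalk_one: "\<one>\<^bsub>loc_at A P\<^esub> = stalk_frac \<one> \<one>"
  by (simp add: loc_at_def loc_ring_def Let_def)

lemma stalk_frac_eq_iff:
  assumes "a \<in> carrier A" "f \<in> carrier A - P" "b \<in> carrier A" "g \<in> carrier A - P"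
  shows "stalk_frac a f = stalk_frac b g \<longleftrightarrow> (\<exists>u \<in> carrier A - P. u \<otimes> (g \<otimes> a) = u \<otimes> (f \<otimes> b))"
  using assms frac.frac_eq_iff[of a f b g] by (simp add: regular_module_simps)

lemma stalk_add_one:
  assumes "a \<in> carrier A" "b \<in> carrier A"
  shows "stalk_frac a \<one> \<oplus>\<^bsub>loc_at A P\<^esub> stalk_frac b \<one> = stalk_frac (a \<oplus> b) \<one>"
  using assms frac.loc_add_same_denominator[of a b \<one>] frac.T.one_closed
  by (simp add: loc_at_def loc_ring_def Let_def regular_module_simps)

lemma stalk_mult:
  assumes "a \<in> carrier A" "f \<in> carrier A - P" "b \<in> carrier A" "g \<in> carrier A - P"
  shows "stalk_frac a f \<otimes>\<^bsub>loc_at A P\<^esub> stalk_frac b g = stalk_frac (a \<otimes> b) (f \<otimes> g)"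
proof -
  have "stalk_frac (a' \<otimes> b') (f' \<otimes> g') = stalk_frac (a \<otimes> b) (f \<otimes> g)"
    if a': "a' \<in> carrier (regular_module A)" "f' \<in> carrier A - P" "stalk_frac a' f' = stalk_frac a f"
      and b': "b' \<in> carrier (regular_module A)" "g' \<in> carrier A - P" "stalk_frac b' g' = stalk_frac b g"
    for a' f' b' g'
  proof -
    have c: "a' \<in> carrier A" "b' \<in> carrier A" using a' b' by (auto simp: regular_module_simps)
    obtain u where u: "u \<in> carrier A - P" "u \<otimes> (f \<otimes> a') = u \<otimes> (f' \<otimes> a)"
      using stalk_frac_eq_iff[OF c(1) a'(2) assms(1,2)] a'(3) by auto
    obtain v where v: "v \<in> carrier A - P" "v \<otimes> (g \<otimes> b') = v \<otimes> (g' \<otimes> b)"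
      using stalk_frac_eq_iff[OF c(2) b'(2) assms(3,4)] b'(3) by auto
    have mem: "f \<in> carrier A" "g \<in> carrier A" "f' \<in> carrier A" "g' \<in> carrier A" "u \<in> carrier A" "v \<in> carrier A"
      using assms a'(2) b'(2) u(1) v(1) by auto
    have "(u \<otimes> v) \<otimes> ((f \<otimes> g) \<otimes> (a' \<otimes> b')) = (u \<otimes> (f \<otimes> a')) \<otimes> (v \<otimes> (g \<otimes> b'))"
      using mem c by (simp add: m_ac)
    also have "\<dots> = (u \<otimes> v) \<otimes> ((f' \<otimes> g') \<otimes> (a \<otimes> b))"
      unfolding u(2) v(2) using mem assms(1,3) by (simp add: m_ac)
    finally have "\<exists>w\<in>carrier A - P. w \<otimes> ((f \<otimes> g) \<otimes> (a' \<otimes> b')) = w \<otimes> ((f' \<otimes> g') \<otimes> (a \<otimes> b))"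
      using frac.T.m_closed[OF u(1) v(1)] by blast
    then show ?thesis
      using assms c a'(2) b'(2) frac.T.m_closed by (subst stalk_frac_eq_iff) auto
  qed
  note eq = this
  have "(\<Union>(a', f')\<in>stalk_frac a f. \<Union>(b', g')\<in>stalk_frac b g. stalk_frac (a' \<otimes> b') (f' \<otimes> g'))
      = stalk_frac (a \<otimes> b) (f \<otimes> g)"
    by (intro frac.UN_frac eq) (use assms in \<open>simp_all add: regular_module_simps\<close>)
  then show ?thesis by (simp add: loc_at_def loc_ring_def Let_def)
qed

lemma stalk_mult_eq_iff:
  assumes "x \<in> carrier A" "c \<in> carrier A" "b \<in> carrier A" "t \<in> carrier A - P"
  shows "stalk_frac x \<one> \<otimes>\<^bsub>loc_at A P\<^esub> stalk_frac b t = stalk_frac c \<one>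
    \<longleftrightarrow> (\<exists>u \<in> carrier A - P. u \<otimes> (x \<otimes> b) = u \<otimes> (t \<otimes> c))"
  using assms frac.T.one_closed by (subst stalk_mult) (simp_all add: stalk_frac_eq_iff)

text \<open>The equation is kept in the form x \<sigma> = c, without division, because x may lie in
  P. For a section, the x that have such a c valid at all points at once then form an ideal.\<close>

definition has_numerator :: "('r \<times> 'r) set \<Rightarrow> 'r \<Rightarrow> 'r \<Rightarrow> bool"
  where "has_numerator \<sigma> x c \<longleftrightarrow> stalk_frac x \<one> \<otimes>\<^bsub>loc_at A P\<^esub> \<sigma> = stalk_frac c \<one>"

context
  fixes \<sigma> assumes \<sigma>: "\<sigma> \<in> carrier (loc_at A P)"
begin

lemma numeratorE:
  obtains b t where "b \<in> carrier A" "t \<in> carrier A" "t \<notin> P" "\<sigma> = stalk_frac b t"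
    "\<And>x c. \<lbrakk>x \<in> carrier A; c \<in> carrier A\<rbrakk> \<Longrightarrow> has_numerator \<sigma> x c
      \<longleftrightarrow> (\<exists>u \<in> carrier A - P. u \<otimes> (x \<otimes> b) = u \<otimes> (t \<otimes> c))"
proof -
  obtain b t where *: "b \<in> carrier A" "t \<in> carrier A - P" "\<sigma> = stalk_frac b t"
    using \<sigma> by (auto simp: stalk_carrier)
  show thesis
    by (rule that[of b t]) (use * stalk_mult_eq_iff[of _ _ b t] in \<open>auto simp: has_numerator_def\<close>)
qed

lemma numerator_scale:
  assumes "has_numerator \<sigma> x c" "x \<in> carrier A" "c \<in> carrier A" "y \<in> carrier A"
  shows "has_numerator \<sigma> (y \<otimes> x) (y \<otimes> c)"
proof -
  obtain b t where bt: "b \<in> carrier A" "t \<in> carrier A"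
    and iff: "\<And>x c. \<lbrakk>x \<in> carrier A; c \<in> carrier A\<rbrakk> \<Longrightarrow> has_numerator \<sigma> x c
      \<longleftrightarrow> (\<exists>u \<in> carrier A - P. u \<otimes> (x \<otimes> b) = u \<otimes> (t \<otimes> c))" by (rule numeratorE) auto
  obtain u where u: "u \<in> carrier A - P" "u \<otimes> (x \<otimes> b) = u \<otimes> (t \<otimes> c)" using iff assms by auto
  have "u \<otimes> ((y \<otimes> x) \<otimes> b) = y \<otimes> (u \<otimes> (x \<otimes> b))" using u(1) bt assms(2-4) by (simp add: m_ac)
  also have "\<dots> = u \<otimes> (t \<otimes> (y \<otimes> c))" unfolding u(2) using u(1) bt assms(2-4) by (simp add: m_ac)
  finally show ?thesis using iff[of "y \<otimes> x" "y \<otimes> c"] u(1) assms(2-4) by auto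
qed

lemma numerator_add:
  assumes "has_numerator \<sigma> x c" "has_numerator \<sigma> y d"
    and "x \<in> carrier A" "c \<in> carrier A" "y \<in> carrier A" "d \<in> carrier A"
  shows "has_numerator \<sigma> (x \<oplus> y) (c \<oplus> d)"
proof -
  obtain b t where bt: "b \<in> carrier A" "t \<in> carrier A"
    and iff: "\<And>x c. \<lbrakk>x \<in> carrier A; c \<in> carrier A\<rbrakk> \<Longrightarrow> has_numerator \<sigma> x c
      \<longleftrightarrow> (\<exists>u \<in> carrier A - P. u \<otimes> (x \<otimes> b) = u \<otimes> (t \<otimes> c))" by (rule numeratorE) auto
  obtain u v where u: "u \<in> carrier A - P" "u \<otimes> (x \<otimes> b) = u \<otimes> (t \<otimes> c)"
    and v: "v \<in> carrier A - P" "v \<otimes> (y \<otimes> b) = v \<otimes> (t \<otimes> d)" using iff assms by metis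
  have uv: "u \<in> carrier A" "v \<in> carrier A" using u v by auto
  have "(u \<otimes> v) \<otimes> ((x \<oplus> y) \<otimes> b) = v \<otimes> (u \<otimes> (x \<otimes> b)) \<oplus> u \<otimes> (v \<otimes> (y \<otimes> b))"
    using uv bt assms(3-6) by (simp add: m_ac r_distr l_distr)
  also have "\<dots> = (u \<otimes> v) \<otimes> (t \<otimes> (c \<oplus> d))"
    unfolding u(2) v(2) using uv bt assms(3-6) by (simp add: m_ac r_distr l_distr)
  finally show ?thesis
    using iff[of "x \<oplus> y" "c \<oplus> d"] frac.T.m_closed[OF u(1) v(1)] assms(3-6) by auto
qed

lemma numerator_zero: "has_numerator \<sigma> \<zero> \<zero>"
proof -
  obtain b t where bt: "b \<in> carrier A" "t \<in> carrier A"
    and iff: "\<And>x c. \<lbrakk>x \<in> carrier A; c \<in> carrier A\<rbrakk> \<Longrightarrow> has_numerator \<sigma> x c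
      \<longleftrightarrow> (\<exists>u \<in> carrier A - P. u \<otimes> (x \<otimes> b) = u \<otimes> (t \<otimes> c))" by (rule numeratorE) auto
  then show ?thesis using iff[of \<zero> \<zero>] frac.T.one_closed by auto
qed

text \<open>y is invertible at P, so \<sigma> = d/y, and the last assumption says that c = x d / y
  there.\<close>

lemma numerator_change:
  assumes "has_numerator \<sigma> y d" "y \<in> carrier A - P" "d \<in> carrier A"
    and "w \<in> carrier A - P" "x \<in> carrier A" "c \<in> carrier A" "w \<otimes> (y \<otimes> c) = w \<otimes> (x \<otimes> d)"
  shows "has_numerator \<sigma> x c"
proof -
  obtain b t where bt: "b \<in> carrier A" "t \<in> carrier A"
    and iff: "\<And>x c. \<lbrakk>x \<in> carrier A; c \<in> carrier A\<rbrakk> \<Longrightarrow> has_numerator \<sigma> x c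
      \<longleftrightarrow> (\<exists>u \<in> carrier A - P. u \<otimes> (x \<otimes> b) = u \<otimes> (t \<otimes> c))" by (rule numeratorE) auto
  obtain u where u: "u \<in> carrier A - P" "u \<otimes> (y \<otimes> b) = u \<otimes> (t \<otimes> d)" using iff[of y d] assms by auto
  have mem: "u \<in> carrier A" "y \<in> carrier A" "w \<in> carrier A" using u assms by auto
  have "((u \<otimes> w) \<otimes> y) \<otimes> (x \<otimes> b) = (w \<otimes> x) \<otimes> (u \<otimes> (y \<otimes> b))"
    using mem bt assms(3,5,6) by (simp add: m_ac)
  also have "\<dots> = (u \<otimes> t) \<otimes> (w \<otimes> (x \<otimes> d))"
    unfolding u(2) using mem bt assms(3,5,6) by (simp add: m_ac)
  also have "\<dots> = ((u \<otimes> w) \<otimes> y) \<otimes> (t \<otimes> c)"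
    unfolding assms(7)[symmetric] using mem bt assms(3,5,6) by (simp add: m_ac)
  finally show ?thesis
    using iff[OF assms(5,6)] frac.T.m_closed[OF frac.T.m_closed[OF u(1) assms(4)] assms(2)] by auto
qed

text \<open>Both sides equal x y \<sigma>.\<close>

lemma numerator_unique:
  assumes "has_numerator \<sigma> x c" "has_numerator \<sigma> y d"
    and mem: "x \<in> carrier A" "c \<in> carrier A" "y \<in> carrier A" "d \<in> carrier A"
  shows "stalk_frac (x \<otimes> d) \<one> = stalk_frac (y \<otimes> c) \<one>"
proof -
  obtain b t where bt: "b \<in> carrier A" "t \<in> carrier A" "t \<notin> P"
    and iff: "\<And>x c. \<lbrakk>x \<in> carrier A; c \<in> carrier A\<rbrakk> \<Longrightarrow> has_numerator \<sigma> x c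
      \<longleftrightarrow> (\<exists>u \<in> carrier A - P. u \<otimes> (x \<otimes> b) = u \<otimes> (t \<otimes> c))" by (rule numeratorE) auto
  obtain u v where u: "u \<in> carrier A - P" "u \<otimes> (x \<otimes> b) = u \<otimes> (t \<otimes> c)"
    and v: "v \<in> carrier A - P" "v \<otimes> (y \<otimes> b) = v \<otimes> (t \<otimes> d)" using iff assms by metis
  have uv: "u \<in> carrier A" "v \<in> carrier A" using u v by auto
  have "((u \<otimes> v) \<otimes> t) \<otimes> (x \<otimes> d) = (u \<otimes> x) \<otimes> (v \<otimes> (t \<otimes> d))"
    using uv bt mem by (simp add: m_ac)
  also have "\<dots> = (v \<otimes> y) \<otimes> (u \<otimes> (x \<otimes> b))"
    unfolding v(2)[symmetric] using uv bt mem by (simp add: m_ac)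
  also have "\<dots> = ((u \<otimes> v) \<otimes> t) \<otimes> (y \<otimes> c)"
    unfolding u(2) using uv bt mem by (simp add: m_ac)
  finally have eq: "((u \<otimes> v) \<otimes> t) \<otimes> (\<one> \<otimes> (x \<otimes> d)) = ((u \<otimes> v) \<otimes> t) \<otimes> (\<one> \<otimes> (y \<otimes> c))"
    using uv bt mem by simp
  have "t \<in> carrier A - P" using bt by simp
  note T = frac.T.m_closed[OF frac.T.m_closed[OF u(1) v(1)] this]
  show ?thesis
  proof (subst stalk_frac_eq_iff)
    show "\<exists>w\<in>carrier A - P. w \<otimes> (\<one> \<otimes> (x \<otimes> d)) = w \<otimes> (\<one> \<otimes> (y \<otimes> c))"
      by (rule bexI[OF _ T]) (rule eq)
  qed (use mem frac.T.one_closed in simp_all)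
qed

lemma numerator_unit:
  assumes "a \<in> carrier A" "has_numerator \<sigma> a \<one>"
  shows "a \<notin> P"
proof
  assume a: "a \<in> P"
  obtain b t where bt: "b \<in> carrier A" "t \<in> carrier A" "t \<notin> P" "\<sigma> = stalk_frac b t"
    and iff: "\<And>x c. \<lbrakk>x \<in> carrier A; c \<in> carrier A\<rbrakk> \<Longrightarrow> has_numerator \<sigma> x c
      \<longleftrightarrow> (\<exists>u \<in> carrier A - P. u \<otimes> (x \<otimes> b) = u \<otimes> (t \<otimes> c))" by (rule numeratorE) auto
  obtain u where u: "u \<in> carrier A - P" "u \<otimes> (a \<otimes> b) = u \<otimes> (t \<otimes> \<one>)" using iff[of a \<one>] assms by auto
  have "u \<in> carrier A" using u(1) by simp
  then have "u \<otimes> (a \<otimes> b) \<in> P"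
    by (rule idealD(4)[OF primeD(1)[OF P] _ idealD(5)[OF primeD(1)[OF P] bt(1) a]])
  then have "u \<otimes> t \<in> P" using u bt(2) by simp
  moreover have "u \<notin> P" using u(1) by simp
  ultimately show False using primeD(3)[OF P \<open>u \<in> carrier A\<close> bt(2)] bt(3) by simp
qed

lemma numerator_denominator:
  assumes "\<sigma> = stalk_frac b t" "b \<in> carrier A" "t \<in> carrier A - P"
  shows "has_numerator \<sigma> t b"
proof -
  have t: "t \<in> carrier A" using assms(3) by simp
  have "\<exists>u\<in>carrier A - P. u \<otimes> (t \<otimes> b) = u \<otimes> (t \<otimes> b)" using frac.T.one_closed by blast
  then show ?thesis
    unfolding has_numerator_def assms(1) stalk_mult_eq_iff[OF t assms(2,2,3)] .
qed

end

end


section \<open>Distinguished open sets of Spec A and their sections\<close>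

definition Spec_basic :: "'r ring \<Rightarrow> 'r \<Rightarrow> 'r set set"
  where "Spec_basic A a = {P. primeideal P A \<and> a \<notin> P}"

definition Spec_const :: "'r ring \<Rightarrow> 'r set set \<Rightarrow> 'r \<Rightarrow> 'r set \<Rightarrow> ('r \<times> 'r) set"
  where "Spec_const A V a = (\<lambda>P\<in>V. fraction A (carrier A - P) (regular_module A) a \<one>\<^bsub>A\<^esub>)"

lemma openin_Spec:
  "openin (Spec_topology A) U \<longleftrightarrow> (\<exists>S \<subseteq> carrier A. U = {P. primeideal P A \<and> \<not> S \<subseteq> P})"
  unfolding Spec_topology_def by (simp add: topology_inverse'[OF istopology_Spec])

lemma openin_Spec_prime: "\<lbrakk>openin (Spec_topology A) U; P \<in> U\<rbrakk> \<Longrightarrow> primeideal P A"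
  by (auto simp: openin_Spec)

lemma openin_Spec_basic: "a \<in> carrier A \<Longrightarrow> openin (Spec_topology A) (Spec_basic A a)"
  unfolding openin_Spec by (intro exI[of _ "{a}"]) (auto simp: Spec_basic_def)

lemma Spec_basic_base:
  assumes "openin (Spec_topology A) U" "P \<in> U"
  shows "\<exists>a \<in> carrier A. P \<in> Spec_basic A a \<and> Spec_basic A a \<subseteq> U"
proof -
  obtain S where S: "S \<subseteq> carrier A" "U = {P. primeideal P A \<and> \<not> S \<subseteq> P}"
    using assms(1) by (auto simp: openin_Spec)
  then obtain a where "a \<in> S" "a \<notin> P" using assms(2) by auto
  then show ?thesis using S assms(2) by (intro bexI[of _ a]) (auto simp: Spec_basic_def)
qed

lemma Spec_basic_one:
  assumes "cring A"
  shows "Spec_basic A \<one>\<^bsub>A\<^esub> = topspace (Spec_topology A)"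
proof -
  interpret cring A by fact
  have "Spec_basic A \<one>\<^bsub>A\<^esub> = {P. primeideal P A}" using primeD(2) by (auto simp: Spec_basic_def)
  moreover have "openin (Spec_topology A) (Spec_basic A \<one>\<^bsub>A\<^esub>)" by (rule openin_Spec_basic) simp
  ultimately show ?thesis
    using openin_subset[of "Spec_topology A"] openin_Spec_prime[OF openin_topspace] by blast
qed

text \<open>Otherwise some prime contains G but not a; it is a point of D(a) that the cover
  misses.\<close>

lemma Spec_basic_covered:
  assumes "cring A" "a \<in> carrier A" "G \<subseteq> carrier A"
    and "Spec_basic A a \<subseteq> \<Union>(Spec_basic A ` G)"
  shows "\<exists>n::nat. a [^]\<^bsub>A\<^esub> n \<in> Idl\<^bsub>A\<^esub> G"
proof (rule ccontr)
  interpret cring A by fact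
  assume "\<not> ?thesis"
  then obtain P where P: "primeideal P A" "Idl\<^bsub>A\<^esub> G \<subseteq> P" "a \<notin> P"
    using exists_prime_avoiding_powers[OF genideal_ideal[OF assms(3)] assms(2)] by auto
  then obtain g where "g \<in> G" "g \<notin> P" using assms(4) by (auto simp: Spec_basic_def)
  then show False using P(2) genideal_self[OF assms(3)] by auto
qed

lemma Spec_section_value:
  "\<lbrakk>s \<in> carrier (Spec_sections A U); P \<in> U\<rbrakk> \<Longrightarrow> s P \<in> carrier (loc_at A P)"
  by (auto simp: Spec_sections_def)

lemma Spec_section_fraction:
  assumes "cring A" "openin (Spec_topology A) U" "a \<in> carrier A" "f \<in> carrier A" "\<And>P. P \<in> U \<Longrightarrow> f \<notin> P"
  shows "(\<lambda>P\<in>U. fraction A (carrier A - P) (regular_module A) a f) \<in> carrier (Spec_sections A U)"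
    (is "?s \<in> _")
proof -
  have "fraction A (carrier A - P) (regular_module A) a f \<in> carrier (loc_at A P)" if PU: "P \<in> U" for P
  proof -
    interpret stalk A P by (intro stalk.intro assms(1) openin_Spec_prime[OF assms(2) PU])
    show ?thesis by (rule stalk_frac_in) (use assms PU in auto)
  qed
  then have "?s \<in> (\<Pi>\<^sub>E P\<in>U. carrier (loc_at A P))" by auto
  moreover have "\<exists>b\<in>carrier A. \<exists>g\<in>carrier A. \<forall>Q\<in>U. g \<notin> Q
      \<and> ?s Q = fraction A (carrier A - Q) (regular_module A) b g"
    by (rule bexI[where x=a], rule bexI[where x=f]) (use assms in auto)
  then have "\<forall>P\<in>U. \<exists>V. openin (Spec_topology A) V \<and> P \<in> V \<and> V \<subseteq> U
      \<and> (\<exists>b\<in>carrier A. \<exists>g\<in>carrier A. \<forall>Q\<in>V. g \<notin> Q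
        \<and> ?s Q = fraction A (carrier A - Q) (regular_module A) b g)"
    by (intro ballI exI[of _ U] conjI assms(2) order_refl) assumption+
  ultimately show ?thesis unfolding Spec_sections_def by simp
qed

lemma Spec_const_carrier:
  assumes "cring A" "openin (Spec_topology A) U" "a \<in> carrier A"
  shows "Spec_const A U a \<in> carrier (Spec_sections A U)"
  unfolding Spec_const_def
proof (rule Spec_section_fraction[OF assms])
  interpret cring A by fact
  show "\<one>\<^bsub>A\<^esub> \<in> carrier A" by simp
  show "\<one>\<^bsub>A\<^esub> \<notin> P" if "P \<in> U" for P using primeD(2)[OF openin_Spec_prime[OF assms(2) that]] .
qed

text \<open>If the ideal of all x with x b = x c contained no power of a, a prime P in D(a) would
  contain this ideal. But equality in the local ring at P yields such an x outside P.\<close>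

lemma Spec_const_eqD:
  assumes "cring A" and a: "a \<in> carrier A" and bc: "b \<in> carrier A" "c \<in> carrier A"
    and eq: "\<And>P. P \<in> Spec_basic A a \<Longrightarrow> fraction A (carrier A - P) (regular_module A) b \<one>\<^bsub>A\<^esub>
      = fraction A (carrier A - P) (regular_module A) c \<one>\<^bsub>A\<^esub>"
  shows "\<exists>n::nat. a [^]\<^bsub>A\<^esub> n \<otimes>\<^bsub>A\<^esub> b = a [^]\<^bsub>A\<^esub> n \<otimes>\<^bsub>A\<^esub> c"
proof (rule ccontr)
  interpret cring A by fact
  let ?I = "{x \<in> carrier A. x \<otimes>\<^bsub>A\<^esub> b = x \<otimes>\<^bsub>A\<^esub> c}"
  assume no: "\<not> ?thesis"
  have I: "ideal ?I A"
    by (rule ideal_intro) (use bc in \<open>auto simp: l_distr m_assoc\<close>)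
  have "a [^]\<^bsub>A\<^esub> n \<notin> ?I" for n :: nat using no by auto
  from exists_prime_avoiding_powers[OF I a this]
  obtain P where Pp: "primeideal P A" "?I \<subseteq> P" "a \<notin> P" by blast
  interpret stalk A P by (intro stalk.intro assms(1) Pp(1))
  have "stalk_frac b \<one>\<^bsub>A\<^esub> = stalk_frac c \<one>\<^bsub>A\<^esub>"
    by (rule eq) (use Pp in \<open>simp add: Spec_basic_def\<close>)
  then obtain u where u: "u \<in> carrier A - P" "u \<otimes>\<^bsub>A\<^esub> (\<one>\<^bsub>A\<^esub> \<otimes>\<^bsub>A\<^esub> b) = u \<otimes>\<^bsub>A\<^esub> (\<one>\<^bsub>A\<^esub> \<otimes>\<^bsub>A\<^esub> c)"
    using stalk_frac_eq_iff[OF bc(1) frac.T.one_closed bc(2) frac.T.one_closed] by auto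
  then have "u \<in> ?I" using bc by auto
  then show False using Pp(2) u(1) by auto
qed

text \<open>On \<open>D(a)\<close> every section is a fraction with denominator a power of \<open>a\<close>: the elements
  \<open>x\<close> for which \<open>x s\<close> is a global constant form an ideal, and it is contained in no prime of \<open>D(a)\<close>.\<close>

lemma Spec_section_numerator:
  assumes "cring A" and a: "a \<in> carrier A" and s: "s \<in> carrier (Spec_sections A (Spec_basic A a))"
  shows "\<exists>n::nat. \<exists>c\<in>carrier A. \<forall>P\<in>Spec_basic A a. stalk.has_numerator A P (s P) (a [^]\<^bsub>A\<^esub> n) c"
proof -
  interpret cring A by fact
  let ?D = "Spec_basic A"
  have st: "stalk A P" if "P \<in> ?D a" for P
    using that by (intro stalk.intro assms(1)) (simp add: Spec_basic_def)
  have sv: "s P \<in> carrier (loc_at A P)" if "P \<in> ?D a" for P using Spec_section_value[OF s that] .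
  let ?local = "\<lambda>g b t. g \<in> carrier A \<and> b \<in> carrier A \<and> t \<in> carrier A \<and> ?D g \<subseteq> ?D a
    \<and> (\<forall>Q\<in>?D g. t \<notin> Q \<and> stalk.has_numerator A Q (s Q) t b)"
  define G where "G = {g. \<exists>b t. ?local g b t}"
  have GA: "G \<subseteq> carrier A" by (auto simp: G_def)
  have "?D a \<subseteq> \<Union>(?D ` G)"
  proof
    fix P assume P: "P \<in> ?D a"
    from s have "\<forall>P\<in>?D a. \<exists>V. openin (Spec_topology A) V \<and> P \<in> V \<and> V \<subseteq> ?D a
          \<and> (\<exists>b \<in> carrier A. \<exists>t \<in> carrier A. \<forall>Q \<in> V. t \<notin> Q
              \<and> s Q = fraction A (carrier A - Q) (regular_module A) b t)"
      by (simp add: Spec_sections_def)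
    from bspec[OF this P] obtain V b t where V: "openin (Spec_topology A) V" "P \<in> V" "V \<subseteq> ?D a"
      "b \<in> carrier A" "t \<in> carrier A"
      "\<forall>Q\<in>V. t \<notin> Q \<and> s Q = fraction A (carrier A - Q) (regular_module A) b t"
      by auto
    obtain g where g: "g \<in> carrier A" "P \<in> ?D g" "?D g \<subseteq> V" using Spec_basic_base[OF V(1,2)] by auto
    have "t \<notin> Q \<and> stalk.has_numerator A Q (s Q) t b" if Q: "Q \<in> ?D g" for Q
    proof -
      have QV: "Q \<in> V" and Qa: "Q \<in> ?D a" using Q g(3) V(3) by auto
      interpret stalk A Q by (rule st[OF Qa])
      have sQ: "t \<notin> Q" "s Q = stalk_frac b t" using V(6) QV by auto
      then show ?thesis using numerator_denominator[OF sv[OF Qa] sQ(2) V(4)] V(5) by simp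
    qed
    then have "?local g b t" using g V(3-5) by auto
    then have "g \<in> G" unfolding G_def by blast
    then show "P \<in> \<Union>(?D ` G)" using g(2) by auto
  qed
  then obtain m :: nat where "a [^]\<^bsub>A\<^esub> m \<in> Idl\<^bsub>A\<^esub> G"
    using Spec_basic_covered[OF assms(1) a GA] by auto
  then obtain F where F: "F \<subseteq> G" "finite F" "a [^]\<^bsub>A\<^esub> m \<in> Idl\<^bsub>A\<^esub> F"
    using finite_generators[OF GA] by auto
  have FA: "F \<subseteq> carrier A" using F(1) GA by auto
  \<comment> \<open>The finite set F still covers D(a): a prime containing F contains a^m and hence
    a.\<close>
  have cover: "\<exists>g\<in>F. P \<in> ?D g" if P: "P \<in> ?D a" for P
  proof (rule ccontr)
    have Pp: "primeideal P A" "a \<notin> P" using P by (auto simp: Spec_basic_def)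
    assume "\<not> ?thesis"
    then have "F \<subseteq> P" using Pp by (auto simp: Spec_basic_def)
    then have "a [^]\<^bsub>A\<^esub> m \<in> P" using genideal_minimal[OF primeD(1)[OF Pp(1)]] F(3) by auto
    then show False using primeD(4)[OF Pp(1) a] Pp(2) by auto
  qed
  have "\<forall>g\<in>F. \<exists>b t. ?local g b t" using F(1) unfolding G_def by blast
  then obtain b t where bt: "\<forall>g\<in>F. ?local g (b g) (t g)" by metis
  have bc: "b g \<in> carrier A" "t g \<in> carrier A" "g \<in> carrier A" if "g \<in> F" for g using bt that by auto
  have num: "t g \<notin> Q" "stalk.has_numerator A Q (s Q) (t g) (b g)" "Q \<in> ?D a" if "g \<in> F" "Q \<in> ?D g" for g Q
    using bt that by auto
  \<comment> \<open>On D(g k) both t_g b_k and t_k b_g equal t_g t_k s, so in A they agree up to a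
    power of g k.\<close>
  have "\<exists>N::nat. (g \<otimes>\<^bsub>A\<^esub> k) [^]\<^bsub>A\<^esub> N \<otimes>\<^bsub>A\<^esub> (t g \<otimes>\<^bsub>A\<^esub> b k) = (g \<otimes>\<^bsub>A\<^esub> k) [^]\<^bsub>A\<^esub> N \<otimes>\<^bsub>A\<^esub> (t k \<otimes>\<^bsub>A\<^esub> b g)"
    if gk: "g \<in> F" "k \<in> F" for g k
  proof (rule Spec_const_eqD[OF assms(1)])
    show "g \<otimes>\<^bsub>A\<^esub> k \<in> carrier A" "t g \<otimes>\<^bsub>A\<^esub> b k \<in> carrier A" "t k \<otimes>\<^bsub>A\<^esub> b g \<in> carrier A"
      using bc gk by auto
    fix Q assume Q: "Q \<in> ?D (g \<otimes>\<^bsub>A\<^esub> k)"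
    then have Qp: "primeideal Q A" by (simp add: Spec_basic_def)
    have Q': "Q \<in> ?D g" "Q \<in> ?D k"
      using Q primeD(3)[OF Qp bc(3)[OF gk(1)] bc(3)[OF gk(2)]] by (auto simp: Spec_basic_def)
    interpret stalk A Q by (intro stalk.intro assms(1) Qp)
    show "stalk_frac (t g \<otimes>\<^bsub>A\<^esub> b k) \<one>\<^bsub>A\<^esub> = stalk_frac (t k \<otimes>\<^bsub>A\<^esub> b g) \<one>\<^bsub>A\<^esub>"
      by (rule numerator_unique[OF sv[OF num(3)[OF gk(1) Q'(1)]] num(2)[OF gk(1) Q'(1)] num(2)[OF gk(2) Q'(2)]])
        (use bc gk in auto)
  qed
  then have "\<exists>N::nat. \<forall>(g, k)\<in>F \<times> F. (g \<otimes>\<^bsub>A\<^esub> k) [^]\<^bsub>A\<^esub> N \<otimes>\<^bsub>A\<^esub> (t g \<otimes>\<^bsub>A\<^esub> b k)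
      = (g \<otimes>\<^bsub>A\<^esub> k) [^]\<^bsub>A\<^esub> N \<otimes>\<^bsub>A\<^esub> (t k \<otimes>\<^bsub>A\<^esub> b g)"
  proof -
    \<comment> \<open>Membership in F is part of the predicate because the monotonicity premise of
      \<open>finite_uniform_bound\<close> ranges over all pairs.\<close>
    let ?P = "\<lambda>(g, k) (N::nat). g \<in> F \<and> k \<in> F \<and> (g \<otimes>\<^bsub>A\<^esub> k) [^]\<^bsub>A\<^esub> N \<otimes>\<^bsub>A\<^esub> (t g \<otimes>\<^bsub>A\<^esub> b k)
      = (g \<otimes>\<^bsub>A\<^esub> k) [^]\<^bsub>A\<^esub> N \<otimes>\<^bsub>A\<^esub> (t k \<otimes>\<^bsub>A\<^esub> b g)"
    assume *: "\<And>g k. g \<in> F \<Longrightarrow> k \<in> F \<Longrightarrow> \<exists>N::nat. (g \<otimes>\<^bsub>A\<^esub> k) [^]\<^bsub>A\<^esub> N \<otimes>\<^bsub>A\<^esub> (t g \<otimes>\<^bsub>A\<^esub> b k)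
      = (g \<otimes>\<^bsub>A\<^esub> k) [^]\<^bsub>A\<^esub> N \<otimes>\<^bsub>A\<^esub> (t k \<otimes>\<^bsub>A\<^esub> b g)"
    have "\<exists>N. \<forall>x\<in>F \<times> F. ?P x N"
    proof (rule finite_uniform_bound)
      show "finite (F \<times> F)" using F(2) by simp
      show "\<exists>n. ?P x n" if "x \<in> F \<times> F" for x using that * by (cases x) simp
      fix x and m n :: nat assume Pm: "?P x m" and "m \<le> n"
      obtain g k where x: "x = (g, k)" by (cases x)
      have gk: "g \<in> F" "k \<in> F" and eq: "(g \<otimes>\<^bsub>A\<^esub> k) [^]\<^bsub>A\<^esub> m \<otimes>\<^bsub>A\<^esub> (t g \<otimes>\<^bsub>A\<^esub> b k)
        = (g \<otimes>\<^bsub>A\<^esub> k) [^]\<^bsub>A\<^esub> m \<otimes>\<^bsub>A\<^esub> (t k \<otimes>\<^bsub>A\<^esub> b g)" using Pm x by auto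
      have pw: "(g \<otimes>\<^bsub>A\<^esub> k) [^]\<^bsub>A\<^esub> n = (g \<otimes>\<^bsub>A\<^esub> k) [^]\<^bsub>A\<^esub> (n - m) \<otimes>\<^bsub>A\<^esub> (g \<otimes>\<^bsub>A\<^esub> k) [^]\<^bsub>A\<^esub> m"
        using bc gk \<open>m \<le> n\<close> by (simp add: nat_pow_mult)
      have "(g \<otimes>\<^bsub>A\<^esub> k) [^]\<^bsub>A\<^esub> n \<otimes>\<^bsub>A\<^esub> (t g \<otimes>\<^bsub>A\<^esub> b k)
        = (g \<otimes>\<^bsub>A\<^esub> k) [^]\<^bsub>A\<^esub> (n - m) \<otimes>\<^bsub>A\<^esub> ((g \<otimes>\<^bsub>A\<^esub> k) [^]\<^bsub>A\<^esub> m \<otimes>\<^bsub>A\<^esub> (t g \<otimes>\<^bsub>A\<^esub> b k))"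
        unfolding pw using bc gk by (intro m_assoc) auto
      also have "\<dots> = (g \<otimes>\<^bsub>A\<^esub> k) [^]\<^bsub>A\<^esub> n \<otimes>\<^bsub>A\<^esub> (t k \<otimes>\<^bsub>A\<^esub> b g)"
        unfolding pw eq using bc gk by (intro m_assoc[symmetric]) auto
      finally show "?P x n" using x gk by simp
    qed
    then show ?thesis by auto
  qed
  then obtain N :: nat where N: "\<And>g k. \<lbrakk>g \<in> F; k \<in> F\<rbrakk> \<Longrightarrow> (g \<otimes>\<^bsub>A\<^esub> k) [^]\<^bsub>A\<^esub> N \<otimes>\<^bsub>A\<^esub> (t g \<otimes>\<^bsub>A\<^esub> b k)
      = (g \<otimes>\<^bsub>A\<^esub> k) [^]\<^bsub>A\<^esub> N \<otimes>\<^bsub>A\<^esub> (t k \<otimes>\<^bsub>A\<^esub> b g)" by auto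
  let ?I = "{x \<in> carrier A. \<exists>c\<in>carrier A. \<forall>Q\<in>?D a. stalk.has_numerator A Q (s Q) x c}"
  have I: "ideal ?I A"
  proof (rule ideal_intro)
    show "\<zero>\<^bsub>A\<^esub> \<in> ?I"
      using stalk.numerator_zero[OF st sv] by (auto intro!: bexI[of _ "\<zero>\<^bsub>A\<^esub>"])
  next
    fix x y assume "x \<in> ?I" "y \<in> ?I"
    then obtain c d where *: "x \<in> carrier A" "y \<in> carrier A" "c \<in> carrier A" "d \<in> carrier A"
      "\<And>Q. Q \<in> ?D a \<Longrightarrow> stalk.has_numerator A Q (s Q) x c"
      "\<And>Q. Q \<in> ?D a \<Longrightarrow> stalk.has_numerator A Q (s Q) y d" by auto
    have "stalk.has_numerator A Q (s Q) (x \<oplus>\<^bsub>A\<^esub> y) (c \<oplus>\<^bsub>A\<^esub> d)" if "Q \<in> ?D a" for Q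
      by (rule stalk.numerator_add[OF st[OF that] sv[OF that] *(5)[OF that] *(6)[OF that] *(1,3,2,4)])
    then show "x \<oplus>\<^bsub>A\<^esub> y \<in> ?I" using * by (intro CollectI conjI bexI[of _ "c \<oplus>\<^bsub>A\<^esub> d"]) auto
  next
    fix y x assume "y \<in> carrier A" "x \<in> ?I"
    then obtain c where *: "y \<in> carrier A" "x \<in> carrier A" "c \<in> carrier A"
      "\<And>Q. Q \<in> ?D a \<Longrightarrow> stalk.has_numerator A Q (s Q) x c" by auto
    have "stalk.has_numerator A Q (s Q) (y \<otimes>\<^bsub>A\<^esub> x) (y \<otimes>\<^bsub>A\<^esub> c)" if "Q \<in> ?D a" for Q
      by (rule stalk.numerator_scale[OF st[OF that] sv[OF that] *(4)[OF that] *(2,3,1)])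
    then show "y \<otimes>\<^bsub>A\<^esub> x \<in> ?I" using * by (intro CollectI conjI bexI[of _ "y \<otimes>\<^bsub>A\<^esub> c"]) auto
  qed auto
  \<comment> \<open>The numerator g^N b_g of g^N t_g s is valid on all of D(a), not just on D(g): at
    a point of D(k), where s = b_k / t_k, the required identity holds after multiplication by k^N, a
    unit there.\<close>
  have mem: "g [^]\<^bsub>A\<^esub> N \<otimes>\<^bsub>A\<^esub> t g \<in> ?I" if g: "g \<in> F" for g
  proof -
    have "stalk.has_numerator A Q (s Q) (g [^]\<^bsub>A\<^esub> N \<otimes>\<^bsub>A\<^esub> t g) (g [^]\<^bsub>A\<^esub> N \<otimes>\<^bsub>A\<^esub> b g)" if Q: "Q \<in> ?D a" for Q
    proof -
      obtain k where k: "k \<in> F" "Q \<in> ?D k" using cover[OF Q] by auto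
      interpret stalk A Q by (rule st[OF Q])
      have kQ: "k \<notin> Q" using k(2) by (simp add: Spec_basic_def)
      have w: "k [^]\<^bsub>A\<^esub> N \<in> carrier A - Q" using primeD(4)[OF P bc(3)[OF k(1)]] kQ bc(3)[OF k(1)] by auto
      have y: "t k \<in> carrier A - Q" using bc(2)[OF k(1)] num(1)[OF k] by simp
      note c = bc[OF g] bc[OF k(1)]
      have "k [^]\<^bsub>A\<^esub> N \<otimes>\<^bsub>A\<^esub> (t k \<otimes>\<^bsub>A\<^esub> (g [^]\<^bsub>A\<^esub> N \<otimes>\<^bsub>A\<^esub> b g)) = (g \<otimes>\<^bsub>A\<^esub> k) [^]\<^bsub>A\<^esub> N \<otimes>\<^bsub>A\<^esub> (t k \<otimes>\<^bsub>A\<^esub> b g)"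
        using c by (simp add: nat_pow_distrib m_ac)
      also have "\<dots> = (g \<otimes>\<^bsub>A\<^esub> k) [^]\<^bsub>A\<^esub> N \<otimes>\<^bsub>A\<^esub> (t g \<otimes>\<^bsub>A\<^esub> b k)" using N[OF g k(1)] by simp
      also have "\<dots> = k [^]\<^bsub>A\<^esub> N \<otimes>\<^bsub>A\<^esub> ((g [^]\<^bsub>A\<^esub> N \<otimes>\<^bsub>A\<^esub> t g) \<otimes>\<^bsub>A\<^esub> b k)"
        using c by (simp add: nat_pow_distrib m_ac)
      finally show ?thesis
        by (rule numerator_change[OF sv[OF Q] num(2)[OF k] y c(4) w, rotated 2]) (use c in auto)
    qed
    then show ?thesis using bc[OF g] by (intro CollectI conjI bexI[of _ "g [^]\<^bsub>A\<^esub> N \<otimes>\<^bsub>A\<^esub> b g"]) auto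
  qed
  have "\<exists>n::nat. a [^]\<^bsub>A\<^esub> n \<in> ?I"
  proof (rule ccontr)
    assume "\<not> ?thesis"
    then have "a [^]\<^bsub>A\<^esub> n \<notin> ?I" for n :: nat by blast
    from exists_prime_avoiding_powers[OF I a this] obtain P
      where P: "primeideal P A" "?I \<subseteq> P" "a \<notin> P" by blast
    then obtain g where g: "g \<in> F" "P \<in> ?D g" using cover[of P] by (auto simp: Spec_basic_def)
    have "g \<notin> P" using g(2) by (simp add: Spec_basic_def)
    moreover have "g [^]\<^bsub>A\<^esub> N \<otimes>\<^bsub>A\<^esub> t g \<in> P" using mem[OF g(1)] P(2) by blast
    ultimately show False
      using primeD(3)[OF P(1) _ bc(2)[OF g(1)], of "g [^]\<^bsub>A\<^esub> N"] primeD(4)[OF P(1) bc(3)[OF g(1)]]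
        num(1)[OF g] bc(3)[OF g(1)] by auto
  qed
  then show ?thesis by auto
qed


subsection \<open>Affine open sets\<close>

lemma ringed_spaceD:
  assumes "ringed_space X"
  shows "\<And>U. openin (space_of X) U \<Longrightarrow> cring (sections X U)"
    and "\<And>U V. \<lbrakk>openin (space_of X) U; openin (space_of X) V; V \<subseteq> U\<rbrakk>
      \<Longrightarrow> res X U V \<in> ring_hom (sections X U) (sections X V)"
    and "\<And>U s. \<lbrakk>openin (space_of X) U; s \<in> carrier (sections X U)\<rbrakk> \<Longrightarrow> res X U U s = s"
    and "\<And>U V W s. \<lbrakk>openin (space_of X) U; openin (space_of X) V; openin (space_of X) W;
      W \<subseteq> V; V \<subseteq> U; s \<in> carrier (sections X U)\<rbrakk> \<Longrightarrow> res X V W (res X U V s) = res X U W s"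
proof -
  have *: "(\<forall>U. openin (space_of X) U \<longrightarrow> cring (sections X U))
  \<and> (\<forall>U V. openin (space_of X) U \<and> openin (space_of X) V \<and> V \<subseteq> U \<longrightarrow>
        res X U V \<in> ring_hom (sections X U) (sections X V))
  \<and> (\<forall>U. openin (space_of X) U \<longrightarrow> (\<forall>s \<in> carrier (sections X U). res X U U s = s))
  \<and> (\<forall>U V W. openin (space_of X) U \<and> openin (space_of X) V \<and> openin (space_of X) W
        \<and> W \<subseteq> V \<and> V \<subseteq> U \<longrightarrow>
        (\<forall>s \<in> carrier (sections X U). res X V W (res X U V s) = res X U W s))"
    using assms unfolding ringed_space_def by (elim conjE) (intro conjI)
  show "\<And>U. openin (space_of X) U \<Longrightarrow> cring (sections X U)"
    "\<And>U V. \<lbrakk>openin (space_of X) U; openin (space_of X) V; V \<subseteq> U\<rbrakk>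
      \<Longrightarrow> res X U V \<in> ring_hom (sections X U) (sections X V)"
    "\<And>U s. \<lbrakk>openin (space_of X) U; s \<in> carrier (sections X U)\<rbrakk> \<Longrightarrow> res X U U s = s"
    "\<And>U V W s. \<lbrakk>openin (space_of X) U; openin (space_of X) V; openin (space_of X) W;
      W \<subseteq> V; V \<subseteq> U; s \<in> carrier (sections X U)\<rbrakk> \<Longrightarrow> res X V W (res X U V s) = res X U W s"
    using * by simp_all
qed

text \<open>Locally a times b/t is (a b)/t. The lemma is needed for
  \<open>\<rho>_unit_notin\<close>, where injectivity of \<open>\<theta> V\<close> can be used only
  on its carrier.\<close>

lemma Spec_sections_const_mult:
  assumes "cring A" and U: "openin (Spec_topology A) U" and a: "a \<in> carrier A"
    and s: "s \<in> carrier (Spec_sections A U)"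
  shows "Spec_const A U a \<otimes>\<^bsub>Spec_sections A U\<^esub> s \<in> carrier (Spec_sections A U)" (is "?t \<in> _")
proof -
  interpret cring A by fact
  have val: "?t P = fraction A (carrier A - P) (regular_module A) a \<one>\<^bsub>A\<^esub> \<otimes>\<^bsub>loc_at A P\<^esub> s P" if "P \<in> U" for P
    using that by (simp add: Spec_sections_def Spec_const_def)
  have loc: "\<exists>V. openin (Spec_topology A) V \<and> P \<in> V \<and> V \<subseteq> U
      \<and> (\<exists>b\<in>carrier A. \<exists>g\<in>carrier A. \<forall>Q\<in>V. g \<notin> Q
        \<and> ?t Q = fraction A (carrier A - Q) (regular_module A) b g)" if P: "P \<in> U" for P
  proof -
    from s have "\<forall>P\<in>U. \<exists>V. openin (Spec_topology A) V \<and> P \<in> V \<and> V \<subseteq> U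
          \<and> (\<exists>b \<in> carrier A. \<exists>t \<in> carrier A. \<forall>Q \<in> V. t \<notin> Q
              \<and> s Q = fraction A (carrier A - Q) (regular_module A) b t)"
      by (simp add: Spec_sections_def)
    from bspec[OF this P] obtain V b t where V: "openin (Spec_topology A) V" "P \<in> V" "V \<subseteq> U"
      "b \<in> carrier A" "t \<in> carrier A"
      "\<forall>Q\<in>V. t \<notin> Q \<and> s Q = fraction A (carrier A - Q) (regular_module A) b t"
      by auto
    have "t \<notin> Q \<and> ?t Q = fraction A (carrier A - Q) (regular_module A) (a \<otimes>\<^bsub>A\<^esub> b) t" if Q: "Q \<in> V" for Q
    proof -
      interpret stalk A Q by (intro stalk.intro assms(1) openin_Spec_prime[OF V(1) Q])
      have tQ: "t \<in> carrier A - Q" using V(5,6) Q by simp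
      have "?t Q = stalk_frac (a \<otimes>\<^bsub>A\<^esub> b) (\<one>\<^bsub>A\<^esub> \<otimes>\<^bsub>A\<^esub> t)"
        using val[of Q] V(3,6) Q stalk_mult[OF a frac.T.one_closed V(4) tQ] by auto
      then show ?thesis using V(5) tQ by simp
    qed
    moreover have "a \<otimes>\<^bsub>A\<^esub> b \<in> carrier A" using a V(4) by simp
    ultimately show ?thesis using V(1-3,5) by blast
  qed
  have "?t P \<in> carrier (loc_at A P)" if PU: "P \<in> U" for P
  proof -
    interpret stalk A P by (intro stalk.intro assms(1) openin_Spec_prime[OF U PU])
    from loc[OF PU] obtain b g where "b \<in> carrier A" "g \<in> carrier A" "g \<notin> P" "?t P = stalk_frac b g"
      by blast
    then show ?thesis using stalk_frac_in[of b g] by simp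
  qed
  moreover have "?t \<in> extensional U" by (simp add: Spec_sections_def)
  ultimately have "?t \<in> (\<Pi>\<^sub>E P\<in>U. carrier (loc_at A P))" by (simp add: PiE_def)
  moreover have "\<forall>P\<in>U. \<exists>V. openin (Spec_topology A) V \<and> P \<in> V \<and> V \<subseteq> U
      \<and> (\<exists>b\<in>carrier A. \<exists>g\<in>carrier A. \<forall>Q\<in>V. g \<notin> Q
        \<and> ?t Q = fraction A (carrier A - Q) (regular_module A) b g)"
    using loc by (rule ballI)
  moreover have "t \<in> carrier (Spec_sections A U)"
    if "t \<in> (\<Pi>\<^sub>E P\<in>U. carrier (loc_at A P))"
      "\<forall>P\<in>U. \<exists>V. openin (Spec_topology A) V \<and> P \<in> V \<and> V \<subseteq> U
      \<and> (\<exists>b\<in>carrier A. \<exists>g\<in>carrier A. \<forall>Q\<in>V. g \<notin> Q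
        \<and> t Q = fraction A (carrier A - Q) (regular_module A) b g)" for t
    using that by (simp add: Spec_sections_def)
  ultimately show ?thesis by blast
qed

lemma ring_hom_Units:
  assumes "cring R" "cring S" "h \<in> ring_hom R S" "u \<in> Units R"
  shows "h u \<in> Units S"
proof -
  interpret R: cring R by fact
  interpret S: cring S by fact
  have "inv\<^bsub>R\<^esub> u \<otimes>\<^bsub>R\<^esub> u = \<one>\<^bsub>R\<^esub>" using assms(4) by simp
  then have "h (inv\<^bsub>R\<^esub> u) \<otimes>\<^bsub>S\<^esub> h u = \<one>\<^bsub>S\<^esub>"
    using ring_hom_mult[OF assms(3), of "inv\<^bsub>R\<^esub> u" u] ring_hom_one[OF assms(3)] assms(4)
    by (simp add: R.Units_closed)
  moreover have "h (inv\<^bsub>R\<^esub> u) \<in> carrier S" "h u \<in> carrier S"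
    using ring_hom_closed[OF assms(3)] assms(4) by (auto simp: R.Units_closed)
  ultimately show ?thesis unfolding Units_def by (auto simp: S.m_comm intro!: bexI[of _ "h (inv\<^bsub>R\<^esub> u)"])
qed

lemma basic_open_subset: "basic_open X U f \<subseteq> U"
  by (auto simp: basic_open_def)

lemma basic_open_openin: "openin (space_of X) (basic_open X U f)"
proof -
  have "basic_open X U f = \<Union>{W. openin (space_of X) W \<and> W \<subseteq> U \<and> res X U W f \<in> Units (sections X W)}"
    by (auto simp: basic_open_def)
  then show ?thesis by (auto intro: openin_Union)
qed

section \<open>Charts: an affine open set identified with Spec A\<close>

locale affine_chart =
  fixes X :: "('a, 'r) ringed_space" and U :: "'a set" and A :: "'r ring"
    and \<phi> :: "'a \<Rightarrow> 'r set" and \<theta> :: "'r set set \<Rightarrow> ('r set \<Rightarrow> ('r \<times> 'r) set) \<Rightarrow> 'r"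
  assumes X: "ringed_space X" and U: "openin (space_of X) U" and A: "cring A"
    and homeo: "homeomorphic_map (subtopology (space_of X) U) (Spec_topology A) \<phi>"
    and iso: "\<And>V. openin (Spec_topology A) V \<Longrightarrow>
      \<theta> V \<in> ring_iso (Spec_sections A V) (sections X {x \<in> U. \<phi> x \<in> V})"
    and compat: "\<And>V W s. \<lbrakk>openin (Spec_topology A) V; openin (Spec_topology A) W; W \<subseteq> V;
      s \<in> carrier (Spec_sections A V)\<rbrakk> \<Longrightarrow>
      res X {x \<in> U. \<phi> x \<in> V} {x \<in> U. \<phi> x \<in> W} (\<theta> V s) = \<theta> W (restrict s W)"
begin

definition pre :: "'r set set \<Rightarrow> 'a set" where "pre V = {x \<in> U. \<phi> x \<in> V}"

abbreviation "OX \<equiv> sections X"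
abbreviation "R \<equiv> sections X U"

sublocale A: cring A by (rule A)

lemma topspace_U: "topspace (subtopology (space_of X) U) = U"
  using openin_subset[OF U] by auto

lemma pre_open: "openin (Spec_topology A) V \<Longrightarrow> openin (space_of X) (pre V)"
proof -
  assume "openin (Spec_topology A) V"
  then have "openin (subtopology (space_of X) U) {x \<in> topspace (subtopology (space_of X) U). \<phi> x \<in> V}"
    using homeomorphic_imp_continuous_map[OF homeo] by (simp add: continuous_map_def)
  then show ?thesis using U unfolding topspace_U pre_def by (simp add: openin_open_subtopology)
qed

lemma open_is_pre:
  assumes "openin (space_of X) W" "W \<subseteq> U"
  shows "openin (Spec_topology A) (\<phi> ` W)" "pre (\<phi> ` W) = W"
proof -
  have "openin (subtopology (space_of X) U) W" using assms U by (simp add: openin_open_subtopology)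
  then show "openin (Spec_topology A) (\<phi> ` W)"
    using homeomorphic_imp_open_map[OF homeo] by (simp add: open_map_def)
  have "inj_on \<phi> U" using homeomorphic_imp_injective_map[OF homeo] unfolding topspace_U .
  then show "pre (\<phi> ` W) = W" using assms(2) by (auto simp: pre_def inj_on_def)
qed

lemma \<phi>_surj: "\<phi> ` U = topspace (Spec_topology A)"
  using homeomorphic_imp_surjective_map[OF homeo] unfolding topspace_U .

lemma OX_cring: "openin (Spec_topology A) V \<Longrightarrow> cring (OX (pre V))"
  by (intro ringed_spaceD(1)[OF X] pre_open)

lemma \<theta>_hom: "openin (Spec_topology A) V \<Longrightarrow> \<theta> V \<in> ring_hom (Spec_sections A V) (OX (pre V))"
  and \<theta>_bij: "openin (Spec_topology A) V \<Longrightarrow> bij_betw (\<theta> V) (carrier (Spec_sections A V)) (carrier (OX (pre V)))"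
  using iso by (auto simp: ring_iso_def pre_def)

text \<open>The structure map from A to O_X(\<open>pre V\<close>). For V = Spec A it identifies A
  with R = O_X(U), and by \<open>res_\<rho>1\<close> restriction from U corresponds to \<rho>. The
  ring R is studied through A in this way.\<close>

definition \<rho> :: "'r set set \<Rightarrow> 'r \<Rightarrow> 'r" where "\<rho> V a = \<theta> V (Spec_const A V a)"

lemmas const_carrier = Spec_const_carrier[OF A]

lemma res_\<rho>:
  assumes "openin (Spec_topology A) V" "openin (Spec_topology A) W" "W \<subseteq> V" "a \<in> carrier A"
  shows "res X (pre V) (pre W) (\<rho> V a) = \<rho> W a"
proof -
  have "restrict (Spec_const A V a) W = Spec_const A W a"
    using assms(3) by (auto simp: Spec_const_def fun_eq_iff)
  then show ?thesis
    using compat[OF assms(1-3) const_carrier[OF assms(1,4)]] by (simp add: \<rho>_def pre_def)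
qed

lemma stalk: "openin (Spec_topology A) V \<Longrightarrow> P \<in> V \<Longrightarrow> stalk A P"
  by (intro stalk.intro A openin_Spec_prime)

lemma \<rho>_ring_hom:
  assumes V: "openin (Spec_topology A) V"
  shows "\<rho> V \<in> ring_hom A (OX (pre V))"
proof (rule ring_hom_memI)
  note hom = \<theta>_hom[OF V]
  show "\<rho> V a \<in> carrier (OX (pre V))" if "a \<in> carrier A" for a
    unfolding \<rho>_def by (rule ring_hom_closed[OF hom const_carrier[OF V that]])
  show "\<rho> V (a \<otimes>\<^bsub>A\<^esub> b) = \<rho> V a \<otimes>\<^bsub>OX (pre V)\<^esub> \<rho> V b" if ab: "a \<in> carrier A" "b \<in> carrier A" for a b
  proof -
    have "Spec_const A V (a \<otimes>\<^bsub>A\<^esub> b) = Spec_const A V a \<otimes>\<^bsub>Spec_sections A V\<^esub> Spec_const A V b"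
      using ab stalk.stalk_mult[OF stalk[OF V] ab(1) _ ab(2), of _ "\<one>\<^bsub>A\<^esub>" "\<one>\<^bsub>A\<^esub>"]
        A.primeD(2)[OF openin_Spec_prime[OF V]]
      by (auto simp: Spec_const_def Spec_sections_def fun_eq_iff)
    then show ?thesis
      unfolding \<rho>_def using ring_hom_mult[OF hom const_carrier[OF V ab(1)] const_carrier[OF V ab(2)]] by simp
  qed
  show "\<rho> V (a \<oplus>\<^bsub>A\<^esub> b) = \<rho> V a \<oplus>\<^bsub>OX (pre V)\<^esub> \<rho> V b" if ab: "a \<in> carrier A" "b \<in> carrier A" for a b
  proof -
    have "Spec_const A V (a \<oplus>\<^bsub>A\<^esub> b) = Spec_const A V a \<oplus>\<^bsub>Spec_sections A V\<^esub> Spec_const A V b"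
      using stalk.stalk_add_one[OF stalk[OF V] ab]
      by (auto simp: Spec_const_def Spec_sections_def fun_eq_iff)
    then show ?thesis
      unfolding \<rho>_def using ring_hom_add[OF hom const_carrier[OF V ab(1)] const_carrier[OF V ab(2)]] by simp
  qed
  have "Spec_const A V \<one>\<^bsub>A\<^esub> = \<one>\<^bsub>Spec_sections A V\<^esub>"
    using stalk.stalk_one[OF stalk[OF V]] by (auto simp: Spec_const_def Spec_sections_def fun_eq_iff)
  then show "\<rho> V \<one>\<^bsub>A\<^esub> = \<one>\<^bsub>OX (pre V)\<^esub>" unfolding \<rho>_def using ring_hom_one[OF hom] by simp
qed

text \<open>Together with \<open>\<rho>_surjD\<close> and \<open>\<rho>_unit\<close> this says that
  the ring over D(a) is the localization of A at the powers of a.\<close>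

lemma \<rho>_eqD:
  assumes a: "a \<in> carrier A" and bc: "b \<in> carrier A" "c \<in> carrier A"
    and eq: "\<rho> (Spec_basic A a) b = \<rho> (Spec_basic A a) c"
  shows "\<exists>n::nat. a [^]\<^bsub>A\<^esub> n \<otimes>\<^bsub>A\<^esub> b = a [^]\<^bsub>A\<^esub> n \<otimes>\<^bsub>A\<^esub> c"
proof (rule Spec_const_eqD[OF A a bc])
  note V = openin_Spec_basic[OF a]
  have "Spec_const A (Spec_basic A a) b = Spec_const A (Spec_basic A a) c"
    using bij_betw_imp_inj_on[OF \<theta>_bij[OF V]] eq const_carrier[OF V] bc unfolding \<rho>_def
    by (auto dest: inj_onD)
  then have eq': "Spec_const A (Spec_basic A a) b P = Spec_const A (Spec_basic A a) c P" for P by simp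
  show "fraction A (carrier A - P) (regular_module A) b \<one>\<^bsub>A\<^esub> = fraction A (carrier A - P) (regular_module A) c \<one>\<^bsub>A\<^esub>"
    if "P \<in> Spec_basic A a" for P
    using eq'[of P] that by (simp add: Spec_const_def)
qed

lemma \<rho>_surjD:
  assumes a: "a \<in> carrier A" and s: "s \<in> carrier (OX (pre (Spec_basic A a)))"
  shows "\<exists>n::nat. \<exists>c\<in>carrier A. \<rho> (Spec_basic A a) (a [^]\<^bsub>A\<^esub> n) \<otimes>\<^bsub>OX (pre (Spec_basic A a))\<^esub> s = \<rho> (Spec_basic A a) c"
proof -
  let ?V = "Spec_basic A a"
  note V = openin_Spec_basic[OF a]
  obtain \<sigma> where \<sigma>: "\<sigma> \<in> carrier (Spec_sections A ?V)" "s = \<theta> ?V \<sigma>"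
    using \<theta>_bij[OF V] s by (auto simp: bij_betw_def)
  obtain n :: nat and c where nc: "c \<in> carrier A"
    "\<And>P. P \<in> ?V \<Longrightarrow> stalk.has_numerator A P (\<sigma> P) (a [^]\<^bsub>A\<^esub> n) c"
    using Spec_section_numerator[OF A a \<sigma>(1)] by auto
  have "Spec_const A ?V (a [^]\<^bsub>A\<^esub> n) \<otimes>\<^bsub>Spec_sections A ?V\<^esub> \<sigma> = Spec_const A ?V c"
    using nc(2) stalk.has_numerator_def[OF stalk[OF V]]
    by (auto simp: Spec_sections_def Spec_const_def fun_eq_iff)
  moreover have "a [^]\<^bsub>A\<^esub> n \<in> carrier A" using a by simp
  ultimately show ?thesis
    using ring_hom_mult[OF \<theta>_hom[OF V] const_carrier[OF V, of "a [^]\<^bsub>A\<^esub> n"] \<sigma>(1)] nc(1)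
    unfolding \<rho>_def \<sigma>(2) by (intro exI[of _ n] bexI[of _ c]) auto
qed

lemma pre_one: "pre (Spec_basic A \<one>\<^bsub>A\<^esub>) = U"
  unfolding Spec_basic_one[OF A] using \<phi>_surj by (auto simp: pre_def)

abbreviation "\<rho>1 \<equiv> \<rho> (Spec_basic A \<one>\<^bsub>A\<^esub>)"

lemma one_open: "openin (Spec_topology A) (Spec_basic A \<one>\<^bsub>A\<^esub>)"
  by (rule openin_Spec_basic) simp

lemma R_cring: "cring R"
  by (rule ringed_spaceD(1)[OF X U])

lemma \<rho>1_hom: "\<rho>1 \<in> ring_hom A R"
  using \<rho>_ring_hom[OF one_open] by (simp add: pre_one)

text \<open>The case a = 1 of \<open>\<rho>_surjD\<close>: the denominator is a power of 1.\<close>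

lemma \<rho>1_surj: "r \<in> carrier R \<Longrightarrow> \<exists>a\<in>carrier A. r = \<rho>1 a"
proof -
  interpret R: cring R by (rule R_cring)
  assume r: "r \<in> carrier R"
  then obtain n :: nat and c where "c \<in> carrier A" "\<rho>1 (\<one>\<^bsub>A\<^esub> [^]\<^bsub>A\<^esub> n) \<otimes>\<^bsub>R\<^esub> r = \<rho>1 c"
    using \<rho>_surjD[of "\<one>\<^bsub>A\<^esub>" r] by (auto simp: pre_one)
  then show ?thesis using ring_hom_one[OF \<rho>1_hom] r by (intro bexI[of _ c]) auto
qed

lemma open_subset_one: "openin (Spec_topology A) V \<Longrightarrow> V \<subseteq> Spec_basic A \<one>\<^bsub>A\<^esub>"
  unfolding Spec_basic_one[OF A] by (rule openin_subset)

lemma res_\<rho>1: "\<lbrakk>openin (Spec_topology A) V; a \<in> carrier A\<rbrakk> \<Longrightarrow> res X U (pre V) (\<rho>1 a) = \<rho> V a"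
  using res_\<rho>[OF one_open _ open_subset_one] by (simp add: pre_one)

text \<open>The inverse is the section 1/a.\<close>

lemma \<rho>_unit:
  assumes a: "a \<in> carrier A"
  shows "\<rho> (Spec_basic A a) a \<in> Units (OX (pre (Spec_basic A a)))"
proof -
  let ?V = "Spec_basic A a"
  note V = openin_Spec_basic[OF a]
  interpret C: cring "OX (pre ?V)" by (rule OX_cring[OF V])
  define \<sigma> where "\<sigma> = (\<lambda>P\<in>?V. fraction A (carrier A - P) (regular_module A) \<one>\<^bsub>A\<^esub> a)"
  have \<sigma>: "\<sigma> \<in> carrier (Spec_sections A ?V)"
    unfolding \<sigma>_def by (rule Spec_section_fraction[OF A V]) (use a in \<open>auto simp: Spec_basic_def\<close>)
  have "Spec_const A ?V a \<otimes>\<^bsub>Spec_sections A ?V\<^esub> \<sigma> = Spec_const A ?V \<one>\<^bsub>A\<^esub>"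
  proof -
    have "fraction A (carrier A - P) (regular_module A) a \<one>\<^bsub>A\<^esub> \<otimes>\<^bsub>loc_at A P\<^esub> \<sigma> P
        = fraction A (carrier A - P) (regular_module A) \<one>\<^bsub>A\<^esub> \<one>\<^bsub>A\<^esub>" if PV: "P \<in> ?V" for P
    proof -
      interpret stalk A P by (rule stalk[OF V PV])
      have aP: "a \<in> carrier A - P" using PV a by (simp add: Spec_basic_def)
      have "\<sigma> P = stalk_frac \<one>\<^bsub>A\<^esub> a" using PV by (simp add: \<sigma>_def)
      from numerator_denominator[OF Spec_section_value[OF \<sigma> PV] this _ aP]
      show ?thesis by (simp add: has_numerator_def)
    qed
    then show ?thesis by (auto simp: Spec_sections_def Spec_const_def fun_eq_iff)
  qed
  then have "\<rho> ?V a \<otimes>\<^bsub>OX (pre ?V)\<^esub> \<theta> ?V \<sigma> = \<one>\<^bsub>OX (pre ?V)\<^esub>"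
    using ring_hom_mult[OF \<theta>_hom[OF V] const_carrier[OF V a] \<sigma>] ring_hom_one[OF \<rho>_ring_hom[OF V]]
    by (simp add: \<rho>_def)
  moreover have "\<rho> ?V a \<in> carrier (OX (pre ?V))" by (rule ring_hom_closed[OF \<rho>_ring_hom[OF V] a])
  moreover have "\<theta> ?V \<sigma> \<in> carrier (OX (pre ?V))" by (rule ring_hom_closed[OF \<theta>_hom[OF V] \<sigma>])
  ultimately show ?thesis unfolding Units_def by (auto simp: C.m_comm intro!: bexI[of _ "\<theta> ?V \<sigma>"])
qed

text \<open>An inverse section \<sigma> satisfies a \<sigma> = 1 in the local ring at P, which
  excludes a from P.\<close>

lemma \<rho>_unit_notin:
  assumes a: "a \<in> carrier A" and V: "openin (Spec_topology A) V" and u: "\<rho> V a \<in> Units (OX (pre V))"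
    and PV: "P \<in> V"
  shows "a \<notin> P"
proof -
  interpret C: cring "OX (pre V)" by (rule OX_cring[OF V])
  obtain y where y: "y \<in> carrier (OX (pre V))" "\<rho> V a \<otimes>\<^bsub>OX (pre V)\<^esub> y = \<one>\<^bsub>OX (pre V)\<^esub>"
    using u by (auto simp: Units_def)
  obtain \<sigma> where \<sigma>: "\<sigma> \<in> carrier (Spec_sections A V)" "y = \<theta> V \<sigma>"
    using \<theta>_bij[OF V] y(1) by (auto simp: bij_betw_def)
  interpret stalk A P by (rule stalk[OF V PV])
  have prod: "Spec_const A V a \<otimes>\<^bsub>Spec_sections A V\<^esub> \<sigma> \<in> carrier (Spec_sections A V)"
    by (rule Spec_sections_const_mult[OF A V a \<sigma>(1)])
  have "\<theta> V (Spec_const A V a \<otimes>\<^bsub>Spec_sections A V\<^esub> \<sigma>) = \<theta> V (Spec_const A V \<one>\<^bsub>A\<^esub>)"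
    using y(2) ring_hom_mult[OF \<theta>_hom[OF V] const_carrier[OF V a] \<sigma>(1)] ring_hom_one[OF \<rho>_ring_hom[OF V]]
    by (simp add: \<rho>_def \<sigma>(2))
  then have "Spec_const A V a \<otimes>\<^bsub>Spec_sections A V\<^esub> \<sigma> = Spec_const A V \<one>\<^bsub>A\<^esub>"
    using bij_betw_imp_inj_on[OF \<theta>_bij[OF V]] prod const_carrier[OF V] by (auto dest: inj_onD)
  then have "(Spec_const A V a \<otimes>\<^bsub>Spec_sections A V\<^esub> \<sigma>) P = Spec_const A V \<one>\<^bsub>A\<^esub> P" by simp
  then have "has_numerator (\<sigma> P) a \<one>\<^bsub>A\<^esub>"
    using PV by (simp add: Spec_sections_def Spec_const_def has_numerator_def)
  then show ?thesis using numerator_unit[OF Spec_section_value[OF \<sigma>(1) PV] a] by simp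
qed

text \<open>\<open>basic_open\<close> is defined without a chart, as the locus where the section is
  locally a unit. It agrees with D(a) because a unit near a point lies outside the corresponding
  prime, and a is a unit on D(a).\<close>

lemma basic_open_\<rho>1:
  assumes a: "a \<in> carrier A"
  shows "basic_open X U (\<rho>1 a) = pre (Spec_basic A a)"
proof
  show "basic_open X U (\<rho>1 a) \<subseteq> pre (Spec_basic A a)"
  proof
    fix x assume "x \<in> basic_open X U (\<rho>1 a)"
    then obtain W where W: "x \<in> U" "openin (space_of X) W" "x \<in> W" "W \<subseteq> U"
      "res X U W (\<rho>1 a) \<in> Units (OX W)" by (auto simp: basic_open_def)
    note V = open_is_pre[OF W(2,4)]
    have "\<rho> (\<phi> ` W) a \<in> Units (OX (pre (\<phi> ` W)))"
      using W(5) res_\<rho>1[OF V(1) a] V(2) by simp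
    then have "a \<notin> \<phi> x" using \<rho>_unit_notin[OF a V(1)] W(3) by auto
    then show "x \<in> pre (Spec_basic A a)"
      using W(1,3) openin_Spec_prime[OF V(1)] by (auto simp: pre_def Spec_basic_def)
  qed
  note V = openin_Spec_basic[OF a]
  show "pre (Spec_basic A a) \<subseteq> basic_open X U (\<rho>1 a)"
    using \<rho>_unit[OF a] pre_open[OF V] res_\<rho>1[OF V a] unfolding basic_open_def
    by (auto simp: pre_def intro!: exI[of _ "pre (Spec_basic A a)"])
qed

text \<open>The facts about \<rho> give this for A in place of R. Since \<rho>1 maps A onto R and
  carries the powers of a to those of f, numerators and torsion relations found in A can be mapped
  to R.\<close>

lemma basic_open_localization:
  assumes f: "f \<in> carrier R"
  shows "ring_loc_units R (OX (basic_open X U f)) (res X U (basic_open X U f)) (powers R f)"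
proof -
  interpret R: cring R by (rule R_cring)
  obtain a where a: "a \<in> carrier A" "f = \<rho>1 a" using \<rho>1_surj[OF f] by auto
  let ?V = "Spec_basic A a"
  note V = openin_Spec_basic[OF a(1)]
  note pw = ring_hom_nat_pow[OF A R_cring \<rho>1_hom a(1)]
  have eq: "basic_open X U f = pre ?V" unfolding a(2) by (rule basic_open_\<rho>1[OF a(1)])
  let ?S = "OX (pre ?V)" and ?h = "res X U (pre ?V)"
  interpret S: cring ?S by (rule OX_cring[OF V])
  have hom: "?h \<in> ring_hom R ?S"
    by (rule ringed_spaceD(2)[OF X U pre_open[OF V]]) (auto simp: pre_def)
  have pf: "f [^]\<^bsub>R\<^esub> (n::nat) \<in> powers R f" for n by (auto simp: powers_def)
  have unit: "?h ` powers R f \<subseteq> Units ?S"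
    using \<rho>_unit[OF a(1)] res_\<rho>1[OF V a(1)] ring_hom_nat_pow[OF R_cring S.is_cring hom f]
    by (auto simp: powers_def a(2) S.Units_pow_closed)
  have surj: "\<exists>t\<in>powers R f. \<exists>r\<in>carrier R. ?h t \<otimes>\<^bsub>?S\<^esub> s = ?h r" if s: "s \<in> carrier ?S" for s
  proof -
    obtain n :: nat and c where nc: "c \<in> carrier A" "\<rho> ?V (a [^]\<^bsub>A\<^esub> n) \<otimes>\<^bsub>?S\<^esub> s = \<rho> ?V c"
      using \<rho>_surjD[OF a(1) s] by auto
    have "?h (f [^]\<^bsub>R\<^esub> n) = \<rho> ?V (a [^]\<^bsub>A\<^esub> n)"
      using res_\<rho>1[OF V, of "a [^]\<^bsub>A\<^esub> n"] a pw[of n] by simp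
    then have "?h (f [^]\<^bsub>R\<^esub> n) \<otimes>\<^bsub>?S\<^esub> s = ?h (\<rho>1 c)" using nc res_\<rho>1[OF V nc(1)] by simp
    then show ?thesis using pf ring_hom_closed[OF \<rho>1_hom nc(1)] by blast
  qed
  have ker: "\<exists>t\<in>powers R f. t \<otimes>\<^bsub>R\<^esub> r = \<zero>\<^bsub>R\<^esub>" if r: "r \<in> carrier R" "?h r = \<zero>\<^bsub>?S\<^esub>" for r
  proof -
    obtain b where b: "b \<in> carrier A" "r = \<rho>1 b" using \<rho>1_surj[OF r(1)] by auto
    have z: "\<rho>1 \<zero>\<^bsub>A\<^esub> = \<zero>\<^bsub>R\<^esub>" using ring_hom_zero[OF \<rho>1_hom] A.ring_axioms R.ring_axioms by simp
    have "\<rho> ?V b = \<rho> ?V \<zero>\<^bsub>A\<^esub>"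
      using r(2) res_\<rho>1[OF V b(1)] b(2) ring_hom_zero[OF \<rho>_ring_hom[OF V]] A.ring_axioms S.ring_axioms by simp
    then obtain n :: nat where "a [^]\<^bsub>A\<^esub> n \<otimes>\<^bsub>A\<^esub> b = a [^]\<^bsub>A\<^esub> n \<otimes>\<^bsub>A\<^esub> \<zero>\<^bsub>A\<^esub>"
      using \<rho>_eqD[OF a(1) b(1)] by auto
    then have "\<rho>1 (a [^]\<^bsub>A\<^esub> n \<otimes>\<^bsub>A\<^esub> b) = \<zero>\<^bsub>R\<^esub>" using a(1) z by simp
    then have "f [^]\<^bsub>R\<^esub> n \<otimes>\<^bsub>R\<^esub> r = \<zero>\<^bsub>R\<^esub>"
      using ring_hom_mult[OF \<rho>1_hom _ b(1), of "a [^]\<^bsub>A\<^esub> n"] a b(2) pw[of n] by simp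
    then show ?thesis using pf by blast
  qed
  show ?thesis unfolding eq
    by (intro ring_loc_units.intro ring_loc.intro ring_loc_units_axioms.intro unit)
      (use hom surj ker powers_submonoid[OF R_cring f] R_cring S.is_cring in \<open>auto simp: ring_localization_def\<close>)
qed

lemma basic_open_base:
  assumes "openin (space_of X) W" "W \<subseteq> U" "x \<in> W"
  shows "\<exists>f \<in> carrier R. x \<in> basic_open X U f \<and> basic_open X U f \<subseteq> W"
proof -
  note V = open_is_pre[OF assms(1,2)]
  obtain a where a: "a \<in> carrier A" "\<phi> x \<in> Spec_basic A a" "Spec_basic A a \<subseteq> \<phi> ` W"
    using Spec_basic_base[OF V(1), of "\<phi> x"] assms(3) by auto
  have "pre (Spec_basic A a) \<subseteq> W" using a(3) V(2) by (auto simp: pre_def)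
  moreover have "x \<in> pre (Spec_basic A a)" using a(2) assms by (auto simp: pre_def)
  ultimately show ?thesis
    using basic_open_\<rho>1[OF a(1)] ring_hom_closed[OF \<rho>1_hom a(1)] by (intro bexI[of _ "\<rho>1 a"]) auto
qed

text \<open>The D(a), for all lifts a of members of F, cover Spec A. Hence the lifts generate 1 in
  A, and \<rho>1 carries this to R.\<close>

lemma basic_open_cover:
  assumes F: "F \<subseteq> carrier R" and cover: "U \<subseteq> (\<Union>f\<in>F. basic_open X U f)"
  shows "\<one>\<^bsub>R\<^esub> \<in> Idl\<^bsub>R\<^esub> F"
proof -
  interpret R: cring R by (rule R_cring)
  let ?G = "{a \<in> carrier A. \<rho>1 a \<in> F}"
  have "Spec_basic A \<one>\<^bsub>A\<^esub> \<subseteq> \<Union>(Spec_basic A ` ?G)"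
  proof
    fix P assume "P \<in> Spec_basic A \<one>\<^bsub>A\<^esub>"
    then obtain x where x: "x \<in> U" "P = \<phi> x" unfolding Spec_basic_one[OF A] \<phi>_surj[symmetric] by auto
    then obtain f where f: "f \<in> F" "x \<in> basic_open X U f" using cover by auto
    then obtain a where a: "a \<in> carrier A" "f = \<rho>1 a" using \<rho>1_surj F by blast
    then have "P \<in> Spec_basic A a" using f(2) basic_open_\<rho>1[OF a(1)] x(2) by (auto simp: pre_def)
    then show "P \<in> \<Union>(Spec_basic A ` ?G)" using a f(1) by auto
  qed
  then obtain n :: nat where "\<one>\<^bsub>A\<^esub> [^]\<^bsub>A\<^esub> n \<in> Idl\<^bsub>A\<^esub> ?G"
    using Spec_basic_covered[OF A, of "\<one>\<^bsub>A\<^esub>" ?G] by auto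
  then have "\<one>\<^bsub>A\<^esub> \<in> Idl\<^bsub>A\<^esub> ?G" by simp
  moreover have "Idl\<^bsub>A\<^esub> ?G \<subseteq> {a \<in> carrier A. \<rho>1 a \<in> Idl\<^bsub>R\<^esub> F}"
    by (rule A.genideal_minimal[OF ideal_vimage[OF A R_cring \<rho>1_hom R.genideal_ideal[OF F]]])
      (use R.genideal_self[OF F] in auto)
  ultimately show ?thesis using ring_hom_one[OF \<rho>1_hom] by auto
qed

end

lemma affine_open_chart:
  fixes X :: "('a, 'r) ringed_space"
  assumes "ringed_space X" "affine_open X U"
  shows "\<exists>A \<phi> \<theta>. affine_chart X U A \<phi> \<theta>"
proof -
  have U: "openin (space_of X) U" using assms(2) by (simp add: affine_open_def)
  then have top: "topspace (space_of X) \<inter> U = U" using openin_subset[OF U] by auto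
  obtain A :: "'r ring" where A: "cring A" "ringed_iso (restrict_space X U) (Spec A)"
    using assms(2) by (auto simp: affine_open_def)
  then obtain \<phi> \<theta> where "homeomorphic_map (subtopology (space_of X) U) (Spec_topology A) \<phi>"
    "\<forall>V. openin (Spec_topology A) V \<longrightarrow> \<theta> V \<in> ring_iso (Spec_sections A V) (sections X {x \<in> U. \<phi> x \<in> V})"
    "\<forall>V W. openin (Spec_topology A) V \<and> openin (Spec_topology A) W \<and> W \<subseteq> V \<longrightarrow>
      (\<forall>s \<in> carrier (Spec_sections A V). res X {x \<in> U. \<phi> x \<in> V} {x \<in> U. \<phi> x \<in> W} (\<theta> V s) = \<theta> W (restrict s W))"
    unfolding ringed_iso_def restrict_space_def Spec_def Let_def by (auto simp: top)
  then show ?thesis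
    using A(1) U assms(1) by (intro exI[of _ A] exI[of _ \<phi>] exI[of _ \<theta>] affine_chart.intro) auto
qed

lemma affine_basic_open_localization:
  assumes "ringed_space X" "affine_open X U" "f \<in> carrier (sections X U)"
  shows "ring_loc_units (sections X U) (sections X (basic_open X U f)) (res X U (basic_open X U f))
    (powers (sections X U) f)"
proof -
  from affine_open_chart[OF assms(1,2)] obtain A \<phi> \<theta> where "affine_chart X U A \<phi> \<theta>" by (elim exE)
  from affine_chart.basic_open_localization[OF this assms(3)] show ?thesis .
qed

lemma affine_basic_open_base:
  assumes "ringed_space X" "affine_open X U" "openin (space_of X) W" "W \<subseteq> U" "x \<in> W"
  shows "\<exists>f \<in> carrier (sections X U). x \<in> basic_open X U f \<and> basic_open X U f \<subseteq> W"
proof -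
  from affine_open_chart[OF assms(1,2)] obtain A \<phi> \<theta> where "affine_chart X U A \<phi> \<theta>" by (elim exE)
  from affine_chart.basic_open_base[OF this assms(3,4,5)] show ?thesis .
qed

lemma affine_basic_open_cover:
  assumes "ringed_space X" "affine_open X U" "F \<subseteq> carrier (sections X U)"
    and "U \<subseteq> (\<Union>f\<in>F. basic_open X U f)"
  shows "\<one>\<^bsub>sections X U\<^esub> \<in> Idl\<^bsub>sections X U\<^esub> F"
proof -
  from affine_open_chart[OF assms(1,2)] obtain A \<phi> \<theta> where "affine_chart X U A \<phi> \<theta>" by (elim exE)
  from affine_chart.basic_open_cover[OF this assms(3,4)] show ?thesis .
qed


section \<open>Basic open sets under restriction and multiplication\<close>

lemma basic_open_restrict:
  assumes X: "ringed_space X" and U: "openin (space_of X) U" and V: "openin (space_of X) V" "V \<subseteq> U"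
    and f: "f \<in> carrier (sections X U)"
  shows "basic_open X V (res X U V f) = basic_open X U f \<inter> V"
proof (intro equalityI subsetI)
  fix x assume "x \<in> basic_open X V (res X U V f)"
  then obtain W where W: "x \<in> V" "openin (space_of X) W" "x \<in> W" "W \<subseteq> V"
    "res X V W (res X U V f) \<in> Units (sections X W)" by (auto simp: basic_open_def)
  then have "res X U W f \<in> Units (sections X W)" using ringed_spaceD(4)[OF X U V(1) W(2,4) V(2) f] by simp
  then show "x \<in> basic_open X U f \<inter> V" using W V(2) unfolding basic_open_def by auto
next
  fix x assume "x \<in> basic_open X U f \<inter> V"
  then obtain W where W: "x \<in> V" "openin (space_of X) W" "x \<in> W" "W \<subseteq> U"
    "res X U W f \<in> Units (sections X W)" by (auto simp: basic_open_def)
  let ?W = "W \<inter> V"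
  have W': "openin (space_of X) ?W" "?W \<subseteq> V" "?W \<subseteq> W" using W(2) V(1) by auto
  have "res X W ?W (res X U W f) \<in> Units (sections X ?W)"
    by (rule ring_hom_Units[OF ringed_spaceD(1)[OF X W(2)] ringed_spaceD(1)[OF X W'(1)]
          ringed_spaceD(2)[OF X W(2) W'(1,3)] W(5)])
  then have "res X V ?W (res X U V f) \<in> Units (sections X ?W)"
    using ringed_spaceD(4)[OF X U W(2) W'(1,3) W(4) f] ringed_spaceD(4)[OF X U V(1) W'(1,2) V(2) f] by simp
  then show "x \<in> basic_open X V (res X U V f)" using W W' unfolding basic_open_def by auto
qed

lemma basic_open_mult:
  assumes X: "ringed_space X" and U: "openin (space_of X) U"
    and f: "f \<in> carrier (sections X U)" and g: "g \<in> carrier (sections X U)"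
  shows "basic_open X U (f \<otimes>\<^bsub>sections X U\<^esub> g) = basic_open X U f \<inter> basic_open X U g"
proof (intro equalityI subsetI)
  fix x assume "x \<in> basic_open X U (f \<otimes>\<^bsub>sections X U\<^esub> g)"
  then obtain W where W: "x \<in> U" "openin (space_of X) W" "x \<in> W" "W \<subseteq> U"
    "res X U W (f \<otimes>\<^bsub>sections X U\<^esub> g) \<in> Units (sections X W)" by (auto simp: basic_open_def)
  interpret C: cring "sections X W" by (rule ringed_spaceD(1)[OF X W(2)])
  note hom = ringed_spaceD(2)[OF X U W(2,4)]
  have c: "res X U W f \<in> carrier (sections X W)" "res X U W g \<in> carrier (sections X W)"
    using ring_hom_closed[OF hom] f g by auto
  have "res X U W f \<otimes>\<^bsub>sections X W\<^esub> res X U W g \<in> Units (sections X W)"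
    using W(5) ring_hom_mult[OF hom f g] by simp
  then have "res X U W f \<in> Units (sections X W)" "res X U W g \<in> Units (sections X W)"
    using C.unit_factor[OF _ c] C.unit_factor[OF _ c(2,1)] C.m_comm[OF c] by auto
  then show "x \<in> basic_open X U f \<inter> basic_open X U g" using W by (auto simp: basic_open_def)
next
  fix x assume "x \<in> basic_open X U f \<inter> basic_open X U g"
  then obtain W where W: "x \<in> U" "openin (space_of X) W" "x \<in> W" "W \<subseteq> U"
    "res X U W f \<in> Units (sections X W)" by (auto simp: basic_open_def)
  obtain W' where W': "openin (space_of X) W'" "x \<in> W'" "W' \<subseteq> U"
    "res X U W' g \<in> Units (sections X W')"
    using \<open>x \<in> basic_open X U f \<inter> basic_open X U g\<close> by (auto simp: basic_open_def)
  let ?W = "W \<inter> W'"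
  have I: "openin (space_of X) ?W" "?W \<subseteq> W" "?W \<subseteq> W'" "?W \<subseteq> U" using W W' by auto
  interpret C: cring "sections X ?W" by (rule ringed_spaceD(1)[OF X I(1)])
  have "res X W ?W (res X U W f) \<in> Units (sections X ?W)"
    by (rule ring_hom_Units[OF ringed_spaceD(1)[OF X W(2)] ringed_spaceD(1)[OF X I(1)]
          ringed_spaceD(2)[OF X W(2) I(1,2)] W(5)])
  moreover have "res X W' ?W (res X U W' g) \<in> Units (sections X ?W)"
    by (rule ring_hom_Units[OF ringed_spaceD(1)[OF X W'(1)] ringed_spaceD(1)[OF X I(1)]
          ringed_spaceD(2)[OF X W'(1) I(1,3)] W'(4)])
  ultimately have "res X U ?W (f \<otimes>\<^bsub>sections X U\<^esub> g) \<in> Units (sections X ?W)"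
    using ringed_spaceD(4)[OF X U W(2) I(1,2) W(4) f] ringed_spaceD(4)[OF X U W'(1) I(1,3) W'(3) g]
      ring_hom_mult[OF ringed_spaceD(2)[OF X U I(1,4)] f g] by auto
  then show "x \<in> basic_open X U (f \<otimes>\<^bsub>sections X U\<^esub> g)"
    using W(1,3) W'(2) I unfolding basic_open_def by auto
qed

lemma basic_open_unit:
  assumes X: "ringed_space X" and U: "openin (space_of X) U" and u: "u \<in> Units (sections X U)"
  shows "basic_open X U u = U"
proof -
  interpret C: cring "sections X U" by (rule ringed_spaceD(1)[OF X U])
  have "res X U U u \<in> Units (sections X U)" using ringed_spaceD(3)[OF X U] u C.Units_closed[OF u] by simp
  then show ?thesis using U by (auto simp: basic_open_def)
qed

text \<open>Here \<open>f\<close> need not be invertible on \<open>V\<close>; therefore \<^const>\<open>ring_localization\<close> does not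
  require the elements of \<open>T\<close> to become units.\<close>

lemma affine_subset_localization:
  assumes X: "ringed_space X" and U: "affine_open X U" and V: "affine_open X V" "V \<subseteq> U"
    and f: "f \<in> carrier (sections X U)" "basic_open X U f \<subseteq> V"
  shows "ring_localization (sections X U) (sections X V) (res X U V) (powers (sections X U) f)"
    and "\<And>J a. \<lbrakk>ideal J (sections X U); a \<in> carrier (sections X V);
      \<exists>t\<in>powers (sections X U) f. \<exists>m\<in>J. res X U (basic_open X U f) t \<otimes>\<^bsub>sections X (basic_open X U f)\<^esub>
        res X V (basic_open X U f) a = res X U (basic_open X U f) m\<rbrakk>
      \<Longrightarrow> \<exists>t\<in>powers (sections X U) f. \<exists>m\<in>J. res X U V t \<otimes>\<^bsub>sections X V\<^esub> a = res X U V m"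
proof -
  let ?R = "sections X U" and ?S = "sections X V" and ?W = "basic_open X U f" and ?T = "powers (sections X U) f"
  let ?h = "res X U V" and ?hU = "res X U (basic_open X U f)" and ?hV = "res X V (basic_open X U f)"
  have Uo: "openin (space_of X) U" and Vo: "openin (space_of X) V"
    using U V by (auto simp: affine_open_def)
  note h = ringed_spaceD(2)[OF X Uo Vo V(2)]
  have g: "?h f \<in> carrier ?S" using ring_hom_closed[OF h f(1)] .
  \<comment> \<open>Lying in V, the set U_f is also the basic open set of V at h f. Its ring is thus
    a localization of O(U) and of O(V), and the two are compared through it.\<close>
  have W: "basic_open X V (?h f) = ?W" using basic_open_restrict[OF X Uo Vo V(2) f(1)] f(2) by auto
  interpret LU: ring_loc_units ?R "sections X ?W" ?hU ?T
    by (rule affine_basic_open_localization[OF X U f(1)])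
  interpret LV: ring_loc_units ?S "sections X ?W" ?hV "powers ?S (?h f)"
    using affine_basic_open_localization[OF X V(1) g] unfolding W .
  interpret H: ring_hom_cring ?R ?S ?h
    by (intro ring_hom_cring.intro ring_hom_cring_axioms.intro LU.R LV.R h)
  have comp: "?hV (?h r) = ?hU r" if "r \<in> carrier ?R" for r
    by (rule ringed_spaceD(4)[OF X Uo Vo basic_open_openin f(2) V(2) that])
  have powers: "\<exists>t\<in>?T. u = ?h t" if "u \<in> powers ?S (?h f)" for u
    using that ring_hom_nat_pow[OF LU.R LV.R h f(1)] by (fastforce simp: powers_def)
  \<comment> \<open>The equation over U_f holds over V after multiplication by a power of h f. That
    power is absorbed into t and m, and m stays in J because J is an ideal.\<close>
  show *: "\<exists>t\<in>?T. \<exists>m\<in>J. ?h t \<otimes>\<^bsub>?S\<^esub> a = ?h m"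
    if J: "ideal J ?R" and a: "a \<in> carrier ?S" and ex: "\<exists>t\<in>?T. \<exists>m\<in>J. ?hU t \<otimes>\<^bsub>sections X ?W\<^esub> ?hV a = ?hU m" for J a
  proof -
    obtain t m where tm: "t \<in> ?T" "m \<in> J" "?hU t \<otimes>\<^bsub>sections X ?W\<^esub> ?hV a = ?hU m" using ex by auto
    have tR: "t \<in> carrier ?R" and mR: "m \<in> carrier ?R"
      using LU.T_in_R[OF tm(1)] tm(2) LU.h.R.idealD(1)[OF J] by auto
    have "?hV (?h t \<otimes>\<^bsub>?S\<^esub> a) = ?hV (?h m)" using tm(3) comp[OF tR] comp[OF mR] tR a by simp
    then obtain u where u: "u \<in> powers ?S (?h f)" "u \<otimes>\<^bsub>?S\<^esub> (?h t \<otimes>\<^bsub>?S\<^esub> a) = u \<otimes>\<^bsub>?S\<^esub> ?h m"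
      using LV.hom_eqD[of "?h t \<otimes>\<^bsub>?S\<^esub> a" "?h m"] tR mR a by auto
    obtain v where v: "v \<in> ?T" "u = ?h v" using powers[OF u(1)] by auto
    have vR: "v \<in> carrier ?R" by (rule LU.T_in_R[OF v(1)])
    have "?h (v \<otimes>\<^bsub>?R\<^esub> t) \<otimes>\<^bsub>?S\<^esub> a = ?h (v \<otimes>\<^bsub>?R\<^esub> m)"
      using u(2) vR tR mR a by (simp add: v(2) LV.h.R.m_assoc)
    moreover have "v \<otimes>\<^bsub>?R\<^esub> m \<in> J" by (rule LU.h.R.idealD(4)[OF J vR tm(2)])
    ultimately show ?thesis using LU.T_closed(1)[OF v(1) tm(1)] by blast
  qed
  show "ring_localization ?R ?S ?h ?T"
    unfolding ring_localization_def
  proof (intro conjI ballI impI LU.R LV.R h LU.T)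
    fix s assume s: "s \<in> carrier ?S"
    then have "\<exists>t\<in>?T. \<exists>m\<in>carrier ?R. ?hU t \<otimes>\<^bsub>sections X ?W\<^esub> ?hV s = ?hU m" by (intro LU.surj) simp
    \<comment> \<open>Surjectivity is the case where J is the unit ideal.\<close>
    from *[OF LU.h.R.oneideal s this] show "\<exists>t\<in>?T. \<exists>r\<in>carrier ?R. ?h t \<otimes>\<^bsub>?S\<^esub> s = ?h r" .
  next
    fix r assume r: "r \<in> carrier ?R" "?h r = \<zero>\<^bsub>?S\<^esub>"
    then have "?hU r = \<zero>\<^bsub>sections X ?W\<^esub>" using comp[OF r(1)] by simp
    then show "\<exists>t\<in>?T. t \<otimes>\<^bsub>?R\<^esub> r = \<zero>\<^bsub>?R\<^esub>" by (rule LU.ker[OF r(1)])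
  qed
qed

text \<open>Surjectivity of J(U)_f -> J(U_f) writes a as the image of some m/t, and t clears the
  denominator. Quasi-coherence enters the closure arguments in this form.\<close>

lemma quasi_coherent_numerator:
  assumes X: "ringed_space X" and J: "quasi_coherent_ideal_sheaf X J" and U: "affine_open X U"
    and f: "f \<in> carrier (sections X U)" and a: "a \<in> J (basic_open X U f)"
  shows "\<exists>t\<in>powers (sections X U) f. \<exists>m\<in>J U.
    res X U (basic_open X U f) t \<otimes>\<^bsub>sections X (basic_open X U f)\<^esub> a = res X U (basic_open X U f) m"
proof -
  let ?R = "sections X U" and ?W = "basic_open X U f" and ?T = "powers (sections X U) f"
  let ?h = "res X U ?W" and ?M = "(regular_module (sections X U))\<lparr>carrier := J U\<rparr>"
  let ?N = "(regular_module (sections X ?W))\<lparr>carrier := J ?W\<rparr>"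
  have Uo: "openin (space_of X) U" using U by (simp add: affine_open_def)
  have R: "cring ?R" by (rule ringed_spaceD(1)[OF X Uo])
  interpret R: cring ?R by (rule R)
  have JU: "ideal (J U) ?R" using J Uo by (simp add: quasi_coherent_ideal_sheaf_def ideal_sheaf_def)
  obtain \<theta> where \<theta>: "\<theta> \<in> mod_iso ?R (loc_module ?R ?T ?M) (restrict_scalars ?h ?N)"
    "\<And>m. m \<in> J U \<Longrightarrow> \<theta> (fraction ?R ?T ?M m \<one>\<^bsub>?R\<^esub>) = ?h m"
    using J U f unfolding quasi_coherent_ideal_sheaf_def Let_def by blast
  have sub: "submodule (J U) ?R (regular_module ?R)"
    by (rule submodule_intro[OF regular_module_module[OF R]])
      (use R.idealD(1-4)[OF JU] in \<open>auto simp: regular_module_simps\<close>)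
  interpret M: fractions ?R ?T ?M
    by (intro fractions.intro submodule.submodule_is_module[OF sub] regular_module_module R powers_submonoid f)
  have "a \<in> carrier (restrict_scalars ?h ?N)" using a by (simp add: restrict_scalars_def)
  moreover have "\<theta> ` carrier M.loc = carrier (restrict_scalars ?h ?N)"
    using \<theta>(1) by (simp add: mod_iso_def bij_betw_def)
  ultimately have "a \<in> \<theta> ` carrier M.loc" by simp
  then obtain x where x: "x \<in> carrier M.loc" "a = \<theta> x" by (rule imageE)
  obtain m t where mt: "m \<in> J U" "t \<in> ?T" "x = M.frc m t" using x(1) by (auto simp: M.loc_carrier)
  have tR: "t \<in> carrier ?R" using mt(2) by simp
  have m: "m \<in> carrier ?M" using mt(1) by simp
  have "t \<odot>\<^bsub>M.loc\<^esub> x = M.frc (t \<odot>\<^bsub>?M\<^esub> m) t" unfolding mt(3) by (rule M.loc_smult[OF tR m mt(2)])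
  also have "\<dots> = M.frc m \<one>\<^bsub>?R\<^esub>" using M.frac_scale[OF m M.T.one_closed mt(2)] tR by simp
  finally have "\<theta> (t \<odot>\<^bsub>M.loc\<^esub> x) = ?h m" using \<theta>(2)[OF mt(1)] by simp
  moreover have "\<theta> (t \<odot>\<^bsub>M.loc\<^esub> x) = ?h t \<otimes>\<^bsub>sections X ?W\<^esub> a"
    using \<theta>(1) tR x by (simp add: mod_iso_def restrict_scalars_def regular_module_def)
  ultimately show ?thesis using mt(1,2) by auto
qed

text \<open>Each point has some Noetherian affine neighbourhood V, unrelated to U. The link is an
  open set that is basic in both: choose U_f inside both U and V, then V_g inside U_f. If a is a
  numerator of g over U_f, then V_g = U_{f a}, because denominators are units on U_f.\<close>

lemma locally_noetherian_affine:
  assumes X: "ringed_space X" and ln: "locally_noetherian X" and U: "affine_open X U"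
  shows "noetherian_ring (sections X U)"
proof -
  let ?R = "sections X U"
  have Uo: "openin (space_of X) U" using U by (simp add: affine_open_def)
  have R: "cring ?R" by (rule ringed_spaceD(1)[OF X Uo])
  interpret R: cring ?R by (rule R)
  let ?F = "{f \<in> carrier ?R. noetherian_ring (sections X (basic_open X U f))}"
  have "U \<subseteq> (\<Union>f\<in>?F. basic_open X U f)"
  proof
    fix x assume x: "x \<in> U"
    then obtain V where V: "x \<in> V" "affine_open X V" "noetherian_ring (sections X V)"
      using ln openin_subset[OF Uo] unfolding locally_noetherian_def by blast
    have Vo: "openin (space_of X) V" using V by (simp add: affine_open_def)
    obtain f where f: "f \<in> carrier ?R" "x \<in> basic_open X U f" "basic_open X U f \<subseteq> U \<inter> V"
      using affine_basic_open_base[OF X U, of "U \<inter> V" x] Uo Vo x V(1) by auto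
    let ?W = "basic_open X U f"
    have Wo: "openin (space_of X) ?W" by (rule basic_open_openin)
    obtain g where g: "g \<in> carrier (sections X V)" "x \<in> basic_open X V g" "basic_open X V g \<subseteq> ?W"
      using affine_basic_open_base[OF X V(2) Wo _ f(2)] f(3) by auto
    interpret L: ring_loc_units ?R "sections X ?W" "res X U ?W" "powers ?R f"
      by (rule affine_basic_open_localization[OF X U f(1)])
    let ?g = "res X V ?W g"
    have WV: "?W \<subseteq> V" using f(3) by auto
    have gc: "?g \<in> carrier (sections X ?W)" using ring_hom_closed[OF ringed_spaceD(2)[OF X Vo Wo WV] g(1)] .
    obtain t a where ta: "t \<in> powers ?R f" "a \<in> carrier ?R" "res X U ?W t \<otimes>\<^bsub>sections X ?W\<^esub> ?g = res X U ?W a"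
      using L.surj[OF gc] by auto
    have tu: "res X U ?W t \<in> Units (sections X ?W)" by (rule L.hT_unit[OF ta(1)])
    have "basic_open X U (f \<otimes>\<^bsub>?R\<^esub> a) = basic_open X ?W (res X U ?W a)"
      using basic_open_mult[OF X Uo f(1) ta(2)] basic_open_restrict[OF X Uo Wo basic_open_subset ta(2)] by auto
    also have "\<dots> = basic_open X ?W ?g"
      unfolding ta(3)[symmetric] basic_open_mult[OF X Wo L.h.S.Units_closed[OF tu] gc] basic_open_unit[OF X Wo tu]
      by (rule Int_absorb1[OF basic_open_subset])
    also have "\<dots> = basic_open X V g" using basic_open_restrict[OF X Vo Wo WV g(1)] g(3) by auto
    finally have eq: "basic_open X U (f \<otimes>\<^bsub>?R\<^esub> a) = basic_open X V g" .
    have "noetherian_ring (sections X (basic_open X V g))"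
      by (rule ring_loc_units.noetherian_localization[OF affine_basic_open_localization[OF X V(2) g(1)] V(3)])
    then show "x \<in> (\<Union>f\<in>?F. basic_open X U f)" using eq g(2) f(1) ta(2)
      by (intro UN_I[of "f \<otimes>\<^bsub>?R\<^esub> a"]) auto
  qed
  then have "\<one>\<^bsub>?R\<^esub> \<in> Idl\<^bsub>?R\<^esub> ?F" by (intro affine_basic_open_cover[OF X U]) auto
  then show ?thesis
    by (intro noetherian_local[OF R, of ?F "\<lambda>f. sections X (basic_open X U f)" "\<lambda>f. res X U (basic_open X U f)"])
      (use affine_basic_open_localization[OF X U] in auto)
qed

subsection \<open>Tight closure\<close>

lemma tight_closure_iff:
  "z \<in> tight_closure p R b M L \<longleftrightarrow> z \<in> carrier M \<and> (\<exists>c \<in> off_minimal_primes R. \<exists>e0. \<forall>e\<ge>1. e0 \<le> e \<longrightarrow>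
    (\<forall>a \<in> b e. frob_mem p e R M L z (c \<otimes>\<^bsub>R\<^esub> a)))"
  by (simp add: tight_closure_def frob_mem_def)

text \<open>The multiplier 1 shows that L is contained in its closure. A sum is handled by the
  product of the two multipliers and the maximum of the two thresholds, and a scalar multiple keeps
  its multiplier by \<open>frob_mem_smult\<close>.\<close>

lemma tight_closure_preclosure:
  assumes M: "module R M" and L: "submodule L R M" and b: "\<And>e. 1 \<le> e \<Longrightarrow> b e \<subseteq> carrier R"
  shows "submodule (tight_closure p R b M L) R M" "L \<subseteq> tight_closure p R b M L"
    and "\<And>L'. \<lbrakk>submodule L' R M; L \<subseteq> L'\<rbrakk> \<Longrightarrow> tight_closure p R b M L \<subseteq> tight_closure p R b M L'"
proof -
  interpret M: module R M by (rule M)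
  note off1 = off_minimal_primes_one[OF M.R.is_cring]
  have offc: "c \<in> carrier R" if "c \<in> off_minimal_primes R" for c using that by (simp add: off_minimal_primes_def)
  show ext: "L \<subseteq> tight_closure p R b M L"
  proof
    fix z assume z: "z \<in> L"
    have "frob_mem p e R M L z (\<one>\<^bsub>R\<^esub> \<otimes>\<^bsub>R\<^esub> a)" if "1 \<le> e" "a \<in> b e" for e a
      by (rule frob_mem_base[OF M L z]) (use b that in auto)
    then show "z \<in> tight_closure p R b M L"
      unfolding tight_closure_iff using off1 z submodule_closed(1)[OF M L] by blast
  qed
  show "tight_closure p R b M L \<subseteq> tight_closure p R b M L'" if L': "submodule L' R M" "L \<subseteq> L'" for L'
    unfolding tight_closure_iff subset_iff using frob_mem_mono[OF M L L'] by blast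
  show "submodule (tight_closure p R b M L) R M"
  proof (rule submodule_intro[OF M])
    show "tight_closure p R b M L \<subseteq> carrier M" by (auto simp: tight_closure_def)
    show "\<zero>\<^bsub>M\<^esub> \<in> tight_closure p R b M L" using ext submodule_closed(2)[OF M L] by auto
  next
    fix z w assume "z \<in> tight_closure p R b M L" "w \<in> tight_closure p R b M L"
    then obtain c e0 d e1 where z: "z \<in> carrier M" "c \<in> off_minimal_primes R"
      "\<And>e a. \<lbrakk>e \<ge> 1; e0 \<le> e; a \<in> b e\<rbrakk> \<Longrightarrow> frob_mem p e R M L z (c \<otimes>\<^bsub>R\<^esub> a)"
      and w: "w \<in> carrier M" "d \<in> off_minimal_primes R"
      "\<And>e a. \<lbrakk>e \<ge> 1; e1 \<le> e; a \<in> b e\<rbrakk> \<Longrightarrow> frob_mem p e R M L w (d \<otimes>\<^bsub>R\<^esub> a)"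
      unfolding tight_closure_iff by metis
    note cd = offc[OF z(2)] offc[OF w(2)]
    have "frob_mem p e R M L (z \<oplus>\<^bsub>M\<^esub> w) ((c \<otimes>\<^bsub>R\<^esub> d) \<otimes>\<^bsub>R\<^esub> a)"
      if e: "e \<ge> 1" "max e0 e1 \<le> e" and a: "a \<in> b e" for e a
    proof -
      have ac: "a \<in> carrier R" using b[OF e(1)] a by auto
      have "frob_mem p e R M L z (d \<otimes>\<^bsub>R\<^esub> (c \<otimes>\<^bsub>R\<^esub> a))"
        by (rule frob_mem_multc[OF M L z(1) z(3)[OF e(1) _ a]]) (use cd ac e in auto)
      moreover have "frob_mem p e R M L w (c \<otimes>\<^bsub>R\<^esub> (d \<otimes>\<^bsub>R\<^esub> a))"
        by (rule frob_mem_multc[OF M L w(1) w(3)[OF e(1) _ a]]) (use cd ac e in auto)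
      moreover have "d \<otimes>\<^bsub>R\<^esub> (c \<otimes>\<^bsub>R\<^esub> a) = (c \<otimes>\<^bsub>R\<^esub> d) \<otimes>\<^bsub>R\<^esub> a" "c \<otimes>\<^bsub>R\<^esub> (d \<otimes>\<^bsub>R\<^esub> a) = (c \<otimes>\<^bsub>R\<^esub> d) \<otimes>\<^bsub>R\<^esub> a"
        using cd ac by (simp_all add: M.R.m_ac)
      ultimately show ?thesis using frob_mem_add[OF M L z(1) w(1)] cd ac by simp
    qed
    then show "z \<oplus>\<^bsub>M\<^esub> w \<in> tight_closure p R b M L"
      unfolding tight_closure_iff using z(1) w(1) off_minimal_primes_mult[OF M.R.is_cring z(2) w(2)]
      by (intro conjI bexI[of _ "c \<otimes>\<^bsub>R\<^esub> d"] exI[of _ "max e0 e1"]) auto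
  next
    fix r z assume r: "r \<in> carrier R" and "z \<in> tight_closure p R b M L"
    then obtain c e0 where z: "z \<in> carrier M" "c \<in> off_minimal_primes R"
      "\<And>e a. \<lbrakk>e \<ge> 1; e0 \<le> e; a \<in> b e\<rbrakk> \<Longrightarrow> frob_mem p e R M L z (c \<otimes>\<^bsub>R\<^esub> a)"
      unfolding tight_closure_iff by metis
    have "frob_mem p e R M L (r \<odot>\<^bsub>M\<^esub> z) (c \<otimes>\<^bsub>R\<^esub> a)" if e: "e \<ge> 1" "e0 \<le> e" and a: "a \<in> b e" for e a
      by (rule frob_mem_smult[OF M L z(1) r _ z(3)[OF e a]]) (use b[OF e(1)] a offc[OF z(2)] in auto)
    then show "r \<odot>\<^bsub>M\<^esub> z \<in> tight_closure p R b M L"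
      unfolding tight_closure_iff using z(1,2) r by (intro conjI bexI[of _ c] exI[of _ e0]) auto
  qed
qed

section \<open>Copies of localized modules\<close>

text \<open>Converts a copy N of the localized module, given only through a bijection \<theta>
  linear over R, into the hypotheses of \<open>frob_mem_push\<close> and
  \<open>frob_mem_pull\<close>.\<close>

lemma localization_at:
  assumes L: "ring_loc_units R S h T" and M: "module R M" and H: "submodule H R M" and N: "module S N"
    and \<theta>: "\<theta> \<in> mod_iso R (loc_module R T M) (restrict_scalars h N)"
  shows "module_localization R h T M N (\<lambda>m. \<theta> (fraction R T M m \<one>\<^bsub>R\<^esub>))"
    and "submodule (\<theta> ` loc_submodule R T M H) S N"
    and "\<And>m. m \<in> H \<Longrightarrow> \<theta> (fraction R T M m \<one>\<^bsub>R\<^esub>) \<in> \<theta> ` loc_submodule R T M H"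
    and "\<And>x. x \<in> \<theta> ` loc_submodule R T M H \<Longrightarrow> \<exists>t\<in>T. \<exists>m\<in>H. h t \<odot>\<^bsub>N\<^esub> x = \<theta> (fraction R T M m \<one>\<^bsub>R\<^esub>)"
proof -
  interpret L: ring_loc_units R S h T by (rule L)
  interpret fr: fractions R T M by (intro fractions.intro M L.T)
  interpret N: module S N by (rule N)
  note Hd = submodule_closed[OF M H]
  have Hc: "m \<in> carrier M" if "m \<in> H" for m using Hd(1) that by auto
  have T1: "\<one>\<^bsub>R\<^esub> \<in> T" by simp
  have bij: "bij_betw \<theta> (carrier fr.loc) (carrier N)"
    and add: "\<And>x y. \<lbrakk>x \<in> carrier fr.loc; y \<in> carrier fr.loc\<rbrakk> \<Longrightarrow> \<theta> (x \<oplus>\<^bsub>fr.loc\<^esub> y) = \<theta> x \<oplus>\<^bsub>N\<^esub> \<theta> y"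
    and sm: "\<And>r x. \<lbrakk>r \<in> carrier R; x \<in> carrier fr.loc\<rbrakk> \<Longrightarrow> \<theta> (r \<odot>\<^bsub>fr.loc\<^esub> x) = h r \<odot>\<^bsub>N\<^esub> \<theta> x"
    using \<theta> by (auto simp: mod_iso_def restrict_scalars_def)
  have \<theta>c: "\<theta> x \<in> carrier N" if "x \<in> carrier fr.loc" for x using bij that by (auto simp: bij_betw_def)
  have clear: "h t \<odot>\<^bsub>N\<^esub> \<theta> (fr.frc m t) = \<theta> (fr.frc m \<one>\<^bsub>R\<^esub>)" if mt: "m \<in> carrier M" "t \<in> T" for m t
  proof -
    have tR: "t \<in> carrier R" by (rule L.T_in_R[OF mt(2)])
    have "h t \<odot>\<^bsub>N\<^esub> \<theta> (fr.frc m t) = \<theta> (fr.frc (t \<odot>\<^bsub>M\<^esub> m) t)"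
      using sm[OF tR fr.frac_in_loc[OF mt]] fr.loc_smult[OF tR mt] by simp
    also have "fr.frc (t \<odot>\<^bsub>M\<^esub> m) t = fr.frc m \<one>\<^bsub>R\<^esub>" using fr.frac_scale[OF mt(1) T1 mt(2)] tR by simp
    finally show ?thesis .
  qed
  let ?H = "\<theta> ` loc_submodule R T M H"
  have HI: "\<theta> (fr.frc m t) \<in> ?H" if "m \<in> H" "t \<in> T" for m t
    using that by (auto simp: loc_submodule_def)
  have HE: "\<exists>m t. m \<in> H \<and> t \<in> T \<and> x = \<theta> (fr.frc m t)" if "x \<in> ?H" for x
    using that by (auto simp: loc_submodule_def)
  show "\<theta> (fr.frc m \<one>\<^bsub>R\<^esub>) \<in> ?H" if "m \<in> H" for m using HI[OF that T1] .
  show "\<exists>t\<in>T. \<exists>m\<in>H. h t \<odot>\<^bsub>N\<^esub> x = \<theta> (fr.frc m \<one>\<^bsub>R\<^esub>)" if x: "x \<in> ?H" for x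
  proof -
    obtain m t where mt: "m \<in> H" "t \<in> T" "x = \<theta> (fr.frc m t)" using HE[OF x] by auto
    show ?thesis
      by (rule bexI[OF _ mt(2)], rule bexI[OF _ mt(1)]) (use clear[OF Hc[OF mt(1)] mt(2)] mt(3) in simp)
  qed
  show "module_localization R h T M N (\<lambda>m. \<theta> (fr.frc m \<one>\<^bsub>R\<^esub>))"
    unfolding module_localization_def semilinear_def
  proof (intro conjI CollectI ballI impI)
    show "(\<lambda>m. \<theta> (fr.frc m \<one>\<^bsub>R\<^esub>)) \<in> carrier M \<rightarrow> carrier N" using \<theta>c fr.frac_in_loc by auto
    show "\<theta> (fr.frc (x \<oplus>\<^bsub>M\<^esub> y) \<one>\<^bsub>R\<^esub>) = \<theta> (fr.frc x \<one>\<^bsub>R\<^esub>) \<oplus>\<^bsub>N\<^esub> \<theta> (fr.frc y \<one>\<^bsub>R\<^esub>)"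
      if "x \<in> carrier M" "y \<in> carrier M" for x y
      using add[OF fr.frac_in_loc[OF that(1) T1] fr.frac_in_loc[OF that(2) T1]]
        fr.loc_add_same_denominator[OF that T1] by simp
    show "\<theta> (fr.frc (r \<odot>\<^bsub>M\<^esub> x) \<one>\<^bsub>R\<^esub>) = h r \<odot>\<^bsub>N\<^esub> \<theta> (fr.frc x \<one>\<^bsub>R\<^esub>)" if "r \<in> carrier R" "x \<in> carrier M" for r x
      using sm[OF that(1) fr.frac_in_loc[OF that(2) T1]] fr.loc_smult[OF that T1] by simp
  next
    fix x assume "x \<in> carrier N"
    then obtain y where "y \<in> carrier fr.loc" "x = \<theta> y" using bij by (auto simp: bij_betw_def)
    then obtain m t where "m \<in> carrier M" "t \<in> T" "x = \<theta> (fr.frc m t)" by (auto simp: fr.loc_carrier)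
    then show "\<exists>t\<in>T. \<exists>m\<in>carrier M. h t \<odot>\<^bsub>N\<^esub> x = \<theta> (fr.frc m \<one>\<^bsub>R\<^esub>)" using clear by blast
  next
    fix m assume m: "m \<in> carrier M" and "\<theta> (fr.frc m \<one>\<^bsub>R\<^esub>) = \<zero>\<^bsub>N\<^esub>"
    \<comment> \<open>\<open>mod_iso\<close> does not mention zero, so 0 is reached through the
      scalar 0.\<close>
    moreover have "\<theta> (fr.frc \<zero>\<^bsub>M\<^esub> \<one>\<^bsub>R\<^esub>) = \<zero>\<^bsub>N\<^esub>"
    proof -
      have z: "fr.frc \<zero>\<^bsub>M\<^esub> \<one>\<^bsub>R\<^esub> \<in> carrier fr.loc" by (rule fr.frac_in_loc) auto
      have "\<zero>\<^bsub>R\<^esub> \<odot>\<^bsub>fr.loc\<^esub> fr.frc \<zero>\<^bsub>M\<^esub> \<one>\<^bsub>R\<^esub> = fr.frc \<zero>\<^bsub>M\<^esub> \<one>\<^bsub>R\<^esub>"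
        using fr.loc_smult[of "\<zero>\<^bsub>R\<^esub>" "\<zero>\<^bsub>M\<^esub>" "\<one>\<^bsub>R\<^esub>"] by simp
      then show ?thesis using sm[of "\<zero>\<^bsub>R\<^esub>", OF _ z] \<theta>c[OF z] by simp
    qed
    ultimately have "\<theta> (fr.frc m \<one>\<^bsub>R\<^esub>) = \<theta> (fr.frc \<zero>\<^bsub>M\<^esub> \<one>\<^bsub>R\<^esub>)" by simp
    then have "fr.frc m \<one>\<^bsub>R\<^esub> = fr.frc \<zero>\<^bsub>M\<^esub> \<one>\<^bsub>R\<^esub>"
      by (rule inj_onD[OF bij_betw_imp_inj_on[OF bij] _ fr.frac_in_loc[OF m T1]
            fr.frac_in_loc[OF fr.M.M.zero_closed T1]])
    then obtain u where "u \<in> T" "u \<odot>\<^bsub>M\<^esub> (\<one>\<^bsub>R\<^esub> \<odot>\<^bsub>M\<^esub> m) = u \<odot>\<^bsub>M\<^esub> (\<one>\<^bsub>R\<^esub> \<odot>\<^bsub>M\<^esub> \<zero>\<^bsub>M\<^esub>)"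
      using fr.frac_eq_iff[OF m T1 fr.M.M.zero_closed T1] by auto
    then show "\<exists>t\<in>T. t \<odot>\<^bsub>M\<^esub> m = \<zero>\<^bsub>M\<^esub>" using m by (intro bexI[of _ u]) auto
  qed
  show "submodule ?H S N"
  proof (rule submodule_intro[OF N])
    have HL: "loc_submodule R T M H \<subseteq> carrier fr.loc"
      using Hc fr.frac_in_loc by (auto simp: loc_submodule_def)
    then show "?H \<subseteq> carrier N" using \<theta>c by auto
    \<comment> \<open>\<theta> is linear over R only. With h v s = h r, the identity s \<theta>(m/t)
      = \<theta>((r m)/(v t)) is verified after multiplication by the unit h (v t).\<close>
    show cl: "s \<odot>\<^bsub>N\<^esub> x \<in> ?H" if s: "s \<in> carrier S" and x: "x \<in> ?H" for s x
    proof -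
      obtain m t where mt: "m \<in> H" "t \<in> T" "x = \<theta> (fr.frc m t)" using HE[OF x] by auto
      obtain v r where vr: "v \<in> T" "r \<in> carrier R" "h v \<otimes>\<^bsub>S\<^esub> s = h r" using L.surj[OF s] by auto
      note c = Hc[OF mt(1)] L.T_in_R[OF vr(1)] L.T_in_R[OF mt(2)]
      have xc: "x \<in> carrier N" unfolding mt(3) by (rule \<theta>c[OF fr.frac_in_loc[OF c(1) mt(2)]])
      have rm: "r \<odot>\<^bsub>M\<^esub> m \<in> H" by (rule Hd(5)[OF vr(2) mt(1)])
      have vt: "v \<otimes>\<^bsub>R\<^esub> t \<in> T" by (rule L.T_closed(1)[OF vr(1) mt(2)])
      have "h (v \<otimes>\<^bsub>R\<^esub> t) \<odot>\<^bsub>N\<^esub> (s \<odot>\<^bsub>N\<^esub> x) = (h v \<otimes>\<^bsub>S\<^esub> s) \<odot>\<^bsub>N\<^esub> (h t \<odot>\<^bsub>N\<^esub> x)"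
        using c s xc by (simp add: N.smult_assoc1[symmetric] L.h.S.m_ac)
      also have "\<dots> = \<theta> (fr.frc (r \<odot>\<^bsub>M\<^esub> m) \<one>\<^bsub>R\<^esub>)"
        unfolding vr(3) mt(3) clear[OF c(1) mt(2)]
        using sm[OF vr(2) fr.frac_in_loc[OF c(1) T1]] fr.loc_smult[OF vr(2) c(1) T1] by simp
      also have "\<dots> = h (v \<otimes>\<^bsub>R\<^esub> t) \<odot>\<^bsub>N\<^esub> \<theta> (fr.frc (r \<odot>\<^bsub>M\<^esub> m) (v \<otimes>\<^bsub>R\<^esub> t))"
        by (rule clear[OF Hc[OF rm] vt, symmetric])
      finally have "s \<odot>\<^bsub>N\<^esub> x = \<theta> (fr.frc (r \<odot>\<^bsub>M\<^esub> m) (v \<otimes>\<^bsub>R\<^esub> t))"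
        by (rule L.unit_smult_cancel[OF N L.hT_unit[OF vt], rotated 2])
          (use s xc \<theta>c[OF fr.frac_in_loc[OF Hc[OF rm] vt]] in auto)
      then show ?thesis using HI[OF rm vt] by simp
    qed
    have z: "\<theta> (fr.frc \<zero>\<^bsub>M\<^esub> \<one>\<^bsub>R\<^esub>) \<in> ?H" by (rule HI[OF Hd(2) T1])
    have "\<zero>\<^bsub>S\<^esub> \<odot>\<^bsub>N\<^esub> \<theta> (fr.frc \<zero>\<^bsub>M\<^esub> \<one>\<^bsub>R\<^esub>) = \<zero>\<^bsub>N\<^esub>"
      using \<theta>c[OF fr.frac_in_loc[OF fr.M.M.zero_closed T1]] by simp
    then show "\<zero>\<^bsub>N\<^esub> \<in> ?H" using cl[OF L.h.S.zero_closed z] by simp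
    fix x y assume "x \<in> ?H" "y \<in> ?H"
    then obtain m t n u where *: "m \<in> H" "t \<in> T" "x = \<theta> (fr.frc m t)" "n \<in> H" "u \<in> T" "y = \<theta> (fr.frc n u)"
      using HE by metis
    have "x \<oplus>\<^bsub>N\<^esub> y = \<theta> (fr.frc (u \<odot>\<^bsub>M\<^esub> m \<oplus>\<^bsub>M\<^esub> t \<odot>\<^bsub>M\<^esub> n) (t \<otimes>\<^bsub>R\<^esub> u))"
      unfolding *(3,6) using add[OF fr.frac_in_loc[OF Hc[OF *(1)] *(2)] fr.frac_in_loc[OF Hc[OF *(4)] *(5)]]
        fr.loc_add[OF Hc[OF *(1)] *(2) Hc[OF *(4)] *(5)] by simp
    then show "x \<oplus>\<^bsub>N\<^esub> y \<in> ?H"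
      using HI[OF Hd(3)[OF Hd(5)[OF L.T_in_R[OF *(5)] *(1)] Hd(5)[OF L.T_in_R[OF *(2)] *(4)]] L.T_closed(1)[OF *(2,5)]]
      by simp
  qed
qed


lemma semilinear_image_submodule:
  assumes B: "module S B" and N: "module S N" and \<Theta>: "\<Theta> \<in> semilinear S (\<lambda>s. s) B N"
    and H: "submodule H S B"
  shows "submodule (\<Theta> ` H) S N"
proof (rule submodule_intro[OF N])
  interpret B: module S B by (rule B)
  note Hd = submodule_closed[OF B H] and \<Theta>d = semilinearD[OF \<Theta>]
  have Hc: "x \<in> carrier B" if "x \<in> H" for x using Hd(1) that by auto
  show "\<Theta> ` H \<subseteq> carrier N" using \<Theta>d(1) Hc by auto
  show "\<zero>\<^bsub>N\<^esub> \<in> \<Theta> ` H" using semilinear_zero[OF B N \<Theta>] Hd(2) by (metis imageI)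
  show "a \<oplus>\<^bsub>N\<^esub> b \<in> \<Theta> ` H" if ab: "a \<in> \<Theta> ` H" "b \<in> \<Theta> ` H" for a b
  proof -
    obtain x y where xy: "x \<in> H" "y \<in> H" "a = \<Theta> x" "b = \<Theta> y" using ab by auto
    then have "a \<oplus>\<^bsub>N\<^esub> b = \<Theta> (x \<oplus>\<^bsub>B\<^esub> y)" using \<Theta>d(2) Hc by simp
    then show ?thesis using Hd(3)[OF xy(1,2)] by simp
  qed
  show "s \<odot>\<^bsub>N\<^esub> a \<in> \<Theta> ` H" if s: "s \<in> carrier S" and a: "a \<in> \<Theta> ` H" for s a
  proof -
    obtain x where x: "x \<in> H" "a = \<Theta> x" using a by auto
    then have "s \<odot>\<^bsub>N\<^esub> a = \<Theta> (s \<odot>\<^bsub>B\<^esub> x)" using \<Theta>d(3) Hc s by simp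
    then show ?thesis using Hd(5)[OF s x(1)] by simp
  qed
qed

text \<open>The preimage of the ideal of \<open>frob_mem_ideal\<close> under multiplication by c. It
  is applied with c replaced by a multiplier times an element of b_q, in order to find 1 or a power
  of g in it.\<close>

lemma frob_mem_colon_ideal:
  assumes M: "module R M" and L: "submodule L R M" and z: "z \<in> carrier M" and c: "c \<in> carrier R"
  shows "ideal {s \<in> carrier R. frob_mem p e R M L z (s \<otimes>\<^bsub>R\<^esub> c)} R"
proof -
  interpret M: module R M by (rule M)
  note I = M.R.idealD(1-4)[OF frob_mem_ideal[OF M L z, of p e]]
  show ?thesis
    by (rule M.R.ideal_intro) (use I(2-4) c in \<open>auto simp: M.R.l_distr M.R.m_assoc\<close>)
qed

section \<open>Tight closure over a scheme\<close>

locale p_sheaves =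
  fixes p :: nat and X :: "('a, 'r) ringed_space" and b :: "nat \<Rightarrow> 'a set \<Rightarrow> 'r set"
  assumes X: "ringed_space X" and ln: "locally_noetherian X" and b: "p_system_of_ideal_sheaves p X b"
begin

lemma b_qc: "1 \<le> e \<Longrightarrow> quasi_coherent_ideal_sheaf X (b e)"
  using b by (simp add: p_system_of_ideal_sheaves_def)

lemma b_ideal: "\<lbrakk>1 \<le> e; openin (space_of X) U\<rbrakk> \<Longrightarrow> ideal (b e U) (sections X U)"
  using b_qc[of e] by (simp add: quasi_coherent_ideal_sheaf_def ideal_sheaf_def)

lemma b_carrier: "\<lbrakk>1 \<le> e; openin (space_of X) U\<rbrakk> \<Longrightarrow> b e U \<subseteq> carrier (sections X U)"
  using cring.idealD(1)[OF ringed_spaceD(1)[OF X] b_ideal] by simp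

lemma b_res:
  assumes "1 \<le> e" "openin (space_of X) U" "openin (space_of X) V" "V \<subseteq> U" "a \<in> b e U"
  shows "res X U V a \<in> b e V"
proof -
  have "res X U V ` b e U \<subseteq> b e V"
    using b_qc[OF assms(1)] assms(2-4) by (simp add: quasi_coherent_ideal_sheaf_def ideal_sheaf_def)
  then show ?thesis using assms(5) by auto
qed

text \<open>The threshold \<open>e0\<close> and the image of the multiplier c serve on V as well.
  The difficulty is that b_e(V) need not be the image of b_e(U): for a in b_e(V) one only gets f^n a
  = h m with m in b_e(U), where n depends on f, e and a.\<close>

lemma tight_closure_base_change:
  assumes U: "affine_open X U" and V: "affine_open X V" "V \<subseteq> U"
    and M: "module (sections X U) M" and L: "submodule L (sections X U) M"
    and x: "x \<in> tight_closure p (sections X U) (\<lambda>e. b e U) M L"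
    and N: "module (sections X V) N" and \<phi>: "\<phi> \<in> semilinear (sections X U) (res X U V) M N"
    and L': "submodule L' (sections X V) N" "\<phi> ` L \<subseteq> L'"
  shows "\<phi> x \<in> tight_closure p (sections X V) (\<lambda>e. b e V) N L'"
proof -
  let ?R = "sections X U" and ?S = "sections X V" and ?h = "res X U V"
  have Uo: "openin (space_of X) U" and Vo: "openin (space_of X) V" using U V by (auto simp: affine_open_def)
  have R: "cring ?R" and S: "cring ?S" using ringed_spaceD(1)[OF X] Uo Vo by auto
  interpret R: cring ?R by (rule R)
  interpret S: cring ?S by (rule S)
  note h = ringed_spaceD(2)[OF X Uo Vo V(2)]
  note hc = ring_hom_closed[OF h]
  obtain c e0 where c: "x \<in> carrier M" "c \<in> off_minimal_primes ?R"
    "\<And>e a. \<lbrakk>e \<ge> 1; e0 \<le> e; a \<in> b e U\<rbrakk> \<Longrightarrow> frob_mem p e ?R M L x (c \<otimes>\<^bsub>?R\<^esub> a)"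
    using x unfolding tight_closure_iff by metis
  have cR: "c \<in> carrier ?R" using c(2) by (simp add: off_minimal_primes_def)
  let ?F = "{f \<in> carrier ?R. basic_open X U f \<subseteq> V}"
  have one: "\<one>\<^bsub>?S\<^esub> \<in> Idl\<^bsub>?S\<^esub> (?h ` ?F)"
  proof (rule affine_basic_open_cover[OF X V(1)])
    show "?h ` ?F \<subseteq> carrier ?S" using hc by auto
    show "V \<subseteq> (\<Union>f\<in>?h ` ?F. basic_open X V f)"
    proof
      fix v assume v: "v \<in> V"
      obtain f where f: "f \<in> carrier ?R" "v \<in> basic_open X U f" "basic_open X U f \<subseteq> V"
        using affine_basic_open_base[OF X U Vo V(2) v] by auto
      have "v \<in> basic_open X V (?h f)" using basic_open_restrict[OF X Uo Vo V(2) f(1)] f(2) v by simp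
      then show "v \<in> (\<Union>f\<in>?h ` ?F. basic_open X V f)" using f by auto
    qed
  qed
  have hF: "?h ` ?F \<subseteq> carrier ?S" using hc by auto
  have off: "?h c \<in> off_minimal_primes ?S"
    by (rule off_minimal_primes_push[OF R S h _ _ one c(2)])
      (use affine_subset_localization(1)[OF X U V] in auto)
  have "frob_mem p e ?S N L' (\<phi> x) (?h c \<otimes>\<^bsub>?S\<^esub> a)" if e: "e \<ge> 1" "e0 \<le> e" and a: "a \<in> b e V" for e a
  proof -
    have ac: "a \<in> carrier ?S" using b_carrier[OF e(1) Vo] a by auto
    have hca: "?h c \<otimes>\<^bsub>?S\<^esub> a \<in> carrier ?S" using hc[OF cR] ac by simp
    have \<phi>x: "\<phi> x \<in> carrier N" by (rule semilinearD(1)[OF \<phi> c(1)])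
    let ?I = "{s \<in> carrier ?S. frob_mem p e ?S N L' (\<phi> x) (s \<otimes>\<^bsub>?S\<^esub> (?h c \<otimes>\<^bsub>?S\<^esub> a))}"
    have "\<one>\<^bsub>?S\<^esub> \<in> ?I"
    proof (rule S.one_in_ideal_if_powers[OF frob_mem_colon_ideal[OF N L'(1) \<phi>x hca] hF _ one])
      fix g assume "g \<in> ?h ` ?F"
      then obtain f where f: "f \<in> carrier ?R" "basic_open X U f \<subseteq> V" "g = ?h f" by auto
      let ?W = "basic_open X U f"
      have "res X V ?W a \<in> b e ?W" by (rule b_res[OF e(1) Vo basic_open_openin f(2) a])
      \<comment> \<open>Quasi-coherence clears the denominator of a over U_f. Since U_f lies in V,
        the resulting equation can be brought back to O(V).\<close>
      from affine_subset_localization(2)[OF X U V f(1,2) b_ideal[OF e(1) Uo] ac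
          quasi_coherent_numerator[OF X b_qc[OF e(1)] U f(1) this]]
      obtain t m where tm: "t \<in> powers ?R f" "m \<in> b e U" "?h t \<otimes>\<^bsub>?S\<^esub> a = ?h m" by auto
      then obtain n :: nat where n: "t = f [^]\<^bsub>?R\<^esub> n" by (auto simp: powers_def)
      have tR: "t \<in> carrier ?R" using n f(1) by simp
      have mR: "m \<in> carrier ?R" using b_carrier[OF e(1) Uo] tm(2) by auto
      have "frob_mem p e ?S N L' (\<phi> x) (?h (c \<otimes>\<^bsub>?R\<^esub> m))"
        by (rule frob_mem_push[OF M L N h \<phi> L' c(1) _ c(3)[OF e tm(2)]]) (use cR mR in simp)
      also have "?h (c \<otimes>\<^bsub>?R\<^esub> m) = ?h t \<otimes>\<^bsub>?S\<^esub> (?h c \<otimes>\<^bsub>?S\<^esub> a)"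
        using ring_hom_mult[OF h cR mR] tm(3)[symmetric] hc[OF cR] hc[OF tR] ac by (simp add: S.m_lcomm)
      also have "?h t = g [^]\<^bsub>?S\<^esub> n" unfolding n f(3) by (rule ring_hom_nat_pow[OF R S h f(1)])
      finally show "\<exists>k::nat. g [^]\<^bsub>?S\<^esub> k \<in> ?I" using hc[OF f(1)] f(3) by (intro exI[of _ n]) simp
    qed
    then show ?thesis using hca by simp
  qed
  then show ?thesis
    unfolding tight_closure_iff using semilinearD(1)[OF \<phi> c(1)] off by blast
qed

lemma sheaf_tight_closure_openly_persistent:
  "openly_persistent X (sheaf_tight_closure p X b :: 'a set \<Rightarrow> ('r, 'm) module \<Rightarrow> 'm set \<Rightarrow> 'm set)"
  unfolding openly_persistent_def Let_def sheaf_tight_closure_def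
proof (intro allI impI, elim conjE)
  fix U V and M :: "('r, 'm) module" and L x and N :: "('r, 'm) module" and \<theta>
  let ?R = "sections X U" and ?S = "sections X V" and ?h = "res X U V"
  assume U: "affine_open X U" and V: "affine_open X V" "V \<subseteq> U"
    and M: "module ?R M" and L: "submodule L ?R M"
    and x: "x \<in> tight_closure p ?R (\<lambda>e. b e U) M L"
    and N: "module ?S N" and \<theta>: "\<theta> \<in> mod_iso ?S (base_change ?R ?S ?h M) N"
  have Uo: "openin (space_of X) U" and Vo: "openin (space_of X) V" using U V by (auto simp: affine_open_def)
  note h = ringed_spaceD(2)[OF X Uo Vo V(2)]
  interpret BC: base_change_setup ?R ?S ?h M
    by (intro base_change_setup.intro M ringed_spaceD(1)[OF X Vo]) (use ring_hom_closed[OF h] in auto)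
  have \<theta>': "\<theta> \<in> semilinear ?S (\<lambda>s. s) BC.B N"
    using \<theta> by (auto simp: mod_iso_def semilinear_def bij_betw_def)
  note el = semilinearD[OF BC.base_change_elt_semilinear] and \<theta>d = semilinearD[OF \<theta>']
  \<comment> \<open>Open persistence is \<open>tight_closure_base_change\<close> for the map m ->
    \<theta>(1 \<otimes> m).\<close>
  have \<phi>: "(\<lambda>m. \<theta> (BC.elt m)) \<in> semilinear ?R ?h M N"
    unfolding semilinear_def using el \<theta>d ring_hom_closed[OF h] by simp
  show "\<theta> (BC.elt x) \<in> tight_closure p ?S (\<lambda>e. b e V) N (\<theta> ` base_change_image ?R ?S ?h M L)"
    by (rule tight_closure_base_change[OF U V M L x N \<phi>
          semilinear_image_submodule[OF BC.base_change_module N \<theta>' BC.base_change_image_submodule[OF L]]])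
      (use BC.base_change_elt_image[OF L] in auto)
qed

text \<open>Brings the condition over R_f back to R, so that the copies N for different f no longer
  matter. The order of quantifiers is the point: c and \<open>e0\<close> come before e and a, and
  only the exponent n may vary with them.\<close>

lemma closure_at_clear_denominators:
  assumes U: "affine_open X U" and f: "f \<in> carrier (sections X U)"
    and M: "module (sections X U) M" and L: "submodule L (sections X U) M" and z: "z \<in> carrier M"
    and loc: "is_localization_at X U f M N \<theta>"
    and cl: "in_closure_at X (sheaf_tight_closure p X b) U f M L z N \<theta>"
  shows "\<exists>c \<in> off_minimal_primes (sections X U). \<exists>e0. \<forall>e\<ge>1. e0 \<le> e \<longrightarrow> (\<forall>a \<in> b e U.
    \<exists>n::nat. frob_mem p e (sections X U) M L z (f [^]\<^bsub>sections X U\<^esub> n \<otimes>\<^bsub>sections X U\<^esub> (c \<otimes>\<^bsub>sections X U\<^esub> a)))"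
proof -
  let ?R = "sections X U" and ?V = "basic_open X U f" and ?T = "powers (sections X U) f"
  let ?S = "sections X ?V" and ?h = "res X U ?V"
  have Uo: "openin (space_of X) U" using U by (auto simp: affine_open_def)
  have Vo: "openin (space_of X) ?V" by (rule basic_open_openin)
  note units = affine_basic_open_localization[OF X U f]
  interpret L: ring_loc_units ?R ?S ?h ?T by (rule units)
  have N: "module ?S N" and \<theta>: "\<theta> \<in> mod_iso ?R (loc_module ?R ?T M) (restrict_scalars ?h N)"
    using loc by (auto simp: is_localization_at_def Let_def)
  let ?\<phi> = "\<lambda>m. \<theta> (fraction ?R ?T M m \<one>\<^bsub>?R\<^esub>)" and ?L = "\<theta> ` loc_submodule ?R ?T M L"
  note la = localization_at[OF units M L N \<theta>]
  have "?\<phi> z \<in> tight_closure p ?S (\<lambda>e. b e ?V) N ?L"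
    using cl by (simp add: in_closure_at_def Let_def sheaf_tight_closure_def)
  then obtain c e0 where c: "c \<in> off_minimal_primes ?S"
    "\<And>e a. \<lbrakk>e \<ge> 1; e0 \<le> e; a \<in> b e ?V\<rbrakk> \<Longrightarrow> frob_mem p e ?S N ?L (?\<phi> z) (c \<otimes>\<^bsub>?S\<^esub> a)"
    unfolding tight_closure_iff by metis
  have cS: "c \<in> carrier ?S" using c(1) by (simp add: off_minimal_primes_def)
  \<comment> \<open>c' is a numerator of c. Since h c' is c times the unit h t, it still avoids the
    minimal primes of S.\<close>
  obtain t c' where t: "t \<in> ?T" "c' \<in> carrier ?R" "?h t \<otimes>\<^bsub>?S\<^esub> c = ?h c'" using L.surj[OF cS] by auto
  have tR: "t \<in> carrier ?R" by (rule L.T_in_R[OF t(1)])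
  have hc': "?h c' \<in> off_minimal_primes ?S"
  proof -
    have "?h t \<notin> P" if P: "P \<in> minimal_primes ?S" for P
    proof
      assume "?h t \<in> P"
      have Pp: "primeideal P ?S" using P by (simp add: minimal_primes_def)
      have "inv\<^bsub>?S\<^esub> (?h t) \<otimes>\<^bsub>?S\<^esub> ?h t \<in> P"
        by (rule L.h.S.idealD(4)[OF L.h.S.primeD(1)[OF Pp] _ \<open>?h t \<in> P\<close>]) (use L.hT_unit[OF t(1)] in simp)
      then show False using L.h.S.primeD(2)[OF Pp] L.hT_unit[OF t(1)] by simp
    qed
    then have "?h t \<in> off_minimal_primes ?S" using tR by (auto simp: off_minimal_primes_def)
    then show ?thesis using off_minimal_primes_mult[OF L.S _ c(1), of "?h t"] t(3) by simp
  qed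
  have "c' \<notin> P" if P: "P \<in> minimal_primes ?R" "f \<notin> P" for P
  proof (rule L.off_minimal_primes_pull[OF t(2) hc' P(1)])
    show "P \<inter> ?T = {}"
      using powers_disjoint_prime[OF L.R _ f P(2)] P(1) by (auto simp: minimal_primes_def)
  qed
  \<comment> \<open>c' may lie in minimal primes of R that contain f. The replacement d lies in
    none, and it agrees with c' after multiplication by f^k.\<close>
  from noetherian_lift_off_minimal_primes[OF L.R locally_noetherian_affine[OF X ln U] f t(2) this]
  obtain d and k :: nat where d: "d \<in> off_minimal_primes ?R"
    "f [^]\<^bsub>?R\<^esub> k \<otimes>\<^bsub>?R\<^esub> d = f [^]\<^bsub>?R\<^esub> k \<otimes>\<^bsub>?R\<^esub> c'" by auto
  have dR: "d \<in> carrier ?R" using d(1) by (simp add: off_minimal_primes_def)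
  have fk: "f [^]\<^bsub>?R\<^esub> k \<in> carrier ?R" using f by simp
  have "\<exists>n::nat. frob_mem p e ?R M L z (f [^]\<^bsub>?R\<^esub> n \<otimes>\<^bsub>?R\<^esub> (d \<otimes>\<^bsub>?R\<^esub> a))"
    if e: "e \<ge> 1" "e0 \<le> e" and a: "a \<in> b e U" for e a
  proof -
    have aR: "a \<in> carrier ?R" using b_carrier[OF e(1) Uo] a by auto
    have "?h a \<in> b e ?V" by (rule b_res[OF e(1) Uo Vo basic_open_subset a])
    note mem = c(2)[OF e this]
    have \<phi>z: "?\<phi> z \<in> carrier N"
      using la(1) z unfolding module_localization_def semilinear_def by auto
    \<comment> \<open>The factor t turns c into c', and the factor f^k then trades c' for d.\<close>
    have "frob_mem p e ?S N ?L (?\<phi> z) (?h (f [^]\<^bsub>?R\<^esub> k \<otimes>\<^bsub>?R\<^esub> t) \<otimes>\<^bsub>?S\<^esub> (c \<otimes>\<^bsub>?S\<^esub> ?h a))"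
      by (rule frob_mem_multc[OF N la(2) \<phi>z mem]) (use cS aR fk tR in auto)
    also have "?h (f [^]\<^bsub>?R\<^esub> k \<otimes>\<^bsub>?R\<^esub> t) \<otimes>\<^bsub>?S\<^esub> (c \<otimes>\<^bsub>?S\<^esub> ?h a) = ?h (f [^]\<^bsub>?R\<^esub> k) \<otimes>\<^bsub>?S\<^esub> (?h t \<otimes>\<^bsub>?S\<^esub> c) \<otimes>\<^bsub>?S\<^esub> ?h a"
      using cS aR fk tR by (simp add: L.h.S.m_assoc)
    also have "\<dots> = ?h (f [^]\<^bsub>?R\<^esub> k \<otimes>\<^bsub>?R\<^esub> c' \<otimes>\<^bsub>?R\<^esub> a)" unfolding t(3) using t(2) aR fk by simp
    also have "f [^]\<^bsub>?R\<^esub> k \<otimes>\<^bsub>?R\<^esub> c' \<otimes>\<^bsub>?R\<^esub> a = f [^]\<^bsub>?R\<^esub> k \<otimes>\<^bsub>?R\<^esub> (d \<otimes>\<^bsub>?R\<^esub> a)"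
      unfolding d(2)[symmetric] using fk dR aR by (rule L.h.R.m_assoc)
    finally have "frob_mem p e ?S N ?L (?\<phi> z) (?h (f [^]\<^bsub>?R\<^esub> k \<otimes>\<^bsub>?R\<^esub> (d \<otimes>\<^bsub>?R\<^esub> a)))" .
    then have "\<exists>u\<in>?T. frob_mem p e ?R M L z (u \<otimes>\<^bsub>?R\<^esub> (f [^]\<^bsub>?R\<^esub> k \<otimes>\<^bsub>?R\<^esub> (d \<otimes>\<^bsub>?R\<^esub> a)))"
      by (intro frob_mem_pull[OF M L units N la(1,2) _ z]) (use la(4) fk dR aR in auto)
    then obtain n :: nat where
      n: "frob_mem p e ?R M L z (f [^]\<^bsub>?R\<^esub> n \<otimes>\<^bsub>?R\<^esub> (f [^]\<^bsub>?R\<^esub> k \<otimes>\<^bsub>?R\<^esub> (d \<otimes>\<^bsub>?R\<^esub> a)))"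
      by (auto simp: powers_def)
    have "f [^]\<^bsub>?R\<^esub> n \<otimes>\<^bsub>?R\<^esub> (f [^]\<^bsub>?R\<^esub> k \<otimes>\<^bsub>?R\<^esub> (d \<otimes>\<^bsub>?R\<^esub> a)) = f [^]\<^bsub>?R\<^esub> (n + k) \<otimes>\<^bsub>?R\<^esub> (d \<otimes>\<^bsub>?R\<^esub> a)"
      using f fk dR aR by (simp add: L.h.R.m_assoc[symmetric] L.h.R.nat_pow_mult)
    then show ?thesis using n by auto
  qed
  then show ?thesis using d(1) by blast
qed

lemma closure_at_glue:
  assumes U: "affine_open X U" and A: "A \<subseteq> carrier (sections X U)"
    and g: "g \<in> radical (sections X U) (Idl\<^bsub>sections X U\<^esub> A)"
    and M: "module (sections X U) M" and L: "submodule L (sections X U) M" and z: "z \<in> carrier M"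
    and cl: "\<And>f. f \<in> A \<Longrightarrow> \<exists>N \<theta>. is_localization_at X U f M N \<theta>
      \<and> in_closure_at X (sheaf_tight_closure p X b) U f M L z N \<theta>"
    and loc: "is_localization_at X U g M N \<theta>"
  shows "in_closure_at X (sheaf_tight_closure p X b) U g M L z N \<theta>"
proof -
  let ?R = "sections X U" and ?V = "basic_open X U g" and ?T = "powers (sections X U) g"
  let ?S = "sections X ?V" and ?h = "res X U ?V"
  have Uo: "openin (space_of X) U" using U by (auto simp: affine_open_def)
  have Vo: "openin (space_of X) ?V" by (rule basic_open_openin)
  obtain k :: nat where gR: "g \<in> carrier ?R" and k: "g [^]\<^bsub>?R\<^esub> k \<in> Idl\<^bsub>?R\<^esub> A" using g by (auto simp: radical_def)
  note units = affine_basic_open_localization[OF X U gR]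
  interpret L: ring_loc_units ?R ?S ?h ?T by (rule units)
  have N: "module ?S N" and \<theta>: "\<theta> \<in> mod_iso ?R (loc_module ?R ?T M) (restrict_scalars ?h N)"
    using loc by (auto simp: is_localization_at_def Let_def)
  let ?\<phi> = "\<lambda>m. \<theta> (fraction ?R ?T M m \<one>\<^bsub>?R\<^esub>)" and ?L = "\<theta> ` loc_submodule ?R ?T M L"
  note la = localization_at[OF units M L N \<theta>]
  have \<phi>: "?\<phi> \<in> semilinear ?R ?h M N" using la(1) by (simp add: module_localization_def)
  \<comment> \<open>Finitely many f suffice for a power of g. This is what allows a common threshold
    and a product of multipliers.\<close>
  obtain F where F: "F \<subseteq> A" "finite F" "g [^]\<^bsub>?R\<^esub> k \<in> Idl\<^bsub>?R\<^esub> F"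
    using L.h.R.finite_generators[OF A k] by auto
  have FR: "F \<subseteq> carrier ?R" using F(1) A by auto
  define Q where "Q f c e0 \<longleftrightarrow> (\<forall>e\<ge>1. e0 \<le> e \<longrightarrow> (\<forall>a \<in> b e U.
    \<exists>n::nat. frob_mem p e ?R M L z (f [^]\<^bsub>?R\<^esub> n \<otimes>\<^bsub>?R\<^esub> (c \<otimes>\<^bsub>?R\<^esub> a))))" for f c e0
  have "\<forall>f\<in>F. \<exists>c. c \<in> off_minimal_primes ?R \<and> (\<exists>e0. Q f c e0)"
  proof
    fix f assume f: "f \<in> F"
    then obtain N' \<theta>' where N': "is_localization_at X U f M N' \<theta>'"
      "in_closure_at X (sheaf_tight_closure p X b) U f M L z N' \<theta>'" using cl[of f] F(1) by auto
    from closure_at_clear_denominators[OF U _ M L z N'] f FR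
    show "\<exists>c. c \<in> off_minimal_primes ?R \<and> (\<exists>e0. Q f c e0)" unfolding Q_def by auto
  qed
  then obtain c where c: "\<And>f. f \<in> F \<Longrightarrow> c f \<in> off_minimal_primes ?R" "\<And>f. f \<in> F \<Longrightarrow> \<exists>e0. Q f (c f) e0"
    by metis
  have "\<exists>e0. \<forall>f\<in>F. Q f (c f) e0"
    by (rule finite_uniform_bound[OF F(2) c(2)]) (auto simp: Q_def)
  then obtain e0 where e0: "\<And>f. f \<in> F \<Longrightarrow> Q f (c f) e0" by auto
  obtain d where d: "d \<in> off_minimal_primes ?R" "\<And>f. f \<in> F \<Longrightarrow> \<exists>r\<in>carrier ?R. d = r \<otimes>\<^bsub>?R\<^esub> c f"
    using off_minimal_primes_finprod[OF L.R F(2), of c] c(1) by auto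
  have dR: "d \<in> carrier ?R" using d(1) by (simp add: off_minimal_primes_def)
  have gT: "g \<in> ?T" unfolding powers_def using gR by (intro CollectI exI[of _ 1]) simp
  have hg: "?h g \<in> Units ?S" by (rule L.hT_unit[OF gT])
  \<comment> \<open>Over U_g the single element h g generates 1, so
    \<open>off_minimal_primes_push\<close> applies to the one-element family consisting of
    g.\<close>
  have one: "\<one>\<^bsub>?S\<^esub> \<in> Idl\<^bsub>?S\<^esub> (?h ` {g})"
  proof -
    have sub: "?h ` {g} \<subseteq> carrier ?S" using gR by simp
    have "inv\<^bsub>?S\<^esub> (?h g) \<otimes>\<^bsub>?S\<^esub> ?h g \<in> Idl\<^bsub>?S\<^esub> (?h ` {g})"
      by (rule L.h.S.idealD(4)[OF L.h.S.genideal_ideal[OF sub]])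
        (use hg L.h.S.genideal_self[OF sub] in auto)
    then show ?thesis using hg by simp
  qed
  have off: "?h d \<in> off_minimal_primes ?S"
    by (rule off_minimal_primes_push[OF L.R L.S L.hom _ _ one d(1)]) (use gR L.loc in auto)
  have \<phi>z: "?\<phi> z \<in> carrier N" by (rule semilinearD(1)[OF \<phi> z])
  have "frob_mem p e ?S N ?L (?\<phi> z) (?h d \<otimes>\<^bsub>?S\<^esub> a)" if e: "e \<ge> 1" "e0 \<le> e" and a: "a \<in> b e ?V" for e a
  proof -
    have aS: "a \<in> carrier ?S" using b_carrier[OF e(1) Vo] a by auto
    \<comment> \<open>a is a section over U_g only, whereas the relations obtained for the f concern
      b_e(U); hence the passage to a numerator m.\<close>
    obtain t m where tm: "t \<in> ?T" "m \<in> b e U" "?h t \<otimes>\<^bsub>?S\<^esub> a = ?h m"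
      using quasi_coherent_numerator[OF X b_qc[OF e(1)] U gR a] by auto
    have tR: "t \<in> carrier ?R" by (rule L.T_in_R[OF tm(1)])
    have mR: "m \<in> carrier ?R" using b_carrier[OF e(1) Uo] tm(2) by auto
    have dm: "d \<otimes>\<^bsub>?R\<^esub> m \<in> carrier ?R" using dR mR by simp
    let ?I = "{s \<in> carrier ?R. frob_mem p e ?R M L z (s \<otimes>\<^bsub>?R\<^esub> (d \<otimes>\<^bsub>?R\<^esub> m))}"
    \<comment> \<open>d is a multiple of each \<open>c f\<close>, so the relation for
      \<open>c f\<close> holds for d with the same power of f. The powers of the f then yield a
      power of g.\<close>
    have "\<exists>n::nat. g [^]\<^bsub>?R\<^esub> n \<in> ?I"
    proof (rule L.h.R.radical_generators[OF frob_mem_colon_ideal[OF M L z dm] FR _ gR F(3)])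
      fix f assume f: "f \<in> F"
      have fR: "f \<in> carrier ?R" using f FR by auto
      have cf: "c f \<in> carrier ?R" using c(1)[OF f] by (simp add: off_minimal_primes_def)
      obtain n :: nat where n: "frob_mem p e ?R M L z (f [^]\<^bsub>?R\<^esub> n \<otimes>\<^bsub>?R\<^esub> (c f \<otimes>\<^bsub>?R\<^esub> m))"
        using e0[OF f] e tm(2) unfolding Q_def by blast
      obtain r where r: "r \<in> carrier ?R" "d = r \<otimes>\<^bsub>?R\<^esub> c f" using d(2)[OF f] by auto
      have "frob_mem p e ?R M L z (r \<otimes>\<^bsub>?R\<^esub> (f [^]\<^bsub>?R\<^esub> n \<otimes>\<^bsub>?R\<^esub> (c f \<otimes>\<^bsub>?R\<^esub> m)))"
        by (rule frob_mem_multc[OF M L z n]) (use r fR cf mR in auto)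
      also have "r \<otimes>\<^bsub>?R\<^esub> (f [^]\<^bsub>?R\<^esub> n \<otimes>\<^bsub>?R\<^esub> (c f \<otimes>\<^bsub>?R\<^esub> m)) = f [^]\<^bsub>?R\<^esub> n \<otimes>\<^bsub>?R\<^esub> (d \<otimes>\<^bsub>?R\<^esub> m)"
        unfolding r(2) using r(1) fR cf mR by (simp add: L.h.R.m_ac)
      finally show "\<exists>n::nat. f [^]\<^bsub>?R\<^esub> n \<in> ?I" using fR by (intro exI[of _ n]) simp
    qed
    then obtain n :: nat where n: "frob_mem p e ?R M L z (g [^]\<^bsub>?R\<^esub> n \<otimes>\<^bsub>?R\<^esub> (d \<otimes>\<^bsub>?R\<^esub> m))" by auto
    have gn: "g [^]\<^bsub>?R\<^esub> n \<in> ?T" by (auto simp: powers_def)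
    have gnR: "g [^]\<^bsub>?R\<^esub> n \<in> carrier ?R" using gR by simp
    \<comment> \<open>Both g^n and the denominator t of a become units over U_g, so they can be
      divided out after pushing forward.\<close>
    let ?u = "?h (g [^]\<^bsub>?R\<^esub> n \<otimes>\<^bsub>?R\<^esub> t)"
    have u: "?u \<in> Units ?S" by (rule L.hT_unit[OF L.T_closed(1)[OF gn tm(1)]])
    have "frob_mem p e ?S N ?L (?\<phi> z) (?h (g [^]\<^bsub>?R\<^esub> n \<otimes>\<^bsub>?R\<^esub> (d \<otimes>\<^bsub>?R\<^esub> m)))"
      by (rule frob_mem_push[OF M L N L.hom \<phi> la(2) _ z _ n]) (use la(3) gnR dm in auto)
    also have "?h (g [^]\<^bsub>?R\<^esub> n \<otimes>\<^bsub>?R\<^esub> (d \<otimes>\<^bsub>?R\<^esub> m)) = ?u \<otimes>\<^bsub>?S\<^esub> (?h d \<otimes>\<^bsub>?S\<^esub> a)"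
    proof -
      have "?h (g [^]\<^bsub>?R\<^esub> n \<otimes>\<^bsub>?R\<^esub> (d \<otimes>\<^bsub>?R\<^esub> m)) = ?h (g [^]\<^bsub>?R\<^esub> n) \<otimes>\<^bsub>?S\<^esub> (?h d \<otimes>\<^bsub>?S\<^esub> (?h t \<otimes>\<^bsub>?S\<^esub> a))"
        unfolding tm(3) using gnR dR mR by simp
      also have "\<dots> = (?h (g [^]\<^bsub>?R\<^esub> n) \<otimes>\<^bsub>?S\<^esub> ?h t) \<otimes>\<^bsub>?S\<^esub> (?h d \<otimes>\<^bsub>?S\<^esub> a)"
        using L.h.hom_closed[OF gnR] L.h.hom_closed[OF dR] L.h.hom_closed[OF tR] aS by (simp only: L.h.S.m_ac L.h.S.m_closed)
      also have "\<dots> = ?u \<otimes>\<^bsub>?S\<^esub> (?h d \<otimes>\<^bsub>?S\<^esub> a)" using L.h.hom_mult[OF gnR tR] by simp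
      finally show ?thesis .
    qed
    finally have *: "frob_mem p e ?S N ?L (?\<phi> z) (?u \<otimes>\<^bsub>?S\<^esub> (?h d \<otimes>\<^bsub>?S\<^esub> a))" .
    have hda: "?h d \<otimes>\<^bsub>?S\<^esub> a \<in> carrier ?S" using dR aS by simp
    have uc: "?u \<in> carrier ?S" by (rule L.h.S.Units_closed[OF u])
    have "frob_mem p e ?S N ?L (?\<phi> z) (inv\<^bsub>?S\<^esub> ?u \<otimes>\<^bsub>?S\<^esub> (?u \<otimes>\<^bsub>?S\<^esub> (?h d \<otimes>\<^bsub>?S\<^esub> a)))"
      by (rule frob_mem_multc[OF N la(2) \<phi>z *]) (use uc hda u in simp_all)
    moreover have "inv\<^bsub>?S\<^esub> ?u \<otimes>\<^bsub>?S\<^esub> (?u \<otimes>\<^bsub>?S\<^esub> (?h d \<otimes>\<^bsub>?S\<^esub> a)) = ?h d \<otimes>\<^bsub>?S\<^esub> a"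
      using L.h.S.m_assoc[OF L.h.S.Units_inv_closed[OF u] uc hda] L.h.S.Units_l_inv[OF u] hda by simp
    ultimately show ?thesis by simp
  qed
  then have "?\<phi> z \<in> tight_closure p ?S (\<lambda>e. b e ?V) N ?L"
    unfolding tight_closure_iff using \<phi>z off by blast
  then show ?thesis by (simp add: in_closure_at_def Let_def sheaf_tight_closure_def)
qed

lemma sheaf_tight_closure_preclosure:
  "preclosure_operation X (sheaf_tight_closure p X b :: 'a set \<Rightarrow> ('r, 'm) module \<Rightarrow> 'm set \<Rightarrow> 'm set)"
  unfolding preclosure_operation_def sheaf_tight_closure_def
proof (intro allI impI, elim conjE)
  fix U and M :: "('r, 'm) module"
  assume U: "affine_open X U" and M: "module (sections X U) M"
  have "b e U \<subseteq> carrier (sections X U)" if "1 \<le> e" for e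
    using b_carrier[OF that] U by (simp add: affine_open_def)
  note tc = tight_closure_preclosure[where b = "\<lambda>e. b e U" and p = p, OF M _ this]
  show "(\<forall>L. submodule L (sections X U) M \<longrightarrow>
          submodule (tight_closure p (sections X U) (\<lambda>e. b e U) M L) (sections X U) M
          \<and> L \<subseteq> tight_closure p (sections X U) (\<lambda>e. b e U) M L)
      \<and> (\<forall>L L'. submodule L (sections X U) M \<and> submodule L' (sections X U) M \<and> L \<subseteq> L' \<longrightarrow>
          tight_closure p (sections X U) (\<lambda>e. b e U) M L \<subseteq> tight_closure p (sections X U) (\<lambda>e. b e U) M L')"
    using tc by simp
qed

lemma sheaf_tight_closure_glueable:
  "glueable X (sheaf_tight_closure p X b :: 'a set \<Rightarrow> ('r, 'm) module \<Rightarrow> 'm set \<Rightarrow> 'm set)"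
  unfolding glueable_def Let_def
proof (intro conjI sheaf_tight_closure_openly_persistent allI impI, elim conjE)
  fix U A I g and M N :: "('r, 'm) module" and L z \<theta>
  assume *: "affine_open X U" "A \<subseteq> carrier (sections X U)" "I = Idl\<^bsub>sections X U\<^esub> A"
    "g \<in> radical (sections X U) I" "module (sections X U) M" "submodule L (sections X U) M" "z \<in> carrier M"
    "\<forall>f\<in>A. \<exists>N \<theta>. is_localization_at X U f M N \<theta>
      \<and> in_closure_at X (sheaf_tight_closure p X b) U f M L z N \<theta>"
    "is_localization_at X U g M N \<theta>"
  show "in_closure_at X (sheaf_tight_closure p X b) U g M L z N \<theta>"
    by (rule closure_at_glue[OF *(1,2) _ *(5-7) bspec[OF *(8)] *(9)]) (use *(3,4) in simp_all)
qed

end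

theorem theorem4p8:
  fixes p :: nat
    and X :: "('a, 'r) ringed_space"
    and b :: "nat \<Rightarrow> 'a set \<Rightarrow> 'r set"
  assumes "Factorial_Ring.prime p"
    and "scheme X"
    and "locally_noetherian X"
    and "Fp_scheme p X"
    and "p_system_of_ideal_sheaves p X b"
  shows "preclosure_operation X
           (sheaf_tight_closure p X b :: 'a set \<Rightarrow> ('r, 'm) module \<Rightarrow> 'm set \<Rightarrow> 'm set)
       \<and> glueable X
           (sheaf_tight_closure p X b :: 'a set \<Rightarrow> ('r, 'm) module \<Rightarrow> 'm set \<Rightarrow> 'm set)"
proof -
  interpret p_sheaves p X b
    using assms by unfold_locales (simp_all add: scheme_def)
  show ?thesis
    by (intro conjI sheaf_tight_closure_preclosure sheaf_tight_closure_glueable)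
qed

end
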